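(* Let $d\in\mathbb N$, $1\le r\le\infty$, $2<p\le\infty$, $0<q<\infty$, let $\psi\in B$, and assume that for all $t$ larger than a certain number $t_0$, $\psi(t)$ is convex and satisfies $$\frac{t|\psi'(t)|}{\psi(t)}\ge\beta,\qquad\psi'(t):=\psi'(t+),$$ with some $\beta>d(1-\frac1q)_+$. Then $$\sigma_m(\mathcal F_{q,r}^\psi)_{L_p}\asymp\psi(m^{1/d})\,m^{\frac12-\frac1q}.$$
   Context: $(a)_+=\max\{0,a\}$. $L_p=L_p(\mathbb T^d)$, $\mathbb T^d=[0,2\pi)^d$, is the space of functions $2\pi$-periodic in each variable with norm $\|f\|_{L_p}=((2\pi)^{-d}\int_{\mathbb T^d}|f|^p\,dx)^{1/p}$ (essential supremum for $p=\infty$). $e_k(x)=e^{i(k,x)}$, $\widehat f(k)=(2\pi)^{-d}\int_{\mathbb T^d}f\,\overline{e_k}\,dx$. For a positive non-increasing $\psi$ on $[1,\infty)$ and $0<q,r\le\infty$, set $\Psi_0=\psi(1)$, $\Psi_k=\psi(|k|_r)$ for $k\in\mathbb Z^d\setminus\{0\}$, where $|k|_r=\|k\|_{\ell_r^d}$, and $\mathcal F_{q,r}^\psi=\{f\in L_1:\|\{\widehat f(k)/\Psi_k\}_{k}\|_{\ell_q(\mathbb Z^d)}\le1\}$. $\Gamma_m$ is the set of all collections $\gamma_m$ of $m$ different vectors of $\mathbb Z^d$; $\sigma_m(\mathfrak N)_{L_p}=\sup_{f\in\mathfrak N}\inf_{\gamma_m\in\Gamma_m}\inf_{c_k\in\mathbb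 C}\|f-\sum_{k\in\gamma_m}c_ke_k\|_{L_p}$. $B$ is the set of all positive non-increasing functions $\psi(t)$, $t\ge1$, for which there is a constant $K$ with $1\le\psi(t)/\psi(2t)\le K$ for all $t\ge1$. $a(m)\asymp b(m)$ means there are constants $0<K_1<K_2$ independent of $m$ with $K_1b(m)\le a(m)\le K_2b(m)$ for all $m\in\mathbb N$. *)

theory Defs
  imports "HOL-Analysis.Analysis" "HOL-Probability.Essential_Supremum"
begin

text \<open>
  Norms take values in \<^typ>\<open>ennreal\<close>, so that a norm, supremum or infinite sum that is infinite
  in the mathematical sense is \<open>\<infinity>\<close> here and not a default value. Exponents in \<open>(0, \<infinity>]\<close> are
  of type \<^typ>\<open>ennreal\<close> as well.
\<close>

text \<open>Real powers on \<open>[0, \<infinity>]\<close>; only used for positive exponents.\<close>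

definition ennreal_powr :: "ennreal \<Rightarrow> real \<Rightarrow> ennreal" where
  "ennreal_powr x a = (if x = \<infinity> then \<infinity> else ennreal (enn2real x powr a))"


subsection \<open>Spaces of periodic functions\<close>

definition torus :: "(real ^ 'd) set" where
  "torus = {x. \<forall>i. 0 \<le> x $ i \<and> x $ i < 2 * pi}"

definition periodic :: "(real ^ 'd \<Rightarrow> complex) \<Rightarrow> bool" where
  "periodic f \<longleftrightarrow> (\<forall>x i. f (x + axis i (2 * pi)) = f x)"

definition Lp_norm :: "ennreal \<Rightarrow> (real ^ 'd \<Rightarrow> complex) \<Rightarrow> ennreal" where
  "Lp_norm p f =
    (if p = \<infinity> then esssup (lebesgue_on torus) (\<lambda>x. ennreal (norm (f x)))
     else ennreal_powr
       (ennreal (1 / (2 * pi) ^ CARD('d)) *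
          (\<integral>\<^sup>+x. ennreal (norm (f x) powr enn2real p) \<partial>lebesgue_on torus))
       (1 / enn2real p))"

definition Lp_space :: "ennreal \<Rightarrow> (real ^ 'd \<Rightarrow> complex) set" where
  "Lp_space p = {f. periodic f \<and> f \<in> borel_measurable (lebesgue_on torus) \<and> Lp_norm p f < \<infinity>}"

definition trig_exp :: "int ^ 'd \<Rightarrow> real ^ 'd \<Rightarrow> complex" where
  "trig_exp k x = exp (\<i> * complex_of_real (\<Sum>i\<in>UNIV. real_of_int (k $ i) * x $ i))"

definition fourier_coeff :: "(real ^ 'd \<Rightarrow> complex) \<Rightarrow> int ^ 'd \<Rightarrow> complex" where
  "fourier_coeff f k =
    complex_of_real (1 / (2 * pi) ^ CARD('d)) *
      (LINT x|lebesgue_on torus. f x * cnj (trig_exp k x))"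


subsection \<open>The function classes\<close>

definition ell_norm :: "ennreal \<Rightarrow> ('i \<Rightarrow> complex) \<Rightarrow> ennreal" where
  "ell_norm q a =
    (if q = \<infinity> then (SUP k. ennreal (norm (a k)))
     else ennreal_powr (\<Sum>\<^sub>\<infinity>k. ennreal (norm (a k) powr enn2real q)) (1 / enn2real q))"

definition index_norm :: "ennreal \<Rightarrow> int ^ 'd \<Rightarrow> real" where
  "index_norm r k =
    (if r = \<infinity> then Max (range (\<lambda>i. \<bar>real_of_int (k $ i)\<bar>))
     else (\<Sum>i\<in>UNIV. \<bar>real_of_int (k $ i)\<bar> powr enn2real r) powr (1 / enn2real r))"

definition Psi :: "(real \<Rightarrow> real) \<Rightarrow> ennreal \<Rightarrow> int ^ 'd \<Rightarrow> real" where
  "Psi \<psi> r k = (if k = 0 then \<psi> 1 else \<psi> (index_norm r k))"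

definition F_class :: "(real \<Rightarrow> real) \<Rightarrow> ennreal \<Rightarrow> ennreal \<Rightarrow> (real ^ 'd \<Rightarrow> complex) set" where
  "F_class \<psi> q r =
    {f \<in> Lp_space 1. ell_norm q (\<lambda>k. fourier_coeff f k / complex_of_real (Psi \<psi> r k)) \<le> 1}"

text \<open>Functions in the class live on \<open>[1, \<infinity>)\<close>; the values of \<open>\<psi>\<close> below \<open>1\<close> are unconstrained and unused.\<close>

definition class_B :: "(real \<Rightarrow> real) set" where
  "class_B = {\<psi>. (\<forall>t\<ge>1. 0 < \<psi> t) \<and> antimono_on {1..} \<psi> \<and>
        (\<exists>K. \<forall>t\<ge>1. 1 \<le> \<psi> t / \<psi> (2 * t) \<and> \<psi> t / \<psi> (2 * t) \<le> K)}"


subsection \<open>Best \<open>m\<close>-term trigonometric approximation\<close>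

definition Gam :: "nat \<Rightarrow> (int ^ 'd) set set" where
  "Gam m = {\<gamma>. finite \<gamma> \<and> card \<gamma> = m}"

definition sigma_m :: "nat \<Rightarrow> (real ^ 'd \<Rightarrow> complex) set \<Rightarrow> ennreal \<Rightarrow> ennreal" where
  "sigma_m m N p =
    (SUP f\<in>N. INF \<gamma>\<in>Gam m. INF c :: int ^ 'd \<Rightarrow> complex.
       Lp_norm p (\<lambda>x. f x - (\<Sum>k\<in>\<gamma>. c k * trig_exp k x)))"

definition same_order :: "(nat \<Rightarrow> ennreal) \<Rightarrow> (nat \<Rightarrow> real) \<Rightarrow> bool" (infix \<open>\<asymp>\<close> 50) where
  "a \<asymp> b \<longleftrightarrow>
    (\<exists>K1 K2. 0 < K1 \<and> K1 < K2 \<and>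
       (\<forall>m\<ge>1. ennreal (K1 * b m) \<le> a m \<and> a m \<le> ennreal (K2 * b m)))"

text \<open>The right derivative \<open>\<psi>'(t+)\<close>; it exists wherever it is used for a convex function.\<close>

definition right_deriv :: "(real \<Rightarrow> real) \<Rightarrow> real \<Rightarrow> real" where
  "right_deriv \<psi> t = vector_derivative \<psi> (at_right t)"

end

theory Submission
  imports Defs "HOL-Library.Real_Mod"
begin

text \<open>
  Since \<open>p > 2\<close>, the lower bound follows from Parseval: for the sum of at least \<open>2 m\<close> exponentials with
  equal coefficients, no choice of \<open>m\<close> frequencies removes more than half of the \<open>L\<^sub>2\<close> mass.

  The upper bound is proved for \<open>p = \<infinity>\<close>. The crucial fact is that a trigonometric polynomial of
  degree \<open>N\<close> with coefficients of \<open>l\<^sub>1\<close> norm \<open>1\<close> has an \<open>m\<close>-term approximant with uniform error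
  \<open>O (m powr (-1/2) * (1 + ln (N\<^sup>d / m)))\<close>; a logarithm of \<open>N\<close> alone would be too large. A
  derandomised choice of \<open>m\<close> terms makes the remainder \<open>h\<close> exponentially integrable at scale
  \<open>m powr (-1/2)\<close> on a fine grid. Cutting \<open>h\<close> at the level \<open>C * m powr (-1/2) * ln (N\<^sup>d / m)\<close> and
  applying a de la Vallee Poussin kernel to both pieces splits it into a uniformly small part and a
  polynomial of degree \<open>3 N\<close> whose coefficients have \<open>l\<^sub>1\<close> norm at most \<open>1/4\<close>. Iterating this with
  \<open>m/2, m/4, \<dots>\<close> terms gives a geometric series of errors.

  For the class itself, the low frequencies are kept, and this fact is applied to dyadic frequency
  shells with geometrically decreasing numbers of terms, after removing the largest coefficients of
  each shell. The convexity and slope assumptions enter only as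
  \<open>\<psi> u \<le> C * (v / u) powr b * \<psi> v\<close> for \<open>1 \<le> v \<le> u\<close>, with some \<open>b\<close> strictly between
  \<open>d * max 0 (1 - 1 / q)\<close> and \<open>\<beta>\<close>.
\<close>

subsection \<open>Exponentials on grids and cubes of frequencies\<close>

text \<open>The form of the logarithm decides the result. On the shell at dyadic distance
  \<open>s\<close> from the kept frequencies, the ratio of frequencies to terms is exponential in
  \<open>s\<close>, so \<open>1 + ln (N^d / m)\<close> is linear in \<open>s\<close> and is absorbed
  by the geometric decay of the weights; a bound with \<open>ln N\<close> would leave a factor
  \<open>ln m\<close>. Bounding the remainder at every grid point would cost the logarithm of the
  number of points, about \<open>N^d\<close>. Exceptional points are therefore tolerated. If
  \<open>A\<close> is the l1 norm of the coefficients, the part of the remainder above the cutting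
  level has mean square of order \<open>A^2 / N^d\<close>; Cauchy-Schwarz over order
  \<open>N^d\<close> coefficients turns this into an l1 norm that is a fixed fraction of
  \<open>A\<close>, which is the input of the next round. Working on a grid makes the choice of the
  terms a finite minimisation. Members of the class are given only as L1 functions. To pass from
  coefficients to uniform errors, such a function with absolutely summable coefficients must agree
  almost everywhere with its Fourier series; this is the purpose of the uniqueness theorem.\<close>

lemma sum_cis_grid:
  assumes "0 < M" "\<not> int M dvd k"
  shows "(\<Sum>j<M. cis (real_of_int k * (2 * pi * real j / real M))) = 0"
proof -
  define z where "z = cis (2 * pi * real_of_int k / real M)"
  have pow: "cis (real_of_int k * (2 * pi * real j / real M)) = z ^ j" for j
    unfolding z_def by (simp add: Complex.DeMoivre mult_ac)
  have "z \<noteq> 1"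
  proof
    assume "z = 1"
    then obtain l where "2 * pi * real_of_int k / real M = of_int l * (2 * pi)"
      unfolding z_def cis_eq_1_iff by blast
    with assms(1) have "real_of_int k = real_of_int (l * int M)"
      by (simp add: field_simps)
    then have "k = l * int M" by linarith
    with assms(2) show False by simp
  qed
  moreover have "z ^ M = 1"
    unfolding z_def using assms(1) by (simp add: Complex.DeMoivre)
  ultimately show ?thesis
    unfolding pow by (simp add: geometric_sum)
qed

lemma trig_exp_prod:
  "trig_exp k x = (\<Prod>i\<in>UNIV. cis (real_of_int (k $ i) * x $ i))"
  by (simp add: trig_exp_def cis_conv_exp exp_sum[symmetric] sum_distrib_left)

lemma trig_exp_cis: "trig_exp k x = cis (\<Sum>i\<in>UNIV. real_of_int (k $ i) * x $ i)"
  by (simp add: trig_exp_def cis_conv_exp)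

lemma norm_trig_exp [simp]: "norm (trig_exp k x) = 1"
  by (simp add: trig_exp_cis)

lemma trig_exp_0 [simp]: "trig_exp 0 x = 1"
  by (simp add: trig_exp_cis)

lemma trig_exp_add_freq: "trig_exp (k + l) x = trig_exp k x * trig_exp l x"
  by (simp add: trig_exp_cis cis_mult algebra_simps sum.distrib)

lemma cnj_trig_exp: "cnj (trig_exp k x) = trig_exp (- k) x"
  by (simp add: trig_exp_cis cis_cnj sum_negf)

lemma trig_exp_diff: "trig_exp k (x - y) = trig_exp k x * cnj (trig_exp k y)"
  by (simp add: trig_exp_cis cis_cnj cis_mult algebra_simps sum_subtractf)

lemma trig_exp_diff_freq: "trig_exp (k - l) x = trig_exp k x * cnj (trig_exp l x)"
  by (simp add: cnj_trig_exp flip: trig_exp_add_freq)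

lemma continuous_on_trig_exp [continuous_intros]: "continuous_on S (trig_exp k)"
  unfolding trig_exp_def by (intro continuous_intros)

lemma periodic_trig_exp: "periodic (trig_exp k)"
proof -
  have "(\<Sum>j\<in>UNIV. real_of_int (k $ j) * (x + axis i (2 * pi)) $ j)
      = (\<Sum>j\<in>UNIV. real_of_int (k $ j) * x $ j) + 2 * pi * real_of_int (k $ i)" for x i
  proof -
    have "(\<Sum>j\<in>UNIV. real_of_int (k $ j) * axis i (2 * pi) $ j)
        = (\<Sum>j\<in>UNIV. if j = i then 2 * pi * real_of_int (k $ i) else 0)"
      by (intro sum.cong) (auto simp: axis_def)
    then show ?thesis by (simp add: algebra_simps sum.distrib)
  qed
  then show ?thesis
    by (simp add: periodic_def trig_exp_cis flip: cis_mult)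
qed

abbreviation trig_sum :: "(int ^ 'd) set \<Rightarrow> (int ^ 'd \<Rightarrow> complex) \<Rightarrow> real ^ 'd::finite \<Rightarrow> complex" where
  "trig_sum F c x \<equiv> \<Sum>k\<in>F. c k * trig_exp k x"

definition grid :: "nat \<Rightarrow> ('d::finite \<Rightarrow> nat) set" where
  "grid M = PiE UNIV (\<lambda>_. {..<M})"

definition grid_pt :: "nat \<Rightarrow> ('d::finite \<Rightarrow> nat) \<Rightarrow> real ^ 'd" where
  "grid_pt M j = (\<chi> i. 2 * pi * real (j i) / real M)"

lemma finite_grid [simp]: "finite (grid M)"
  by (simp add: grid_def finite_PiE)

lemma card_grid: "card (grid M :: ('d::finite \<Rightarrow> nat) set) = M ^ CARD('d)"
  by (simp add: grid_def card_PiE)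

text \<open>The sum factors over the coordinates, and a nonzero coordinate of \<open>k\<close>
  contributes a vanishing sum over roots of unity. The bound by \<open>M\<close> rules out aliasing:
  no nonzero coordinate is a multiple of \<open>M\<close>.\<close>

lemma sum_trig_exp_grid:
  fixes k :: "int ^ 'd::finite"
  assumes "0 < M" "\<And>i. \<bar>k $ i\<bar> < int M"
  shows "(\<Sum>j\<in>grid M. trig_exp k (grid_pt M j)) = (if k = 0 then of_nat (M ^ CARD('d)) else 0)"
proof (cases "k = 0")
  case True
  then show ?thesis by (simp add: card_grid)
next
  case False
  then obtain i where i: "k $ i \<noteq> 0" by (auto simp: vec_eq_iff)
  with assms(2)[of i] have nd: "\<not> int M dvd k $ i"
    using dvd_imp_le_int[of "k $ i" "int M"] by linarith
  have "(\<Sum>j\<in>grid M. trig_exp k (grid_pt M j))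
      = (\<Prod>i\<in>UNIV. \<Sum>j<M. cis (real_of_int (k $ i) * (2 * pi * real j / real M)))"
    unfolding grid_def trig_exp_prod grid_pt_def
    by (subst prod_sum_PiE) auto
  also have "\<dots> = 0"
    using sum_cis_grid[OF assms(1) nd] by (auto intro!: prod_zero)
  finally show ?thesis using False by simp
qed

text \<open>Discrete orthogonality applies to all differences of frequencies. The condition concerns
  differences in \<open>F\<close>, so a cube of radius \<open>N\<close> needs only
  \<open>2 * N < M\<close>.\<close>

lemma grid_parseval:
  fixes F :: "(int ^ 'd::finite) set"
  assumes "0 < M" "finite F" "\<And>k l i. k \<in> F \<Longrightarrow> l \<in> F \<Longrightarrow> \<bar>k $ i - l $ i\<bar> < int M"
  shows "(\<Sum>j\<in>grid M. (norm (trig_sum F c (grid_pt M j)))\<^sup>2)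
       = real (M ^ CARD('d)) * (\<Sum>k\<in>F. (norm (c k))\<^sup>2)"
proof -
  have "complex_of_real (\<Sum>j\<in>grid M. (norm (trig_sum F c (grid_pt M j)))\<^sup>2)
      = (\<Sum>j\<in>grid M. \<Sum>k\<in>F. \<Sum>l\<in>F. c k * cnj (c l) * trig_exp (k - l) (grid_pt M j))"
    by (simp only: of_real_sum complex_norm_square cnj_sum sum_product)
       (simp add: trig_exp_diff_freq mult_ac)
  also have "\<dots> = (\<Sum>k\<in>F. \<Sum>l\<in>F. c k * cnj (c l) * (\<Sum>j\<in>grid M. trig_exp (k - l) (grid_pt M j)))"
    unfolding sum_distrib_left
    by (subst sum.swap, rule sum.cong[OF refl], subst sum.swap) simp
  also have "\<dots> = (\<Sum>k\<in>F. \<Sum>l\<in>F. if k = l then c k * cnj (c l) * of_nat (M ^ CARD('d)) else 0)"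
    using assms by (intro sum.cong refl) (subst sum_trig_exp_grid, auto)
  also have "\<dots> = complex_of_real (real (M ^ CARD('d)) * (\<Sum>k\<in>F. (norm (c k))\<^sup>2))"
    using assms(2) by (simp add: complex_norm_square[symmetric] sum_distrib_left mult_ac)
  finally show ?thesis unfolding of_real_eq_iff .
qed

text \<open>Balls in the maximum norm serve for every \<open>r\<close>: they are product sets, which
  suits grids and kernels, and \<open>index_norm r\<close> is comparable with the maximum norm up to
  the factor \<open>CARD('d)\<close>.\<close>

definition cube :: "nat \<Rightarrow> (int ^ 'd::finite) set" where
  "cube N = {k. \<forall>i. \<bar>k $ i\<bar> \<le> int N}"

lemma bij_betw_cube:
  "bij_betw vec_nth (cube N :: (int ^ 'd::finite) set) (PiE UNIV (\<lambda>_. {- int N..int N}))"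
proof (rule bij_betw_byWitness[where f' = vec_lambda])
  have b: "\<bar>x\<bar> \<le> int N \<longleftrightarrow> x \<in> {- int N..int N}" for x :: int by auto
  show "($) ` (cube N :: (int ^ 'd) set) \<subseteq> PiE UNIV (\<lambda>_. {- int N..int N})"
    unfolding cube_def b by blast
  show "vec_lambda ` PiE UNIV (\<lambda>_. {- int N..int N}) \<subseteq> (cube N :: (int ^ 'd) set)"
    unfolding cube_def b by (auto simp: PiE_iff)
qed (simp_all add: fun_eq_iff)

lemma finite_cube [simp]: "finite (cube N)"
  using bij_betw_finite[OF bij_betw_cube] by (simp add: finite_PiE)

lemma card_cube: "card (cube N :: (int ^ 'd::finite) set) = (2 * N + 1) ^ CARD('d)"
proof -
  have "nat (2 * int N + 1) = 2 * N + 1" by linarith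
  then show ?thesis
    using bij_betw_same_card[OF bij_betw_cube[where 'd = 'd, of N]]
    by (simp add: card_PiE add.commute)
qed

lemma zero_in_cube [simp]: "0 \<in> cube N"
  by (simp add: cube_def)

lemma cube_mono: "M \<le> N \<Longrightarrow> cube M \<subseteq> cube N"
  unfolding cube_def by (auto intro: order_trans)

section \<open>Deterministic choice of terms through exponential moments\<close>

text \<open>For \<open>x = - y\<close> with \<open>y > 0\<close>, the product of
  \<open>1 - y + y^2\<close> with the lower bound \<open>1 + y + y^2 / 2\<close> for
  \<open>exp y\<close> is \<open>1 + (y^2 + y^3 + y^4) / 2\<close>, hence at least 1.\<close>

lemma exp_le_quadratic:
  fixes x :: real
  assumes "\<bar>x\<bar> \<le> 1"
  shows "exp x \<le> 1 + x + x\<^sup>2"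
proof (cases "0 \<le> x")
  case True
  then show ?thesis using exp_bound[of x] assms by simp
next
  case False
  define y where "y = - x"
  have y: "0 \<le> y" "x = - y" using False by (auto simp: y_def)
  have pos: "0 < 1 + y + y\<^sup>2 / 2" using y(1) by (simp add: add_pos_nonneg)
  have "(1 - y + y\<^sup>2) * (1 + y + y\<^sup>2 / 2) = 1 + (y\<^sup>2 + y ^ 3 + y ^ 4) / 2"
    by (simp add: field_simps power2_eq_square power3_eq_cube power4_eq_xxxx)
  then have "1 \<le> (1 - y + y\<^sup>2) * (1 + y + y\<^sup>2 / 2)"
    using y(1) by simp
  moreover have "exp (- y) \<le> inverse (1 + y + y\<^sup>2 / 2)"
    unfolding exp_minus using pos y(1) by (intro le_imp_inverse_le exp_lower_Taylor_quadratic) auto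
  ultimately have "exp (- y) \<le> 1 - y + y\<^sup>2"
    using pos by (smt (verit) inverse_eq_divide pos_divide_le_eq)
  then show ?thesis by (simp add: y)
qed

text \<open>Plays the part of an expectation: with \<open>w\<close> as probabilities, some outcome
  does not exceed the mean. Each greedy choice is one use of it.\<close>

lemma convex_combination_min:
  fixes w v :: "'a \<Rightarrow> real"
  assumes "finite I" "\<And>k. k \<in> I \<Longrightarrow> 0 \<le> w k" "(\<Sum>k\<in>I. w k) = 1" "(\<Sum>k\<in>I. w k * v k) \<le> V"
  shows "\<exists>k\<in>I. v k \<le> V"
proof (rule ccontr)
  assume "\<not> ?thesis"
  then have less: "\<And>k. k \<in> I \<Longrightarrow> V < v k" by force
  obtain k0 where k0: "k0 \<in> I" "0 < w k0"
    using assms(2,3) by (metis less_eq_real_def less_irrefl sum.neutral zero_less_one)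
  have "(\<Sum>k\<in>I. w k * V) < (\<Sum>k\<in>I. w k * v k)"
    using k0 less assms(1,2)
    by (intro sum_strict_mono_ex1) (auto intro!: mult_left_mono bexI[of _ k0] intro: less_imp_le)
  then show False using assms(3,4) by (simp flip: sum_distrib_right)
qed

text \<open>Method of conditional expectations. If the next index is drawn with probabilities
  \<open>w\<close>, the linear term of \<open>exp_le_quadratic\<close> averages to zero by
  \<open>mean\<close>, so the expected sum over \<open>P\<close> grows at most by the factor
  \<open>exp (\<tau>\<^sup>2)\<close>, and some index does at least as well. Indices may
  repeat.\<close>

lemma greedy_exponential_moment:
  fixes w :: "'a \<Rightarrow> real" and v :: "'a \<Rightarrow> 'p \<Rightarrow> real"
  assumes "finite I" "\<And>k. k \<in> I \<Longrightarrow> 0 \<le> w k" "(\<Sum>k\<in>I. w k) = 1"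
    and "finite P" "\<And>k p. k \<in> I \<Longrightarrow> p \<in> P \<Longrightarrow> \<bar>v k p\<bar> \<le> 1"
    and mean: "\<And>p. p \<in> P \<Longrightarrow> (\<Sum>k\<in>I. w k * v k p) = 0"
    and tau: "0 \<le> \<tau>" "\<tau> \<le> 1"
  shows "\<exists>\<kappa>::nat \<Rightarrow> 'a. (\<forall>i<\<mu>. \<kappa> i \<in> I) \<and>
    (\<Sum>p\<in>P. exp (\<tau> * (\<Sum>i<\<mu>. v (\<kappa> i) p))) \<le> real (card P) * exp (real \<mu> * \<tau>\<^sup>2)"
proof (induction \<mu>)
  case 0
  then show ?case by simp
next
  case (Suc \<mu>)
  then obtain \<kappa> where \<kappa>: "\<forall>i<\<mu>. \<kappa> i \<in> I"
    "(\<Sum>p\<in>P. exp (\<tau> * (\<Sum>i<\<mu>. v (\<kappa> i) p))) \<le> real (card P) * exp (real \<mu> * \<tau>\<^sup>2)" by blast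
  define E where "E p = exp (\<tau> * (\<Sum>i<\<mu>. v (\<kappa> i) p))" for p
  have step: "(\<Sum>k\<in>I. w k * exp (\<tau> * v k p)) \<le> exp (\<tau>\<^sup>2)" if p: "p \<in> P" for p
  proof -
    have "(\<Sum>k\<in>I. w k * exp (\<tau> * v k p)) \<le> (\<Sum>k\<in>I. w k * (1 + \<tau> * v k p + \<tau>\<^sup>2))"
    proof (intro sum_mono mult_left_mono)
      fix k assume k: "k \<in> I"
      have v1: "\<bar>v k p\<bar> \<le> 1" using assms(5) k p by blast
      then have "\<bar>\<tau> * v k p\<bar> \<le> 1"
        using tau by (simp add: abs_mult mult_le_one)
      then have "exp (\<tau> * v k p) \<le> 1 + \<tau> * v k p + (\<tau> * v k p)\<^sup>2" by (rule exp_le_quadratic)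
      also have "(\<tau> * v k p)\<^sup>2 \<le> \<tau>\<^sup>2"
        using v1 by (simp add: power_mult_distrib mult_left_le abs_square_le_1)
      finally show "exp (\<tau> * v k p) \<le> 1 + \<tau> * v k p + \<tau>\<^sup>2" by simp
    qed (use assms(2) in auto)
    also have "\<dots> = (\<Sum>k\<in>I. w k) * (1 + \<tau>\<^sup>2) + \<tau> * (\<Sum>k\<in>I. w k * v k p)"
      by (simp add: algebra_simps sum.distrib sum_distrib_left sum_distrib_right)
    also have "\<dots> \<le> exp (\<tau>\<^sup>2)"
      using mean[OF p] assms(3) exp_ge_add_one_self[of "\<tau>\<^sup>2"] by simp
    finally show ?thesis .
  qed
  have "(\<Sum>k\<in>I. w k * (\<Sum>p\<in>P. E p * exp (\<tau> * v k p)))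
      = (\<Sum>p\<in>P. E p * (\<Sum>k\<in>I. w k * exp (\<tau> * v k p)))"
    unfolding sum_distrib_left by (subst sum.swap) (simp add: mult_ac)
  also have "\<dots> \<le> (\<Sum>p\<in>P. E p * exp (\<tau>\<^sup>2))"
    by (intro sum_mono mult_left_mono step) (auto simp: E_def)
  also have "\<dots> \<le> real (card P) * exp (real \<mu> * \<tau>\<^sup>2) * exp (\<tau>\<^sup>2)"
    using \<kappa>(2) by (simp add: E_def flip: sum_distrib_right)
  also have "\<dots> = real (card P) * exp (real (Suc \<mu>) * \<tau>\<^sup>2)"
    by (simp add: algebra_simps exp_add)
  finally have "\<exists>k\<in>I. (\<Sum>p\<in>P. E p * exp (\<tau> * v k p)) \<le> real (card P) * exp (real (Suc \<mu>) * \<tau>\<^sup>2)"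
    by (rule convex_combination_min[OF assms(1-3), rotated]) simp
  then obtain k where k: "k \<in> I"
    "(\<Sum>p\<in>P. E p * exp (\<tau> * v k p)) \<le> real (card P) * exp (real (Suc \<mu>) * \<tau>\<^sup>2)"
    by blast
  show ?case
  proof (intro exI[of _ "\<kappa>(\<mu> := k)"] conjI)
    show "\<forall>i<Suc \<mu>. (\<kappa>(\<mu> := k)) i \<in> I"
      using \<kappa>(1) k(1) by (simp add: less_Suc_eq)
    have "(\<Sum>i<Suc \<mu>. v ((\<kappa>(\<mu> := k)) i) p) = (\<Sum>i<\<mu>. v (\<kappa> i) p) + v k p" for p
      by simp
    then show "(\<Sum>p\<in>P. exp (\<tau> * (\<Sum>i<Suc \<mu>. v ((\<kappa>(\<mu> := k)) i) p)))
        \<le> real (card P) * exp (real (Suc \<mu>) * \<tau>\<^sup>2)"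
      using k(2) by (simp only: E_def distrib_left exp_add)
  qed
qed


subsection \<open>Splitting a polynomial by a de la Vallee Poussin kernel\<close>

text \<open>Discrete Fourier coefficient. It is defined for arbitrary functions on the grid because
  the truncated samples to which it is applied do not come from a polynomial of low degree.\<close>

definition avg_coeff :: "nat \<Rightarrow> (('d::finite \<Rightarrow> nat) \<Rightarrow> complex) \<Rightarrow> int ^ 'd \<Rightarrow> complex" where
  "avg_coeff M u l = (\<Sum>j\<in>grid M. u j * cnj (trig_exp l (grid_pt M j))) / of_nat (M ^ CARD('d))"

lemma sum_mult_le_sqrt:
  fixes f g :: "'a \<Rightarrow> real"
  shows "(\<Sum>i\<in>I. f i * g i) \<le> sqrt (\<Sum>i\<in>I. (f i)\<^sup>2) * sqrt (\<Sum>i\<in>I. (g i)\<^sup>2)"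
proof -
  have "(\<Sum>i\<in>I. f i * g i)\<^sup>2 \<le> (\<Sum>i\<in>I. (f i)\<^sup>2) * (\<Sum>i\<in>I. (g i)\<^sup>2)"
    by (rule Cauchy_Schwarz_ineq_sum)
  then show ?thesis
    unfolding real_sqrt_mult[symmetric] by (rule real_le_rsqrt)
qed

text \<open>Pairing \<open>u\<close> with its own partial sum \<open>w\<close> gives
  \<open>m * S\<close>. Cauchy-Schwarz bounds the pairing by the norms of \<open>u\<close> and
  \<open>w\<close>, and the squared norm of \<open>w\<close> is again \<open>m * S\<close> by
  \<open>grid_parseval\<close>.\<close>

lemma grid_bessel:
  fixes F :: "(int ^ 'd::finite) set"
  assumes "0 < M" "finite F" "\<And>k l i. k \<in> F \<Longrightarrow> l \<in> F \<Longrightarrow> \<bar>k $ i - l $ i\<bar> < int M"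
  shows "(\<Sum>l\<in>F. (norm (avg_coeff M u l))\<^sup>2) \<le> (\<Sum>j\<in>grid M. (norm (u j))\<^sup>2) / real (M ^ CARD('d))"
proof -
  define m where "m = real (M ^ CARD('d))"
  have m: "0 < m" using assms(1) by (simp add: m_def)
  define S where "S = (\<Sum>l\<in>F. (norm (avg_coeff M u l))\<^sup>2)"
  define U where "U = (\<Sum>j\<in>grid M. (norm (u j))\<^sup>2)"
  define w where "w j = (\<Sum>l\<in>F. avg_coeff M u l * trig_exp l (grid_pt M j))" for j
  have S0: "0 \<le> S" and U0: "0 \<le> U" by (simp_all add: S_def U_def sum_nonneg)
  have mav: "of_real m * avg_coeff M u l = (\<Sum>j\<in>grid M. u j * cnj (trig_exp l (grid_pt M j)))" for l
    using m by (simp add: avg_coeff_def m_def)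
  have "complex_of_real (m * S) = (\<Sum>l\<in>F. (of_real m * avg_coeff M u l) * cnj (avg_coeff M u l))"
    by (simp only: S_def of_real_mult of_real_sum complex_norm_square sum_distrib_left mult.assoc)
  also have "\<dots> = (\<Sum>j\<in>grid M. u j * cnj (w j))"
    unfolding mav w_def cnj_sum sum_distrib_left sum_distrib_right
    by (subst sum.swap) (simp add: mult_ac)
  finally have "m * S = norm (\<Sum>j\<in>grid M. u j * cnj (w j))"
    using S0 m by (metis abs_of_nonneg mult_nonneg_nonneg less_imp_le norm_of_real)
  also have "\<dots> \<le> (\<Sum>j\<in>grid M. norm (u j) * norm (w j))"
    by (rule order_trans[OF norm_sum]) (simp add: norm_mult)
  also have "\<dots> \<le> sqrt U * sqrt (\<Sum>j\<in>grid M. (norm (w j))\<^sup>2)"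
    unfolding U_def by (rule sum_mult_le_sqrt)
  also have "(\<Sum>j\<in>grid M. (norm (w j))\<^sup>2) = m * S"
    unfolding w_def m_def S_def using assms by (rule grid_parseval)
  finally have *: "m * S \<le> sqrt U * sqrt (m * S)" .
  have "m * S \<le> U"
  proof (cases "m * S = 0")
    case False
    then have "0 < m * S" using m S0 by (metis less_eq_real_def mult_nonneg_nonneg)
    then have "sqrt (m * S) * sqrt (m * S) \<le> sqrt U * sqrt (m * S)" "0 < sqrt (m * S)"
      using * by simp_all
    then have "sqrt (m * S) \<le> sqrt U" by (rule mult_right_le_imp_le)
    then show ?thesis by simp
  qed (use U0 in linarith)
  then show ?thesis
    using m unfolding S_def[symmetric] U_def[symmetric] m_def[symmetric]
    by (simp add: pos_le_divide_eq mult.commute)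
qed

definition dirichlet :: "nat \<Rightarrow> real ^ 'd::finite \<Rightarrow> complex" where
  "dirichlet N x = (\<Sum>k\<in>cube N. trig_exp k x)"

text \<open>A de la Vallee Poussin kernel: its coefficients are \<open>1\<close> on \<open>cube N\<close> and vanish outside
  \<open>cube (3 * N)\<close>, while Cauchy-Schwarz bounds its mean absolute value by \<open>2 powr (d / 2)\<close>.\<close>

definition vp_kernel :: "nat \<Rightarrow> real ^ 'd::finite \<Rightarrow> complex" where
  "vp_kernel N x = dirichlet N x * dirichlet (2 * N) x / of_nat (card (cube N :: (int ^ 'd) set))"

text \<open>Convolution of the indicators of \<open>cube N\<close> and \<open>cube (2 * N)\<close>
  at \<open>l\<close>, divided by the size of the smaller cube. These are the coefficients of
  \<open>vp_kernel\<close>.\<close>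

definition vp_coeff :: "nat \<Rightarrow> int ^ 'd::finite \<Rightarrow> real" where
  "vp_coeff N l = real (card {k \<in> cube N. l - k \<in> cube (2 * N)}) / real (card (cube N :: (int ^ 'd) set))"

lemma cube_nonempty [simp]: "cube N \<noteq> {}"
  using zero_in_cube by blast

lemma card_cube_pos: "0 < card (cube N :: (int ^ 'd::finite) set)"
  by (simp add: card_cube)

lemma vp_coeff_bounds: "0 \<le> vp_coeff N l" "vp_coeff N l \<le> 1"
proof -
  show "0 \<le> vp_coeff N l" by (simp add: vp_coeff_def)
  have "card {k \<in> cube N. l - k \<in> cube (2 * N)} \<le> card (cube N :: (int ^ 'a) set)"
    by (intro card_mono) auto
  then show "vp_coeff N l \<le> 1"
    using card_cube_pos[where 'd = 'a, of N] by (simp add: vp_coeff_def divide_le_eq)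
qed

lemma cube_add: "k \<in> cube M \<Longrightarrow> l \<in> cube N \<Longrightarrow> k + l \<in> cube (M + N)"
  by (simp add: cube_def) (metis abs_triangle_ineq add_mono order_trans)

lemma cube_diff: "k \<in> cube M \<Longrightarrow> l \<in> cube N \<Longrightarrow> k - l \<in> cube (M + N)"
  by (simp add: cube_def) (metis abs_triangle_ineq4 add_mono order_trans)

text \<open>This is why the second Dirichlet kernel has degree \<open>2 * N\<close>: for
  \<open>l\<close> and \<open>k\<close> in \<open>cube N\<close> the difference \<open>l - k\<close>
  always lies in \<open>cube (2 * N)\<close>, so the count is full.\<close>

lemma vp_coeff_eq_1:
  assumes "l \<in> cube N"
  shows "vp_coeff N l = 1"
proof -
  have "{k \<in> cube N. l - k \<in> cube (2 * N)} = cube N"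
    using cube_diff[OF assms, of _ N] by (auto simp: mult_2)
  then show ?thesis
    using card_cube_pos[where 'd = 'a, of N] by (simp add: vp_coeff_def)
qed

lemma vp_kernel_expansion: "vp_kernel N x = (\<Sum>l\<in>cube (3 * N). of_real (vp_coeff N l) * trig_exp l x)"
proof -
  have "dirichlet N x * dirichlet (2 * N) x = (\<Sum>k\<in>cube N. \<Sum>l\<in>cube (2 * N). trig_exp (k + l) x)"
    unfolding dirichlet_def sum_product by (simp add: trig_exp_add_freq)
  also have "\<dots> = (\<Sum>k\<in>cube N. \<Sum>l\<in>cube (3 * N). if l - k \<in> cube (2 * N) then trig_exp l x else 0)"
  proof (rule sum.cong[OF refl])
    fix k :: "int ^ 'a" assume k: "k \<in> cube N"
    have "(\<Sum>l\<in>cube (2 * N). trig_exp (k + l) x) = (\<Sum>l\<in>{l \<in> cube (3 * N). l - k \<in> cube (2 * N)}. trig_exp l x)"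
      by (rule sum.reindex_bij_witness[of _ "\<lambda>l. l - k" "\<lambda>l. k + l"])
         (use k cube_add[of k N _ "2 * N"] in auto)
    then show "(\<Sum>l\<in>cube (2 * N). trig_exp (k + l) x)
      = (\<Sum>l\<in>cube (3 * N). if l - k \<in> cube (2 * N) then trig_exp l x else 0)"
      by (simp add: sum.inter_filter)
  qed
  also have "\<dots> = (\<Sum>l\<in>cube (3 * N). of_nat (card {k \<in> cube N. l - k \<in> cube (2 * N)}) * trig_exp l x)"
    by (subst sum.swap) (simp flip: sum.inter_filter)
  finally show ?thesis
    by (simp add: vp_kernel_def vp_coeff_def sum_divide_distrib)
qed

lemma cube_diff_less: "k \<in> cube M \<Longrightarrow> l \<in> cube N \<Longrightarrow> M + N < L \<Longrightarrow> \<bar>k $ i - l $ i\<bar> < int L"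
  using cube_diff[of k M l N] by (fastforce simp: cube_def dest: spec[of _ i])

text \<open>As a function of the grid point, the conjugate of the shifted kernel is a polynomial
  with coefficients of modulus 1, since \<open>x\<close> enters only through phases. Hence the
  kernel estimates are uniform in \<open>x\<close>.\<close>

lemma dirichlet_grid_norm:
  fixes x :: "real ^ 'd::finite"
  assumes "2 * R < M"
  shows "(\<Sum>j\<in>grid M. (norm (dirichlet R (x - grid_pt M j)))\<^sup>2)
    = real (M ^ CARD('d)) * real (card (cube R :: (int ^ 'd) set))"
proof -
  have "norm (dirichlet R (x - grid_pt M j))
      = norm (\<Sum>k\<in>cube R. cnj (trig_exp k x) * trig_exp k (grid_pt M j))" for j
  proof -
    have "norm (dirichlet R (x - grid_pt M j)) = norm (cnj (dirichlet R (x - grid_pt M j)))"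
      by simp
    then show ?thesis by (simp add: dirichlet_def trig_exp_diff)
  qed
  moreover have "(\<Sum>j\<in>grid M. (norm (\<Sum>k\<in>cube R. cnj (trig_exp k x) * trig_exp k (grid_pt M j)))\<^sup>2)
      = real (M ^ CARD('d)) * (\<Sum>k\<in>cube R. (norm (cnj (trig_exp k x)))\<^sup>2)"
    by (rule grid_parseval) (use assms in \<open>auto intro!: cube_diff_less\<close>)
  ultimately show ?thesis by simp
qed

text \<open>After Cauchy-Schwarz the mean is at most the square root of the ratio of the two cube
  sizes, and this ratio is at most \<open>2 ^ CARD('d)\<close>. The condition
  \<open>4 * N < M\<close> is what Parseval requires for degree \<open>2 * N\<close>.\<close>

lemma vp_kernel_grid_norm:
  assumes "4 * N < M"
  shows "(\<Sum>j\<in>grid M. norm (vp_kernel N (x - grid_pt M j :: real ^ 'd::finite)))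
    \<le> real (M ^ CARD('d)) * sqrt (2 ^ CARD('d))"
proof -
  define c where "c R = real (card (cube R :: (int ^ 'd) set))" for R
  have c: "0 < c N" unfolding c_def using card_cube_pos[where 'd = 'd, of N] by simp
  have "c (2 * N) \<le> 2 ^ CARD('d) * c N"
    unfolding c_def card_cube of_nat_power power_mult_distrib[symmetric]
    by (intro power_mono) auto
  then have sq: "sqrt (c (2 * N)) \<le> sqrt (2 ^ CARD('d)) * sqrt (c N)"
    by (simp flip: real_sqrt_mult)
  define m where "m = real (M ^ CARD('d))"
  have m: "0 \<le> m" by (simp add: m_def)
  have "c N * (\<Sum>j\<in>grid M. norm (vp_kernel N (x - grid_pt M j)))
      = (\<Sum>j\<in>grid M. norm (dirichlet N (x - grid_pt M j)) * norm (dirichlet (2 * N) (x - grid_pt M j)))"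
    using c by (simp add: vp_kernel_def norm_divide norm_mult sum_distrib_left c_def)
  also have "\<dots> \<le> sqrt (m * c N) * sqrt (m * c (2 * N))"
    using sum_mult_le_sqrt[of "\<lambda>j. norm (dirichlet N (x - grid_pt M j))" "\<lambda>j. norm (dirichlet (2 * N) (x - grid_pt M j))" "grid M"]
      dirichlet_grid_norm[of N M x] dirichlet_grid_norm[of "2 * N" M x] assms
    by (simp add: m_def c_def)
  also have "\<dots> = m * (sqrt (c N) * sqrt (c (2 * N)))"
    using m by (simp add: real_sqrt_mult)
  also have "\<dots> \<le> m * (sqrt (c N) * (sqrt (2 ^ CARD('d)) * sqrt (c N)))"
    using c by (intro mult_left_mono sq m) auto
  also have "\<dots> = c N * (m * sqrt (2 ^ CARD('d)))"
    using c by (simp add: algebra_simps)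
  finally show ?thesis using c by (simp add: m_def)
qed

text \<open>A frequency in \<open>cube N\<close> and one in \<open>cube (3 * N)\<close> differ by at
  most \<open>4 * N\<close> in each coordinate, so sampling causes no aliasing.\<close>

lemma avg_coeff_trig_sum:
  fixes c :: "int ^ 'd::finite \<Rightarrow> complex"
  assumes "4 * N < M" "l \<in> cube (3 * N)"
  shows "avg_coeff M (\<lambda>j. trig_sum (cube N) c (grid_pt M j)) l = (if l \<in> cube N then c l else 0)"
proof -
  have "(\<Sum>j\<in>grid M. trig_sum (cube N) c (grid_pt M j) * cnj (trig_exp l (grid_pt M j)))
      = (\<Sum>k\<in>cube N. c k * (\<Sum>j\<in>grid M. trig_exp (k - l) (grid_pt M j)))"
    unfolding sum_distrib_left sum_distrib_right
    by (subst sum.swap) (simp add: trig_exp_diff_freq mult_ac)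
  also have "\<dots> = (\<Sum>k\<in>cube N. if k = l then c k * of_nat (M ^ CARD('d)) else 0)"
  proof (rule sum.cong[OF refl])
    fix k :: "int ^ 'd" assume "k \<in> cube N"
    then have "\<bar>(k - l) $ i\<bar> < int M" for i
      using cube_diff_less[of k N l "3 * N" M i] assms by simp
    with assms(1) show "c k * (\<Sum>j\<in>grid M. trig_exp (k - l) (grid_pt M j))
        = (if k = l then c k * of_nat (M ^ CARD('d)) else 0)"
      by (subst sum_trig_exp_grid) auto
  qed
  finally show ?thesis
    using assms(1) by (simp add: avg_coeff_def)
qed

text \<open>The grid operator \<open>V\<close> reproduces \<open>h\<close> from its samples, so
  cutting the samples at level \<open>\<theta>\<close> splits \<open>h\<close> itself. The small
  samples give a uniformly bounded function by the mean bound on the kernel. The large ones give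
  coefficients controlled in l2 by \<open>grid_bessel\<close>, and Cauchy-Schwarz over the
  \<open>(6 * N + 1) ^ CARD('d)\<close> frequencies of \<open>cube (3 * N)\<close> turns this into
  an l1 bound. The condition \<open>6 * N < M\<close> is the one Bessel requires on that
  cube.\<close>

lemma trig_sum_split:
  fixes c :: "int ^ 'd::finite \<Rightarrow> complex" and N M :: nat and \<theta> :: real
  defines "h \<equiv> \<lambda>x. trig_sum (cube N) c x"
  assumes "6 * N < M" "0 \<le> \<theta>"
  shows "\<exists>c'. (\<forall>x. norm (h x - trig_sum (cube (3 * N)) c' x) \<le> sqrt (2 ^ CARD('d)) * \<theta>) \<and>
    (\<Sum>k\<in>cube (3 * N). norm (c' k)) \<le> sqrt (real ((6 * N + 1) ^ CARD('d)) *
      ((\<Sum>j\<in>{j \<in> grid M. norm (h (grid_pt M j)) > \<theta>}. (norm (h (grid_pt M j)))\<^sup>2) / real (M ^ CARD('d))))"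
proof -
  define V where "V u x = (\<Sum>l\<in>cube (3 * N). of_real (vp_coeff N l) * avg_coeff M u l * trig_exp l x)" for u and x :: "real ^ 'd"
  define hb where "hb j = (if norm (h (grid_pt M j)) > \<theta> then h (grid_pt M j) else 0)" for j
  define hg where "hg j = (if norm (h (grid_pt M j)) > \<theta> then 0 else h (grid_pt M j))" for j
  define c' where "c' l = of_real (vp_coeff N l) * avg_coeff M hb l" for l
  have m: "0 < real (M ^ CARD('d))" using assms by simp
  have av: "avg_coeff M (\<lambda>j. h (grid_pt M j)) l = avg_coeff M hg l + avg_coeff M hb l" for l
    unfolding avg_coeff_def add_divide_distrib[symmetric] sum.distrib[symmetric]
    by (intro arg_cong2[where f = "(/)"] sum.cong) (auto simp: hg_def hb_def)
  \<comment> \<open>The kernel multiplies the true coefficients by \<open>vp_coeff\<close>, which is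
    1 wherever they can be nonzero.\<close>
  have Vh: "V (\<lambda>j. h (grid_pt M j)) x = h x" for x
  proof -
    have "V (\<lambda>j. h (grid_pt M j)) x = (\<Sum>l\<in>cube (3 * N). if l \<in> cube N then c l * trig_exp l x else 0)"
      unfolding V_def h_def
      using assms avg_coeff_trig_sum[of N M _ c] vp_coeff_eq_1[of _ N] by (intro sum.cong) auto
    also have "\<dots> = h x"
      unfolding h_def using cube_mono[of N "3 * N", where 'a = 'd]
      by (subst sum.inter_restrict[symmetric]) (simp_all add: Int_absorb1)
    finally show ?thesis .
  qed
  have "V (\<lambda>j. h (grid_pt M j)) x = V hg x + V hb x" for x
    unfolding V_def av by (simp add: algebra_simps sum.distrib)
  then have split: "h x - V hb x = V hg x" for x
    using Vh by (simp add: algebra_simps)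
  have V_kernel: "V u x = (\<Sum>j\<in>grid M. u j * vp_kernel N (x - grid_pt M j)) / of_nat (M ^ CARD('d))" for u x
    unfolding V_def avg_coeff_def vp_kernel_expansion sum_distrib_left sum_distrib_right sum_divide_distrib
    by (subst sum.swap) (simp add: trig_exp_diff mult_ac)
  have good: "norm (V hg x) \<le> sqrt (2 ^ CARD('d)) * \<theta>" for x
  proof -
    have "norm (V hg x) * real (M ^ CARD('d)) = norm (\<Sum>j\<in>grid M. hg j * vp_kernel N (x - grid_pt M j))"
      using m unfolding V_kernel by (simp add: norm_divide norm_power)
    also have "\<dots> \<le> (\<Sum>j\<in>grid M. \<theta> * norm (vp_kernel N (x - grid_pt M j)))"
      using assms(3) by (intro sum_norm_le) (auto simp: hg_def norm_mult intro!: mult_right_mono)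
    also have "\<dots> \<le> \<theta> * (real (M ^ CARD('d)) * sqrt (2 ^ CARD('d)))"
      unfolding sum_distrib_left[symmetric]
      using assms by (intro mult_left_mono vp_kernel_grid_norm) auto
    finally show ?thesis
      using m by (simp add: algebra_simps)
  qed
  have "(\<Sum>l\<in>cube (3 * N). norm (c' l)) \<le> (\<Sum>l\<in>cube (3 * N). norm (avg_coeff M hb l))"
    using vp_coeff_bounds[where 'a = 'd, of N] by (intro sum_mono) (auto simp: c'_def norm_mult intro!: mult_left_le_one_le)
  also have "\<dots> \<le> sqrt (\<Sum>l\<in>(cube (3 * N) :: (int ^ 'd) set). 1\<^sup>2) * sqrt (\<Sum>l\<in>cube (3 * N). (norm (avg_coeff M hb l))\<^sup>2)"
    using sum_mult_le_sqrt[of "\<lambda>_. 1" "\<lambda>l. norm (avg_coeff M hb l)" "cube (3 * N)"] by simp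
  also have "\<dots> = sqrt (real ((6 * N + 1) ^ CARD('d)) * (\<Sum>l\<in>cube (3 * N). (norm (avg_coeff M hb l))\<^sup>2))"
    by (simp add: card_cube real_sqrt_mult)
  also have "\<dots> \<le> sqrt (real ((6 * N + 1) ^ CARD('d)) * ((\<Sum>j\<in>grid M. (norm (hb j))\<^sup>2) / real (M ^ CARD('d))))"
    using assms cube_diff_less[of _ "3 * N" _ "3 * N" M]
    by (intro real_sqrt_le_mono mult_left_mono grid_bessel) auto
  also have "(\<Sum>j\<in>grid M. (norm (hb j))\<^sup>2)
      = (\<Sum>j\<in>{j \<in> grid M. norm (h (grid_pt M j)) > \<theta>}. (norm (h (grid_pt M j)))\<^sup>2)"
    unfolding hb_def by (subst sum.inter_filter) (auto intro!: sum.cong)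
  finally have bad: "(\<Sum>l\<in>cube (3 * N). norm (c' l)) \<le> sqrt (real ((6 * N + 1) ^ CARD('d)) *
      ((\<Sum>j\<in>{j \<in> grid M. norm (h (grid_pt M j)) > \<theta>}. (norm (h (grid_pt M j)))\<^sup>2) / real (M ^ CARD('d))))" .
  show ?thesis
    using good bad split unfolding V_def c'_def[symmetric] by (intro exI[of _ c']) simp
qed


subsection \<open>Sparse approximation in the uniform norm\<close>

text \<open>The count is an upper bound, unlike in \<open>Gam\<close>, so that budgets add even when
  frequencies overlap. The padding to exactly \<open>m\<close> frequencies happens once, in
  \<open>sigma_m_le\<close>.\<close>

definition trig_sparse :: "nat \<Rightarrow> (real ^ 'd::finite \<Rightarrow> complex) \<Rightarrow> bool" where
  "trig_sparse m g \<longleftrightarrow>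
    (\<exists>\<gamma> b. finite \<gamma> \<and> card \<gamma> \<le> m \<and> g = trig_sum \<gamma> b)"

lemma trig_sparse_sum: "finite \<gamma> \<Longrightarrow> card \<gamma> \<le> m \<Longrightarrow> trig_sparse m (trig_sum \<gamma> b)"
  unfolding trig_sparse_def by blast

lemma trig_sparse_zero: "trig_sparse m (\<lambda>x. 0)"
  using trig_sparse_sum[of "{}" m] by simp

lemma trig_sparse_mono: "trig_sparse m g \<Longrightarrow> m \<le> n \<Longrightarrow> trig_sparse n g"
  by (metis le_trans trig_sparse_def)

lemma trig_sparse_add:
  assumes "trig_sparse m g" "trig_sparse n h"
  shows "trig_sparse (m + n) (\<lambda>x. g x + h x)"
proof -
  obtain \<gamma> b where g: "finite \<gamma>" "card \<gamma> \<le> m" "g = trig_sum \<gamma> b"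
    using assms(1) unfolding trig_sparse_def by blast
  obtain \<delta> c where h: "finite \<delta>" "card \<delta> \<le> n" "h = trig_sum \<delta> c"
    using assms(2) unfolding trig_sparse_def by blast
  have "g x + h x = (\<Sum>k\<in>\<gamma> \<union> \<delta>. ((if k \<in> \<gamma> then b k else 0) + (if k \<in> \<delta> then c k else 0)) * trig_exp k x)" for x
  proof -
    have "g x = (\<Sum>k\<in>\<gamma> \<union> \<delta>. (if k \<in> \<gamma> then b k else 0) * trig_exp k x)"
      unfolding g(3) using g(1) h(1) by (intro sum.mono_neutral_cong_left) auto
    moreover have "h x = (\<Sum>k\<in>\<gamma> \<union> \<delta>. (if k \<in> \<delta> then c k else 0) * trig_exp k x)"
      unfolding h(3) using g(1) h(1) by (intro sum.mono_neutral_cong_left) auto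
    ultimately show ?thesis by (simp add: distrib_right sum.distrib)
  qed
  moreover have "card (\<gamma> \<union> \<delta>) \<le> m + n"
    using card_Un_le[of \<gamma> \<delta>] g(2) h(2) by linarith
  ultimately show ?thesis
    unfolding trig_sparse_def using g(1) h(1)
    by (intro exI[of _ "\<gamma> \<union> \<delta>"] exI[of _ "\<lambda>k. (if k \<in> \<gamma> then b k else 0) + (if k \<in> \<delta> then c k else 0)"]) auto
qed

section \<open>One sparsification step and its iteration\<close>

text \<open>One of the four directions captures at least half of the modulus of \<open>z\<close>.
  Half of the exponent \<open>w\<close> absorbs the square; the other half is at least
  \<open>\<theta> * \<tau> / 4\<close> and becomes the decay factor. Thus an exponential moment
  controls the square mass above the level \<open>\<theta>\<close> with an exponentially small
  factor.\<close>

lemma square_le_exp_directions: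
  fixes z :: complex and \<tau> \<theta> :: real
  assumes "0 < \<tau>" "\<theta> < norm z" "0 \<le> \<theta>"
  shows "(\<tau> * norm z)\<^sup>2 \<le> 32 * exp (- (\<theta> * \<tau> / 4)) * (\<Sum>\<sigma>\<in>{1, -1, \<i>, -\<i>}. exp (\<tau> * Re (\<sigma> * z)))"
proof -
  define w where "w = \<tau> * max \<bar>Re z\<bar> \<bar>Im z\<bar>"
  have "norm z \<le> \<bar>Re z\<bar> + \<bar>Im z\<bar>" by (rule cmod_le)
  then have "norm z \<le> 2 * max \<bar>Re z\<bar> \<bar>Im z\<bar>" by linarith
  then have nz: "\<tau> * norm z \<le> 2 * w"
    using assms(1) by (simp add: w_def mult.left_commute)
  have "\<tau> * \<theta> < \<tau> * norm z" using assms(1,2) by simp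
  with nz have T: "\<theta> * \<tau> / 4 \<le> w / 2" by (simp add: mult.commute)
  have w0: "0 \<le> w" using T assms(1,3) by (smt (verit) mult_nonneg_nonneg zero_le_divide_iff)
  have "1 + w / 2 + (w / 2)\<^sup>2 / 2 \<le> exp (w / 2)"
    using w0 by (intro exp_lower_Taylor_quadratic) simp
  then have w2: "w\<^sup>2 \<le> 8 * exp (w / 2)" using w0 by (simp add: power_divide)
  have "(\<tau> * norm z)\<^sup>2 \<le> (2 * w)\<^sup>2"
    using nz assms(1) by (intro power_mono) auto
  also have "\<dots> \<le> 32 * exp (w / 2)" using w2 by simp
  also have "\<dots> = 32 * exp (- (w / 2)) * exp w" by (simp flip: exp_add)
  also have "\<dots> \<le> 32 * exp (- (\<theta> * \<tau> / 4)) * exp w" using T by simp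
  also have "exp w \<le> (\<Sum>\<sigma>\<in>{1, -1, \<i>, -\<i>}. exp (\<tau> * Re (\<sigma> * z)))"
  proof -
    have "(\<Sum>\<sigma>\<in>{1, -1, \<i>, -\<i>}. exp (\<tau> * Re (\<sigma> * z)))
        = exp (\<tau> * Re z) + exp (- (\<tau> * Re z)) + exp (- (\<tau> * Im z)) + exp (\<tau> * Im z)"
      by (simp add: complex_eq_iff)
    moreover have "w \<in> {\<tau> * Re z, - (\<tau> * Re z), - (\<tau> * Im z), \<tau> * Im z}"
      by (auto simp: w_def max_def abs_if)
    ultimately show ?thesis by (auto simp: add_nonneg_nonneg)
  qed
  finally show ?thesis by simp
qed

text \<open>Divided by \<open>A\<close>, the polynomial is a convex combination of the atoms
  \<open>sgn (a k) * trig_exp k x\<close> with weights \<open>norm (a k) / A\<close>. An average of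
  \<open>\<mu>\<close> greedily chosen atoms leaves the remainder with coefficients
  \<open>c\<close>, whose real parts in four directions have bounded exponential moments at the
  scale \<open>A / sqrt \<mu>\<close>.\<close>

lemma greedy_trig_approx:
  fixes a :: "int ^ 'd::finite \<Rightarrow> complex"
  assumes "1 \<le> \<mu>" and A: "A = (\<Sum>k\<in>cube N. norm (a k))" "0 < A"
  shows "\<exists>c. trig_sparse \<mu> (\<lambda>x. trig_sum (cube N) a x - trig_sum (cube N) c x) \<and>
    (\<Sum>j\<in>grid M. \<Sum>\<sigma>\<in>{1, -1, \<i>, -\<i>}. exp (sqrt (real \<mu>) / (2 * A) * Re (\<sigma> * trig_sum (cube N) c (grid_pt M j))))
      \<le> 4 * exp 1 * real (M ^ CARD('d))"
proof -
  define F where "F x = trig_sum (cube N) a x / of_real A" for x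
  define w where "w k = norm (a k) / A" for k
  define P where "P = (grid M :: ('d \<Rightarrow> nat) set) \<times> {1, -1, \<i>, -\<i>}"
  \<comment> \<open>The factor 1/2 normalises a difference of two quantities of modulus at most
    1.\<close>
  define v where "v k p = Re (snd p * (F (grid_pt M (fst p)) - sgn (a k) * trig_exp k (grid_pt M (fst p)))) / 2"
    for k and p :: "('d \<Rightarrow> nat) \<times> complex"
  \<comment> \<open>With this choice the growth factor
    \<open>exp (real \<mu> * \<tau>\<^sup>2)\<close> equals \<open>exp 1\<close>.\<close>
  define \<tau> where "\<tau> = 1 / sqrt (real \<mu>)"
  have Re_cmult: "Re (of_real r * z) = r * Re z" for r z by simp
  have wsum: "(\<Sum>k\<in>cube N. w k) = 1"
    using A by (simp add: w_def flip: sum_divide_distrib)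
  have aw: "of_real (w k) * (sgn (a k) * trig_exp k x) = a k * trig_exp k x / of_real A" for k x
    by (simp add: w_def sgn_eq)
  have F1: "norm (F x) \<le> 1" for x
  proof -
    have "norm (trig_sum (cube N) a x) \<le> A"
      unfolding A(1) by (rule order_trans[OF norm_sum]) (simp add: norm_mult)
    then show ?thesis using A(2) by (simp add: F_def norm_divide)
  qed
  have cardP: "card P = 4 * M ^ CARD('d)"
    by (simp add: P_def card_cartesian_product card_grid complex_eq_iff)
  have \<tau>2: "real \<mu> * \<tau>\<^sup>2 = 1"
    using assms(1) by (simp add: \<tau>_def power_divide)
  have "\<exists>\<kappa>::nat \<Rightarrow> int ^ 'd. (\<forall>i<\<mu>. \<kappa> i \<in> cube N) \<and>
    (\<Sum>p\<in>P. exp (\<tau> * (\<Sum>i<\<mu>. v (\<kappa> i) p))) \<le> real (card P) * exp (real \<mu> * \<tau>\<^sup>2)"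
  proof (rule greedy_exponential_moment[where w = w])
    show "finite P" by (simp add: P_def)
    show "\<bar>v k p\<bar> \<le> 1" if "k \<in> cube N" "p \<in> P" for k p
    proof -
      have "norm (snd p) = 1" using that(2) by (auto simp: P_def)
      have "\<bar>v k p\<bar> \<le> norm (snd p * (F (grid_pt M (fst p)) - sgn (a k) * trig_exp k (grid_pt M (fst p)))) / 2"
        unfolding v_def abs_divide abs_numeral by (intro divide_right_mono abs_Re_le_cmod) simp
      also have "\<dots> \<le> (norm (F (grid_pt M (fst p))) + norm (sgn (a k) * trig_exp k (grid_pt M (fst p)))) / 2"
        unfolding norm_mult[of "snd p"] \<open>norm (snd p) = 1\<close> mult_1
        by (intro divide_right_mono norm_triangle_ineq4) simp
      also have "\<dots> \<le> (1 + 1) / 2"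
        by (intro divide_right_mono add_mono F1) (auto simp: norm_mult norm_sgn)
      finally show ?thesis by simp
    qed
    show "(\<Sum>k\<in>cube N. w k * v k p) = 0" if "p \<in> P" for p
    proof -
      define x where "x = grid_pt M (fst p)"
      have "(\<Sum>k\<in>cube N. of_real (w k) * (F x - sgn (a k) * trig_exp k x))
          = of_real (\<Sum>k\<in>cube N. w k) * F x - F x"
        unfolding right_diff_distrib sum_subtractf aw of_real_sum sum_distrib_right
        by (simp add: F_def sum_divide_distrib)
      also have "\<dots> = 0" using wsum by simp
      finally have z: "(\<Sum>k\<in>cube N. of_real (w k) * (F x - sgn (a k) * trig_exp k x)) = 0" .
      have "(\<Sum>k\<in>cube N. w k * v k p) = (\<Sum>k\<in>cube N. Re (snd p * (of_real (w k) * (F x - sgn (a k) * trig_exp k x))) / 2)"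
      proof (intro sum.cong refl)
        fix k
        have "snd p * (of_real (w k) * (F x - sgn (a k) * trig_exp k x))
            = of_real (w k) * (snd p * (F x - sgn (a k) * trig_exp k x))" by (rule mult.left_commute)
        then show "w k * v k p = Re (snd p * (of_real (w k) * (F x - sgn (a k) * trig_exp k x))) / 2"
          unfolding v_def x_def[symmetric] by (simp only: Re_cmult times_divide_eq_right)
      qed
      also have "\<dots> = Re (snd p * (\<Sum>k\<in>cube N. of_real (w k) * (F x - sgn (a k) * trig_exp k x))) / 2"
        by (simp only: sum_divide_distrib sum_distrib_left Re_sum)
      also have "\<dots> = 0" unfolding z by simp
      finally show ?thesis .
    qed
  qed (use A(2) wsum assms(1) in \<open>auto simp: w_def \<tau>_def\<close>)
  then obtain \<kappa> :: "nat \<Rightarrow> int ^ 'd" where \<kappa>: "\<And>i. i < \<mu> \<Longrightarrow> \<kappa> i \<in> cube N"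
    "(\<Sum>p\<in>P. exp (\<tau> * (\<Sum>i<\<mu>. v (\<kappa> i) p))) \<le> 4 * real (M ^ CARD('d)) * exp 1"
    unfolding cardP \<tau>2 by auto
  \<comment> \<open>Repeated choices of a frequency are merged with their multiplicity, so at most
    \<open>\<mu>\<close> frequencies occur.\<close>
  define b where "b k = of_real (A / real \<mu>) * (of_nat (card {i \<in> {..<\<mu>}. \<kappa> i = k}) * sgn (a k))" for k
  define c where "c k = a k - b k" for k
  define h where "h x = trig_sum (cube N) c x" for x
  have b_out: "b k = 0" if "k \<notin> \<kappa> ` {..<\<mu>}" for k
  proof -
    have "{i \<in> {..<\<mu>}. \<kappa> i = k} = {}" using that by auto
    then show ?thesis by (simp add: b_def)
  qed
  have bsum: "trig_sum (cube N) b x = of_real (A / real \<mu>) * (\<Sum>i<\<mu>. sgn (a (\<kappa> i)) * trig_exp (\<kappa> i) x)" for x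
  proof -
    have "(\<Sum>i<\<mu>. sgn (a (\<kappa> i)) * trig_exp (\<kappa> i) x)
        = (\<Sum>k\<in>cube N. \<Sum>i\<in>{i \<in> {..<\<mu>}. \<kappa> i = k}. sgn (a (\<kappa> i)) * trig_exp (\<kappa> i) x)"
      by (rule sum.group[symmetric]) (use \<kappa>(1) in auto)
    also have "\<dots> = (\<Sum>k\<in>cube N. of_nat (card {i \<in> {..<\<mu>}. \<kappa> i = k}) * (sgn (a k) * trig_exp k x))"
      by (intro sum.cong refl) simp
    finally show ?thesis by (simp add: b_def sum_distrib_left mult.assoc)
  qed
  have "trig_sum (cube N) a x - h x = trig_sum (cube N) b x" for x
    by (simp add: h_def c_def left_diff_distrib sum_subtractf)
  moreover have "trig_sum (cube N) b x = (\<Sum>k\<in>\<kappa> ` {..<\<mu>}. b k * trig_exp k x)" for x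
    using \<kappa>(1) b_out by (intro sum.mono_neutral_right) auto
  moreover have "card (\<kappa> ` {..<\<mu>}) \<le> \<mu>"
    using card_image_le[of "{..<\<mu>}" \<kappa>] by simp
  ultimately have sp: "trig_sparse \<mu> (\<lambda>x. trig_sum (cube N) a x - h x)"
    by (simp add: trig_sparse_sum)
  have h_eq: "h x = of_real (A / real \<mu>) * (\<Sum>i<\<mu>. F x - sgn (a (\<kappa> i)) * trig_exp (\<kappa> i) x)" for x
  proof -
    have "h x = of_real A * F x - trig_sum (cube N) b x"
      using A(2) by (simp add: h_def c_def F_def left_diff_distrib sum_subtractf)
    then show ?thesis
      unfolding bsum using assms(1) by (simp add: sum_subtractf right_diff_distrib)
  qed
  have key: "\<tau> * (\<Sum>i<\<mu>. v (\<kappa> i) (j, \<sigma>)) = sqrt (real \<mu>) / (2 * A) * Re (\<sigma> * h (grid_pt M j))" for j \<sigma>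
  proof -
    have "\<sigma> * h (grid_pt M j) = of_real (A / real \<mu>) *
        (\<Sum>i<\<mu>. \<sigma> * (F (grid_pt M j) - sgn (a (\<kappa> i)) * trig_exp (\<kappa> i) (grid_pt M j)))"
      unfolding h_eq sum_distrib_left[symmetric] by (rule mult.left_commute)
    then have "Re (\<sigma> * h (grid_pt M j)) = A / real \<mu> *
        (\<Sum>i<\<mu>. Re (\<sigma> * (F (grid_pt M j) - sgn (a (\<kappa> i)) * trig_exp (\<kappa> i) (grid_pt M j))))"
      by (simp only: Re_cmult Re_sum)
    also have "\<dots> = A / real \<mu> * (2 * (\<Sum>i<\<mu>. v (\<kappa> i) (j, \<sigma>)))"
    proof -
      have "Re (\<sigma> * (F (grid_pt M j) - sgn (a (\<kappa> i)) * trig_exp (\<kappa> i) (grid_pt M j))) = 2 * v (\<kappa> i) (j, \<sigma>)" for i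
        unfolding v_def fst_conv snd_conv by linarith
      then show ?thesis by (simp only: sum_distrib_left)
    qed
    finally have "Re (\<sigma> * h (grid_pt M j)) = A / real \<mu> * (2 * (\<Sum>i<\<mu>. v (\<kappa> i) (j, \<sigma>)))" .
    moreover have "sqrt (real \<mu>) / real \<mu> = \<tau>"
      using assms(1) by (simp add: \<tau>_def real_sqrt_divide field_simps)
    moreover have "sqrt (real \<mu>) / (2 * A) * (A / real \<mu> * (2 * y)) = sqrt (real \<mu>) / real \<mu> * y" for y
      using A(2) by simp
    ultimately show ?thesis by simp
  qed
  have "(\<Sum>j\<in>grid M. \<Sum>\<sigma>\<in>{1, -1, \<i>, -\<i>}. exp (sqrt (real \<mu>) / (2 * A) * Re (\<sigma> * h (grid_pt M j))))
      = (\<Sum>p\<in>P. exp (\<tau> * (\<Sum>i<\<mu>. v (\<kappa> i) p)))"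
    unfolding key[symmetric] P_def by (rule sum.cartesian_product[of "\<lambda>j \<sigma>. exp (\<tau> * (\<Sum>i<\<mu>. v (\<kappa> i) (j, \<sigma>)))", unfolded case_prod_beta prod.collapse])
  with \<kappa>(2) have "(\<Sum>j\<in>grid M. \<Sum>\<sigma>\<in>{1, -1, \<i>, -\<i>}. exp (sqrt (real \<mu>) / (2 * A) * Re (\<sigma> * h (grid_pt M j))))
      \<le> 4 * exp 1 * real (M ^ CARD('d))" by (simp add: mult_ac)
  with sp show ?thesis unfolding h_def by blast
qed

text \<open>The level \<open>\<theta>\<close> is set so that the decay factor
  \<open>exp (- (\<theta> * \<tau> / 4))\<close> is \<open>1 / Y\<close>, with \<open>Y\<close>
  proportional to \<open>X\<close>. This beats the number of coefficients of
  \<open>cube (3 * N)\<close>, which is of order \<open>X * \<mu>\<close>. The price is the factor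
  \<open>ln Y = c0 + ln X\<close> in the uniform error.\<close>

lemma sparse_step:
  fixes a :: "int ^ 'd::finite \<Rightarrow> complex"
  defines "c0 \<equiv> ln (8192 * exp 1 * 7 ^ CARD('d))"
  assumes "1 \<le> N" "1 \<le> \<mu>" "1 \<le> X" and X: "real N ^ CARD('d) \<le> X * real \<mu>"
    and A: "A = (\<Sum>k\<in>cube N. norm (a k))" "0 < A"
  shows "\<exists>g a'. trig_sparse \<mu> g \<and> (\<Sum>k\<in>cube (3 * N). norm (a' k)) \<le> A / 4 \<and>
    (\<forall>x. norm (trig_sum (cube N) a x - g x - trig_sum (cube (3 * N)) a' x)
       \<le> 16 * sqrt (2 ^ CARD('d)) * A * (c0 + ln X) / sqrt (real \<mu>))"
proof -
  define M where "M = 6 * N + 1"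
  define \<tau> where "\<tau> = sqrt (real \<mu>) / (2 * A)"
  \<comment> \<open>The constant makes the product below equal to \<open>(A / 4)\<^sup>2\<close>:
    the 7 comes from \<open>6 * N + 1 \<le> 7 * N\<close>, and 8192 is 16 times 512, where
    \<open>512 * exp 1\<close> is the constant in \<open>S2\<close>.\<close>
  define Y where "Y = 8192 * exp 1 * 7 ^ CARD('d) * X"
  define \<theta> where "\<theta> = 4 * ln Y / \<tau>"
  have \<tau>: "0 < \<tau>" using assms by (simp add: \<tau>_def)
  have c1: "1 \<le> 8192 * exp 1 * (7::real) ^ CARD('d)"
  proof -
    have "1 * 1 * 1 \<le> 8192 * exp 1 * (7::real) ^ CARD('d)" by (intro mult_mono) auto
    then show ?thesis by simp
  qed
  have "1 * 1 \<le> Y" unfolding Y_def using c1 assms(4) by (intro mult_mono) auto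
  then have Y: "1 \<le> Y" by simp
  have lnY: "ln Y = c0 + ln X"
    unfolding Y_def c0_def using c1 assms(4) by (intro ln_mult_pos) auto
  have \<theta>: "0 \<le> \<theta>" using Y \<tau> by (simp add: \<theta>_def)
  have e_theta: "exp (- (\<theta> * \<tau> / 4)) = 1 / Y"
    using Y \<tau> by (simp add: \<theta>_def exp_minus inverse_eq_divide)
  obtain c where sp: "trig_sparse \<mu> (\<lambda>x. trig_sum (cube N) a x - trig_sum (cube N) c x)"
    and mom: "(\<Sum>j\<in>grid M. \<Sum>\<sigma>\<in>{1, -1, \<i>, -\<i>}. exp (\<tau> * Re (\<sigma> * trig_sum (cube N) c (grid_pt M j))))
      \<le> 4 * exp 1 * real (M ^ CARD('d))"
    using greedy_trig_approx[OF assms(3) A] unfolding \<tau>_def by blast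
  define h where "h x = trig_sum (cube N) c x" for x
  define S where "S = (\<Sum>j\<in>{j \<in> grid M. norm (h (grid_pt M j)) > \<theta>}. (norm (h (grid_pt M j)))\<^sup>2)"
  define E where "E j = (\<Sum>\<sigma>\<in>{1, -1, \<i>, -\<i>}. exp (\<tau> * Re (\<sigma> * h (grid_pt M j))))" for j
  have "\<tau>\<^sup>2 * S \<le> (\<Sum>j\<in>{j \<in> grid M. norm (h (grid_pt M j)) > \<theta>}. 32 / Y * E j)"
    unfolding S_def sum_distrib_left
  proof (rule sum_mono)
    fix j :: "'d \<Rightarrow> nat" assume "j \<in> {j \<in> grid M. norm (h (grid_pt M j)) > \<theta>}"
    then have "\<theta> < norm (h (grid_pt M j))" by simp
    from square_le_exp_directions[OF \<tau> this \<theta>]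
    show "\<tau>\<^sup>2 * (norm (h (grid_pt M j)))\<^sup>2 \<le> 32 / Y * E j"
      unfolding e_theta power_mult_distrib E_def by simp
  qed
  also have "\<dots> \<le> (\<Sum>j\<in>grid M. 32 / Y * E j)"
  proof (rule sum_mono2)
    have "0 \<le> E j" for j unfolding E_def by (intro sum_nonneg) simp
    then show "0 \<le> 32 / Y * E j" for j using Y by (intro mult_nonneg_nonneg) auto
  qed auto
  also have "\<dots> \<le> 32 / Y * (4 * exp 1 * real (M ^ CARD('d)))"
    unfolding sum_distrib_left[symmetric] using mom Y unfolding E_def h_def
    by (intro mult_left_mono) auto
  finally have S1: "\<tau>\<^sup>2 * S \<le> 128 * exp 1 * real (M ^ CARD('d)) / Y" by simp
  have m: "0 < real (M ^ CARD('d))" by (simp add: M_def)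
  have \<tau>2: "\<tau>\<^sup>2 = real \<mu> / (4 * A\<^sup>2)"
    by (simp add: \<tau>_def power_divide power_mult_distrib)
  have \<mu>: "0 < real \<mu>" using assms(3) by simp
  have S2: "S / real (M ^ CARD('d)) \<le> 512 * exp 1 * A\<^sup>2 / (Y * real \<mu>)"
    using S1 m A(2) Y \<mu> unfolding \<tau>2 by (simp add: field_simps)
  have "real (6 * N + 1) \<le> 7 * real N" using assms(2) by simp
  then have "real ((6 * N + 1) ^ CARD('d)) \<le> (7 * real N) ^ CARD('d)"
    unfolding of_nat_power by (intro power_mono) auto
  also have "\<dots> \<le> 7 ^ CARD('d) * (X * real \<mu>)"
    using X by (simp add: power_mult_distrib)
  finally have K: "real ((6 * N + 1) ^ CARD('d)) \<le> 7 ^ CARD('d) * (X * real \<mu>)" .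
  have S0: "0 \<le> S" by (simp add: S_def sum_nonneg)
  have "real ((6 * N + 1) ^ CARD('d)) * (S / real (M ^ CARD('d)))
      \<le> 7 ^ CARD('d) * (X * real \<mu>) * (512 * exp 1 * A\<^sup>2 / (Y * real \<mu>))"
    using S0 m assms(4) by (intro mult_mono K S2) auto
  also have "\<dots> = (A / 4)\<^sup>2"
    using \<mu> assms(4) by (simp add: Y_def power_divide)
  finally have fin: "sqrt (real ((6 * N + 1) ^ CARD('d)) * (S / real (M ^ CARD('d)))) \<le> A / 4"
    using A(2) by (intro real_le_lsqrt) auto
  have "\<exists>c'. (\<forall>x. norm (h x - trig_sum (cube (3 * N)) c' x) \<le> sqrt (2 ^ CARD('d)) * \<theta>) \<and>
    (\<Sum>k\<in>cube (3 * N). norm (c' k)) \<le> sqrt (real ((6 * N + 1) ^ CARD('d)) * (S / real (M ^ CARD('d))))"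
    unfolding h_def S_def by (rule trig_sum_split) (use \<theta> in \<open>auto simp: M_def\<close>)
  then obtain c' where c': "\<And>x. norm (h x - trig_sum (cube (3 * N)) c' x) \<le> sqrt (2 ^ CARD('d)) * \<theta>"
    "(\<Sum>k\<in>cube (3 * N). norm (c' k)) \<le> sqrt (real ((6 * N + 1) ^ CARD('d)) * (S / real (M ^ CARD('d))))"
    by blast
  have \<theta>_le: "sqrt (2 ^ CARD('d)) * \<theta> \<le> 16 * sqrt (2 ^ CARD('d)) * A * (c0 + ln X) / sqrt (real \<mu>)"
  proof -
    have "\<theta> = 8 * A * (c0 + ln X) / sqrt (real \<mu>)"
      unfolding \<theta>_def lnY \<tau>_def by simp
    moreover have "0 \<le> A * (c0 + ln X) / sqrt (real \<mu>)"
      using A(2) Y lnY by (metis divide_nonneg_nonneg less_imp_le ln_ge_zero mult_nonneg_nonneg of_nat_0_le_iff real_sqrt_ge_zero)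
    ultimately have "\<theta> \<le> 16 * A * (c0 + ln X) / sqrt (real \<mu>)" by simp
    then have "sqrt (2 ^ CARD('d)) * \<theta> \<le> sqrt (2 ^ CARD('d)) * (16 * A * (c0 + ln X) / sqrt (real \<mu>))"
      by (intro mult_left_mono) auto
    then show ?thesis by (simp only: times_divide_eq_right mult_ac)
  qed
  show ?thesis
  proof (intro exI conjI allI)
    show "trig_sparse \<mu> (\<lambda>x. trig_sum (cube N) a x - h x)"
      using sp by (simp add: h_def)
    show "(\<Sum>k\<in>cube (3 * N). norm (c' k)) \<le> A / 4" using c'(2) fin by simp
    fix x
    show "norm (trig_sum (cube N) a x - (trig_sum (cube N) a x - h x)
        - trig_sum (cube (3 * N)) c' x)
      \<le> 16 * sqrt (2 ^ CARD('d)) * A * (c0 + ln X) / sqrt (real \<mu>)"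
      using order_trans[OF c'(1)[of x] \<theta>_le] by simp
  qed
qed

text \<open>A predicate on \<open>C\<close>, so that one constant per dimension can be handed to
  later lemmas; the type token fixes the dimension. \<open>X\<close> is any bound, at least 1, for
  the ratio of \<open>N^d\<close> to \<open>2 ^ t\<close>. The budget \<open>2 ^ Suc t\<close> is
  the total of successively halved budgets that start at \<open>2 ^ t\<close>.\<close>

definition sparse_constant :: "'d::finite itself \<Rightarrow> real \<Rightarrow> bool" where
  "sparse_constant _ C \<longleftrightarrow> 0 < C \<and> (\<forall>t N X (a :: int ^ 'd \<Rightarrow> complex).
     1 \<le> N \<longrightarrow> 1 \<le> X \<longrightarrow> real N ^ CARD('d) \<le> X * 2 ^ t \<longrightarrow>
     (\<exists>g. trig_sparse (2 ^ Suc t) g \<and>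
       (\<forall>x. norm (trig_sum (cube N) a x - g x)
          \<le> C * (\<Sum>k\<in>cube N. norm (a k)) * (1 + ln X) / sqrt (2 ^ t))))"

text \<open>Induction on \<open>t\<close>: \<open>sparse_step\<close> spends half of the budget, and
  the induction hypothesis treats the rest, with degree tripled, number of terms halved and l1 norm
  quartered. The ratio \<open>X\<close> is multiplied by \<open>2 * 3 ^ CARD('d)\<close> in each
  round, so its logarithm grows only by the constant \<open>L\<close> while the norm shrinks
  geometrically.\<close>

theorem sparse_approximation: "\<exists>C. sparse_constant TYPE('d::finite) C"
proof -
  define c0 where "c0 = ln (8192 * exp 1 * (7::real) ^ CARD('d))"
  define L where "L = ln (2 * (3::real) ^ CARD('d))"
  define D where "D = 16 * sqrt (2 ^ CARD('d)) * (c0 + 1)"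
  have c0: "0 \<le> c0"
  proof -
    have "1 * 1 * 1 \<le> 8192 * exp 1 * (7::real) ^ CARD('d)" by (intro mult_mono) auto
    then show ?thesis by (simp add: c0_def)
  qed
  have L1: "1 \<le> L"
  proof -
    have "exp 1 \<le> (3::real)" using exp_le by simp
    also have "3 \<le> 2 * (3::real) ^ CARD('d)"
      using power_increasing[of 1 "CARD('d)" "3::real"] by (simp add: Suc_le_eq)
    finally show ?thesis unfolding L_def by (subst ln_ge_iff) auto
  qed
  have "1 * 1 \<le> D"
  proof -
    have "1 * 1 * 1 \<le> 16 * sqrt (2 ^ CARD('d)) * (c0 + 1)" using c0 by (intro mult_mono) auto
    then show ?thesis by (simp add: D_def)
  qed
  then have D: "1 \<le> D" by simp
  have main: "\<exists>g. trig_sparse (2 ^ Suc t) g \<and>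
       (\<forall>x. norm (trig_sum (cube N) a x - g x)
          \<le> 4 * D * (\<Sum>k\<in>cube N. norm (a k)) * (L + ln X) / sqrt (2 ^ t))"
    if "1 \<le> N" "1 \<le> X" "real N ^ CARD('d) \<le> X * 2 ^ t" for t N X and a :: "int ^ 'd \<Rightarrow> complex"
    using that
  proof (induction t arbitrary: N X a)
    case 0
    \<comment> \<open>The claimed error is at least the trivial bound \<open>A\<close> here, so the
      zero function suffices.\<close>
    define A where "A = (\<Sum>k\<in>cube N. norm (a k))"
    have triv: "norm (trig_sum (cube N) a x) \<le> A" for x
      unfolding A_def by (rule order_trans[OF norm_sum]) (simp add: norm_mult)
    have "A * 1 \<le> A * (4 * D * (L + ln X))"
    proof (rule mult_left_mono)
      have "1 * 1 \<le> (4 * D) * (L + ln X)"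
        using D L1 ln_ge_zero[OF 0(2)] by (intro mult_mono) linarith+
      then show "1 \<le> 4 * D * (L + ln X)" by simp
    qed (simp add: A_def sum_nonneg)
    then have "A \<le> 4 * D * A * (L + ln X) / sqrt (2 ^ 0)"
      by (simp add: mult_ac)
    then have "norm (trig_sum (cube N) a x - 0) \<le> 4 * D * A * (L + ln X) / sqrt (2 ^ 0)" for x
      using triv[of x] by (simp del: power_0 real_sqrt_one)
    then show ?case
      unfolding A_def[symmetric] by (intro exI[of _ "\<lambda>x. 0"] conjI allI trig_sparse_zero)
  next
    case (Suc t)
    define A where "A = (\<Sum>k\<in>cube N. norm (a k))"
    have A0: "0 \<le> A" by (simp add: A_def sum_nonneg)
    show ?case
    proof (cases "A = 0")
      case True
      then have "\<forall>k\<in>cube N. a k = 0"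
        by (simp add: A_def sum_nonneg_eq_0_iff)
      then have "trig_sum (cube N) a x = 0" for x by simp
      then show ?thesis
        unfolding A_def[symmetric] True by (intro exI[of _ "\<lambda>x. 0"] conjI allI trig_sparse_zero) simp
    next
      case False
      with A0 have Apos: "0 < A" by simp
      define R where "R = (L + ln X) / sqrt (2 ^ Suc t)"
      have lnX: "0 \<le> ln X" using Suc.prems(2) by simp
      have R0: "0 \<le> R" using L1 lnX by (simp add: R_def)
      obtain g a' where g: "trig_sparse (2 ^ Suc t) g" "(\<Sum>k\<in>cube (3 * N). norm (a' k)) \<le> A / 4"
        "\<And>x. norm (trig_sum (cube N) a x - g x - trig_sum (cube (3 * N)) a' x)
           \<le> 16 * sqrt (2 ^ CARD('d)) * A * (c0 + ln X) / sqrt (real (2 ^ Suc t))"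
        using sparse_step[of N "2 ^ Suc t" X A a] Suc.prems Apos unfolding A_def c0_def by auto
      define X' where "X' = 2 * 3 ^ CARD('d) * X"
      have t3: "1 \<le> 2 * (3::real) ^ CARD('d)"
        using one_le_power[of "3::real" "CARD('d)"] by linarith
      have "1 * 1 \<le> X'" unfolding X'_def using t3 Suc.prems(2) by (intro mult_mono) auto
      then have X': "1 \<le> X'" by simp
      have lnX': "ln X' = L + ln X"
        unfolding X'_def L_def using Suc.prems(2) by (intro ln_mult_pos) auto
      have N3: "real (3 * N) ^ CARD('d) \<le> X' * 2 ^ t"
        using Suc.prems(3) by (simp add: X'_def power_mult_distrib)
      have "1 \<le> 3 * N" using Suc.prems(1) by simp
      then obtain g' where g': "trig_sparse (2 ^ Suc t) g'"
        "\<And>x. norm (trig_sum (cube (3 * N)) a' x - g' x)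
          \<le> 4 * D * (\<Sum>k\<in>cube (3 * N). norm (a' k)) * (L + ln X') / sqrt (2 ^ t)"
        using Suc.IH[OF _ X' N3, of a'] by blast
      have sq: "1 / sqrt (2 ^ t) = sqrt 2 / sqrt (2 ^ Suc t)"
        by (simp add: real_sqrt_mult)
      have b1: "16 * sqrt (2 ^ CARD('d)) * A * (c0 + ln X) / sqrt (real (2 ^ Suc t)) \<le> D * A * R"
      proof -
        have "c0 * 1 \<le> c0 * (L + ln X)" using c0 L1 lnX by (intro mult_left_mono) auto
        then have "c0 + ln X \<le> (c0 + 1) * (L + ln X)" using L1 by (simp add: algebra_simps)
        then have "16 * sqrt (2 ^ CARD('d)) * A * (c0 + ln X) / sqrt (2 ^ Suc t)
           \<le> 16 * sqrt (2 ^ CARD('d)) * A * ((c0 + 1) * (L + ln X)) / sqrt (2 ^ Suc t)"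
          using A0 by (intro divide_right_mono mult_left_mono) auto
        then show ?thesis unfolding D_def R_def by (simp add: mult_ac)
      qed
      \<comment> \<open>The quarter of the l1 norm cancels the 4; the new logarithm costs a factor
        of at most 2 and the halved budget a factor \<open>sqrt 2\<close>. Since
        \<open>2 * sqrt 2 \<le> 3\<close>, the total 1 + 3 closes the induction with the constant
        \<open>4 * D\<close>.\<close>
      have b2: "4 * D * (\<Sum>k\<in>cube (3 * N). norm (a' k)) * (L + ln X') / sqrt (2 ^ t) \<le> 3 * D * A * R"
      proof -
        have "4 * D * (\<Sum>k\<in>cube (3 * N). norm (a' k)) * (L + ln X') / sqrt (2 ^ t)
            \<le> 4 * D * (A / 4) * (2 * (L + ln X)) / sqrt (2 ^ t)"
          unfolding lnX' using g(2) D L1 lnX A0 by (intro divide_right_mono mult_mono) (auto simp: sum_nonneg)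
        also have "\<dots> = 2 * D * A * (L + ln X) * (1 / sqrt (2 ^ t))" by simp
        also have "\<dots> = (2 * sqrt 2) * (D * A * R)"
          unfolding sq R_def by (simp add: mult_ac)
        also have "\<dots> \<le> 3 * (D * A * R)"
        proof (rule mult_right_mono)
          have "sqrt 2 \<le> 3 / 2" by (rule real_le_lsqrt) (auto simp: power2_eq_square)
          then show "2 * sqrt 2 \<le> 3" by simp
        qed (use D A0 R0 in simp)
        finally show ?thesis by simp
      qed
      have "norm (trig_sum (cube N) a x - (g x + g' x)) \<le> 4 * D * A * R" for x
      proof -
        define f where "f = trig_sum (cube N) a x"
        define f' where "f' = trig_sum (cube (3 * N)) a' x"
        have "norm (f - (g x + g' x)) = norm ((f - g x - f') + (f' - g' x))"
          by (simp add: algebra_simps)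
        also have "\<dots> \<le> norm (f - g x - f') + norm (f' - g' x)" by (rule norm_triangle_ineq)
        also have "\<dots> \<le> D * A * R + 3 * D * A * R"
          using order_trans[OF g(3) b1] order_trans[OF g'(2) b2] unfolding f_def f'_def by (rule add_mono)
        finally show ?thesis by (simp add: f_def mult_ac)
      qed
      moreover have "trig_sparse (2 ^ Suc (Suc t)) (\<lambda>x. g x + g' x)"
        using trig_sparse_add[OF g(1) g'(1)] by (simp add: mult_2)
      ultimately show ?thesis
        unfolding A_def[symmetric] R_def
        by (intro exI[of _ "\<lambda>x. g x + g' x"] conjI allI) simp_all
    qed
  qed
  show ?thesis
    unfolding sparse_constant_def
  proof (intro exI[of _ "4 * D * L"] conjI allI impI)
    show "0 < 4 * D * L" using D L1 by simp
    fix t N X and a :: "int ^ 'd \<Rightarrow> complex"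
    assume *: "1 \<le> N" "(1::real) \<le> X" "real N ^ CARD('d) \<le> X * 2 ^ t"
    obtain g where g: "trig_sparse (2 ^ Suc t) g" "\<And>x. norm (trig_sum (cube N) a x - g x)
          \<le> 4 * D * (\<Sum>k\<in>cube N. norm (a k)) * (L + ln X) / sqrt (2 ^ t)"
      using main[OF *] by blast
    have "ln X * 1 \<le> ln X * L" using *(2) L1 by (intro mult_left_mono) auto
    then have "L + ln X \<le> L * (1 + ln X)" by (simp add: algebra_simps)
    then have "4 * D * (\<Sum>k\<in>cube N. norm (a k)) * (L + ln X) / sqrt (2 ^ t)
       \<le> 4 * D * (\<Sum>k\<in>cube N. norm (a k)) * (L * (1 + ln X)) / sqrt (2 ^ t)"
      using D by (intro divide_right_mono mult_left_mono) (auto simp: sum_nonneg)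
    then have "norm (trig_sum (cube N) a x - g x)
          \<le> 4 * D * L * (\<Sum>k\<in>cube N. norm (a k)) * (1 + ln X) / sqrt (2 ^ t)" for x
      using g(2)[of x] by (simp add: mult_ac)
    with g(1) show "\<exists>g. trig_sparse (2 ^ Suc t) g \<and>
       (\<forall>x. norm (trig_sum (cube N) a x - g x)
          \<le> 4 * D * L * (\<Sum>k\<in>cube N. norm (a k)) * (1 + ln X) / sqrt (2 ^ t))" by blast
  qed
qed


subsection \<open>Decay of the weight\<close>

lemma class_B_pos: "\<psi> \<in> class_B \<Longrightarrow> 1 \<le> t \<Longrightarrow> 0 < \<psi> t"
  by (simp add: class_B_def)

lemma class_B_antimono: "\<psi> \<in> class_B \<Longrightarrow> 1 \<le> s \<Longrightarrow> s \<le> t \<Longrightarrow> \<psi> t \<le> \<psi> s"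
  by (auto simp: class_B_def monotone_on_def)

text \<open>The doubling condition is iterated until \<open>2 ^ j > R\<close>. This lets values of
  \<open>\<psi>\<close> at comparable frequency scales be exchanged.\<close>

lemma class_B_dilation:
  assumes "\<psi> \<in> class_B"
  shows "\<exists>K\<ge>1. \<forall>v u. 1 \<le> v \<longrightarrow> v \<le> u \<longrightarrow> u \<le> R * v \<longrightarrow> \<psi> v \<le> K * \<psi> u"
proof -
  obtain K where K: "\<And>t. 1 \<le> t \<Longrightarrow> 1 \<le> \<psi> t / \<psi> (2 * t) \<and> \<psi> t / \<psi> (2 * t) \<le> K"
    using assms unfolding class_B_def by blast
  have K1: "1 \<le> K" using K[of 1] by linarith
  have double: "\<psi> v \<le> K * \<psi> (2 * v)" if "1 \<le> v" for v
    using K[OF that] class_B_pos[OF assms, of "2 * v"] that by (simp add: pos_divide_le_eq)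
  have it: "\<psi> v \<le> K ^ j * \<psi> (2 ^ j * v)" if "1 \<le> v" for v j
  proof (induction j)
    case (Suc j)
    have "1 * 1 \<le> 2 ^ j * v" using that by (intro mult_mono) auto
    then have "\<psi> (2 ^ j * v) \<le> K * \<psi> (2 * (2 ^ j * v))" by (intro double) simp
    then have "K ^ j * \<psi> (2 ^ j * v) \<le> K ^ j * (K * \<psi> (2 * (2 ^ j * v)))"
      using K1 by (intro mult_left_mono) auto
    with Suc show ?case by (simp add: mult_ac)
  qed simp
  obtain j where j: "R < 2 ^ j" using real_arch_pow[of 2 R] by auto
  show ?thesis
  proof (intro exI[of _ "K ^ j"] conjI allI impI)
    show "1 \<le> K ^ j" using K1 by simp
    fix v u :: real assume *: "1 \<le> v" "v \<le> u" "u \<le> R * v"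
    have "R * v \<le> 2 ^ j * v" using j *(1) by (intro mult_right_mono) auto
    then have "\<psi> (2 ^ j * v) \<le> \<psi> u"
      using * by (intro class_B_antimono[OF assms]) linarith+
    then have "K ^ j * \<psi> (2 ^ j * v) \<le> K ^ j * \<psi> u" using K1 by (intro mult_left_mono) auto
    with it[OF *(1), of j] show "\<psi> v \<le> K ^ j * \<psi> u" by simp
  qed
qed

text \<open>Slopes from \<open>t\<close> to the right decrease as the right end approaches
  \<open>t\<close>, and stay above the slope \<open>s\<close> between \<open>y\<close> and
  \<open>t\<close>. Their infimum \<open>D\<close> is therefore their limit: the derivative selected
  by \<open>right_deriv\<close> exists and equals \<open>D\<close>, and \<open>s \<le> D\<close> is
  the supporting line at a point to the left of \<open>t\<close>.\<close>

lemma convex_right_deriv_subgradient: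
  fixes f :: "real \<Rightarrow> real"
  assumes cvx: "convex_on {a<..} f" and "a < y" "y < t"
  shows "f t + right_deriv f t * (y - t) \<le> f y"
    and "antimono_on {a<..} f \<Longrightarrow> right_deriv f t \<le> 0"
proof -
  define g where "g z = (f z - f t) / (z - t)" for z
  define D where "D = Inf (g ` {t<..})"
  define s where "s = (f y - f t) / (y - t)"
  have flip: "g z = (f t - f z) / (t - z)" for z
    unfolding g_def by (metis minus_diff_eq minus_divide_divide)
  have mono: "g z \<le> g w" if "t < z" "z < w" for z w
    unfolding flip using that assms(2,3) by (intro convex_on_slope_le(1)[OF cvx]) auto
  have lower: "s \<le> g z" if "t < z" for z
    unfolding flip s_def using convex_on_slope_le[OF cvx, of y z t] that assms(2,3) by auto
  have bdd: "bdd_below (g ` {t<..})" using lower by (intro bdd_belowI2) auto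
  have sD: "s \<le> D" unfolding D_def using lower by (intro cINF_greatest) auto
  have Dle: "D \<le> g z" if "t < z" for z
    unfolding D_def using bdd that by (intro cINF_lower) auto
  have "(g \<longlongrightarrow> D) (at_right t)"
  proof (rule tendstoI)
    fix e :: real assume "0 < e"
    then have "\<exists>z\<in>{t<..}. g z < D + e"
      using cINF_less_iff[OF _ bdd, of "D + e"] unfolding D_def by auto
    then obtain z0 where z0: "t < z0" "g z0 < D + e" by auto
    have "dist (g z) D < e" if "t < z" "z < z0" for z
      using Dle[OF that(1)] mono[OF that] z0(2) by (simp add: dist_real_def)
    then show "\<forall>\<^sub>F z in at_right t. dist (g z) D < e"
      unfolding eventually_at_right_field using z0(1) by blast
  qed
  then have "(f has_real_derivative D) (at_right t)"
    unfolding has_field_derivative_iff g_def .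
  then have "(f has_vector_derivative D) (at_right t)"
    by (simp add: has_real_derivative_iff_has_vector_derivative)
  then have rd: "right_deriv f t = D"
    unfolding right_deriv_def by (intro vector_derivative_within) auto
  have "(t - y) * s = f t - f y"
    using assms(3) by (simp add: s_def field_simps)
  moreover have "(t - y) * s \<le> (t - y) * D" using sD assms(3) by (intro mult_left_mono) auto
  ultimately show "f t + right_deriv f t * (y - t) \<le> f y"
    unfolding rd by (simp add: algebra_simps)
  show "right_deriv f t \<le> 0" if "antimono_on {a<..} f"
  proof -
    have "f (t + 1) \<le> f t" using that assms(2,3) by (auto simp: monotone_on_def)
    then have "g (t + 1) \<le> 0" by (simp add: g_def)
    with Dle[of "t + 1"] show ?thesis unfolding rd by simp
  qed
qed

text \<open>At \<open>\<rho> = 1\<close> both sides equal 1, and their derivatives there are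
  \<open>b\<close> and \<open>\<beta>\<close>.\<close>

lemma ex_dilation_factor:
  fixes \<beta> b :: real
  assumes "b < \<beta>"
  shows "\<exists>\<rho>>1. \<rho> powr b \<le> 1 + \<beta> * (1 - 1 / \<rho>)"
proof -
  define \<phi> where "\<phi> x = 1 + \<beta> * (1 - 1 / x) - x powr b" for x :: real
  have "(\<phi> has_real_derivative \<beta> - b) (at 1)"
    unfolding \<phi>_def by (auto intro!: derivative_eq_intros)
  then obtain d where d: "d > 0" "\<And>h. 0 < h \<Longrightarrow> h < d \<Longrightarrow> \<phi> 1 < \<phi> (1 + h)"
    using has_real_derivative_pos_inc_right[of \<phi> "\<beta> - b" 1 UNIV] assms by auto
  have "\<phi> 1 < \<phi> (1 + d / 2)" using d by simp
  moreover have "\<phi> 1 = 0" by (simp add: \<phi>_def)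
  ultimately have "0 < \<phi> (1 + d / 2)" by simp
  then show ?thesis using d(1) by (intro exI[of _ "1 + d / 2"]) (simp add: \<phi>_def)
qed

text \<open>The supporting line at \<open>u = \<rho> * t\<close>, evaluated at \<open>t\<close>,
  together with the slope bound at \<open>u\<close> gives
  \<open>(1 + \<beta> * (1 - 1 / \<rho>)) * \<psi> u \<le> \<psi> t\<close>, and
  \<open>ex_dilation_factor\<close> bounds the factor below by \<open>\<rho> powr b\<close>.
  Iterating over powers of a fixed \<open>\<rho>\<close> gives the power decay; the gap between
  \<open>b\<close> and \<open>\<beta>\<close> is what permits a fixed \<open>\<rho>\<close>.\<close>

lemma class_B_decay:
  assumes B: "\<psi> \<in> class_B" and t0: "1 \<le> t0" and cvx: "convex_on {t0<..} \<psi>"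
    and slope: "\<And>t. t > t0 \<Longrightarrow> t * \<bar>right_deriv \<psi> t\<bar> / \<psi> t \<ge> \<beta>"
    and b: "0 < b" "b < \<beta>"
  shows "\<exists>C\<ge>1. \<forall>v u. 1 \<le> v \<longrightarrow> v \<le> u \<longrightarrow> \<psi> u \<le> C * (v / u) powr b * \<psi> v"
proof -
  obtain \<rho> where \<rho>: "1 < \<rho>" "\<rho> powr b \<le> 1 + \<beta> * (1 - 1 / \<rho>)"
    using ex_dilation_factor[OF b(2)] by blast
  have pos: "0 < \<psi> t" if "1 \<le> t" for t using class_B_pos[OF B that] .
  have anti: "\<psi> t \<le> \<psi> s" if "1 \<le> s" "s \<le> t" for s t using class_B_antimono[OF B that] .
  have anti0: "antimono_on {t0<..} \<psi>" using anti t0 by (auto simp: monotone_on_def)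
  have step: "\<rho> powr b * \<psi> (\<rho> * t) \<le> \<psi> t" if t: "t0 < t" for t
  proof -
    define u where "u = \<rho> * t"
    have "1 * t < \<rho> * t" using \<rho>(1) t t0 by (intro mult_strict_right_mono) auto
    then have u: "t < u" by (simp add: u_def)
    have u0: "0 < u" "0 < \<psi> u" "0 < t" using u t t0 pos[of u] by auto
    have "right_deriv \<psi> u \<le> 0" by (rule convex_right_deriv_subgradient(2)[OF cvx t u anti0])
    moreover have "\<beta> * \<psi> u \<le> u * \<bar>right_deriv \<psi> u\<bar>"
      using slope[of u] t u u0 by (simp add: pos_le_divide_eq)
    ultimately have "\<beta> * \<psi> u \<le> u * (- right_deriv \<psi> u)" by simp
    then have "(1 - 1 / \<rho>) * (\<beta> * \<psi> u) \<le> (1 - 1 / \<rho>) * (u * (- right_deriv \<psi> u))"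
      using \<rho>(1) by (intro mult_left_mono) auto
    also have "\<dots> = right_deriv \<psi> u * (t - u)"
      using \<rho>(1) by (simp add: u_def field_simps)
    finally have "\<psi> u + (1 - 1 / \<rho>) * (\<beta> * \<psi> u) \<le> \<psi> t"
      using convex_right_deriv_subgradient(1)[OF cvx t u] by linarith
    moreover have "\<rho> powr b * \<psi> u \<le> (1 + \<beta> * (1 - 1 / \<rho>)) * \<psi> u"
      using \<rho>(2) u0 by (intro mult_right_mono) auto
    ultimately show ?thesis by (simp add: u_def algebra_simps)
  qed
  have it: "(\<rho> ^ j) powr b * \<psi> (\<rho> ^ j * t) \<le> \<psi> t" if t: "t0 < t" for t j
  proof (induction j)
    case (Suc j)
    have pw: "(\<rho> ^ Suc j) powr b = (\<rho> ^ j) powr b * \<rho> powr b"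
      using \<rho>(1) by (simp add: powr_mult)
    have "1 * t \<le> \<rho> ^ j * t" using \<rho>(1) t t0 by (intro mult_right_mono) auto
    then have "\<rho> powr b * \<psi> (\<rho> * (\<rho> ^ j * t)) \<le> \<psi> (\<rho> ^ j * t)"
      using t by (intro step) simp
    then have "(\<rho> ^ j) powr b * (\<rho> powr b * \<psi> (\<rho> * (\<rho> ^ j * t))) \<le> (\<rho> ^ j) powr b * \<psi> (\<rho> ^ j * t)"
      by (intro mult_left_mono) auto
    with Suc show ?case unfolding pw by (simp add: mult_ac)
  qed (use t0 t in simp)
  \<comment> \<open>One further factor \<open>\<rho> powr b\<close> covers the incomplete last step
    from \<open>\<rho> ^ j * v\<close> to \<open>u\<close>.\<close>
  define C1 where "C1 = \<rho> powr b"
  have C1: "1 \<le> C1" unfolding C1_def using \<rho>(1) b(1) by (simp add: ge_one_powr_ge_zero)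
  have far: "\<psi> u \<le> C1 * (v / u) powr b * \<psi> v" if "t0 < v" "v \<le> u" for v u
  proof -
    define j where "j = nat \<lfloor>log \<rho> (u / v)\<rfloor>"
    have v0: "0 < v" "0 < u" "1 \<le> u / v" using that t0 by auto
    have l0: "0 \<le> log \<rho> (u / v)" using v0 \<rho>(1) by simp
    have "real j \<le> log \<rho> (u / v)" using l0 by (simp add: j_def)
    then have "\<rho> powr real j \<le> u / v" using \<rho>(1) v0 by (simp add: le_log_iff)
    then have j1: "\<rho> ^ j * v \<le> u" using \<rho>(1) v0 by (simp add: powr_realpow pos_le_divide_eq)
    have "log \<rho> (u / v) \<le> real (Suc j)" using l0 unfolding j_def by linarith
    then have "u / v \<le> \<rho> powr real (Suc j)" using \<rho>(1) v0 by (simp add: log_le_iff)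
    then have j2: "u / v \<le> \<rho> * \<rho> ^ j" using \<rho>(1) by (simp only: powr_realpow power_Suc)
    have "1 * v \<le> \<rho> ^ j * v" using \<rho>(1) v0 by (intro mult_right_mono) auto
    then have "\<psi> u \<le> \<psi> (\<rho> ^ j * v)" using j1 that t0 by (intro anti) linarith+
    moreover have "(u / v) powr b \<le> (\<rho> * \<rho> ^ j) powr b" using j2 v0 b by (intro powr_mono2) auto
    ultimately have "(u / v) powr b * \<psi> u \<le> (\<rho> * \<rho> ^ j) powr b * \<psi> (\<rho> ^ j * v)"
      using pos[of u] that t0 by (intro mult_mono) auto
    also have "\<dots> = C1 * ((\<rho> ^ j) powr b * \<psi> (\<rho> ^ j * v))"
      using \<rho>(1) by (simp add: C1_def powr_mult)
    also have "\<dots> \<le> C1 * \<psi> v" using it[OF that(1)] C1 by (intro mult_left_mono) auto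
    finally have *: "(u / v) powr b * \<psi> u \<le> C1 * \<psi> v" .
    have "(v / u) powr b * (u / v) powr b = 1"
      using v0 by (simp flip: powr_mult)
    then have "\<psi> u = (v / u) powr b * ((u / v) powr b * \<psi> u)" by (simp flip: mult.assoc)
    also have "\<dots> \<le> (v / u) powr b * (C1 * \<psi> v)" using * by (intro mult_left_mono) auto
    finally show ?thesis by (simp add: mult_ac)
  qed
  \<comment> \<open>For \<open>v \<le> t0\<close> the decay is started at \<open>t1\<close> instead
    of \<open>v\<close>, and monotonicity together with the factor \<open>t1 powr b\<close> covers
    the range up to \<open>t1\<close>.\<close>
  define t1 where "t1 = t0 + 1"
  have t1: "1 \<le> t1" "t0 < t1" using t0 by (auto simp: t1_def)
  have tp: "1 \<le> t1 powr b" using t1 b by (simp add: ge_one_powr_ge_zero)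
  show ?thesis
  proof (intro exI[of _ "C1 * t1 powr b"] conjI allI impI)
    have "1 * 1 \<le> C1 * t1 powr b" using C1 tp by (intro mult_mono) auto
    then show "1 \<le> C1 * t1 powr b" by simp
    fix v u :: real assume vu: "1 \<le> v" "v \<le> u"
    have pv: "0 < \<psi> v" using pos vu by simp
    have t1v: "(t1 / u) powr b \<le> t1 powr b * (v / u) powr b"
    proof -
      have "t1 / u \<le> t1 * (v / u)" using vu t1 by (simp add: divide_right_mono)
      then have "(t1 / u) powr b \<le> (t1 * (v / u)) powr b" using vu t1 b by (intro powr_mono2) auto
      also have "(t1 * (v / u)) powr b = t1 powr b * (v / u) powr b"
        by (rule powr_mult)
      finally show ?thesis .
    qed
    consider "t0 < v" | "v \<le> t0" "u \<le> t1" | "v \<le> t0" "t1 < u" by linarith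
    then show "\<psi> u \<le> C1 * t1 powr b * (v / u) powr b * \<psi> v"
    proof cases
      case 1
      have "C1 * (v / u) powr b * \<psi> v * 1 \<le> C1 * (v / u) powr b * \<psi> v * t1 powr b"
        using tp C1 pv by (intro mult_left_mono) auto
      with far[OF 1 vu(2)] show ?thesis by (simp add: mult_ac)
    next
      case 2
      have "1 \<le> (t1 / u) powr b" using 2 vu b by (intro ge_one_powr_ge_zero) auto
      then have "1 * 1 \<le> C1 * (t1 powr b * (v / u) powr b)" using t1v C1 by (intro mult_mono) auto
      then have "1 * \<psi> v \<le> C1 * (t1 powr b * (v / u) powr b) * \<psi> v" using pv by (intro mult_right_mono) auto
      with anti[OF vu] show ?thesis by (simp add: mult_ac)
    next
      case 3
      have "\<psi> u \<le> C1 * (t1 / u) powr b * \<psi> t1" using far[of t1 u] 3 t1 by simp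
      also have "\<dots> \<le> C1 * (t1 powr b * (v / u) powr b) * \<psi> v"
        using t1v C1 anti[of v t1] 3 vu t1 pos[of t1] by (intro mult_mono) auto
      finally show ?thesis by (simp add: mult_ac)
    qed
  qed
qed


subsection \<open>Shells of frequencies\<close>

text \<open>The tangent line at \<open>y = 1\<close>, obtained from Young's inequality for
  \<open>y powr q\<close> and 1. Summed or integrated after a normalisation, it compares l1 with lq
  in \<open>l1_le_lq\<close> and L2 with Lp in \<open>Lp_norm_ge_L2\<close>.\<close>

lemma bernoulli_powr:
  fixes y q :: real
  assumes "0 \<le> y" "1 \<le> q"
  shows "1 + q * (y - 1) \<le> y powr q"
proof (cases "y = 0")
  case False
  then have "0 < y powr q" using assms by simp
  then have "(y powr q) powr (1 / q) * 1 powr (1 - 1 / q) \<le> 1 / q * (y powr q) + (1 - 1 / q) * 1"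
    using assms by (intro Youngs_inequality_0) auto
  then have "y \<le> y powr q / q + 1 - 1 / q"
    using assms by (simp add: powr_powr)
  then have "q * y \<le> q * (y powr q / q + 1 - 1 / q)"
    using assms by (intro mult_left_mono) auto
  then show ?thesis using assms by (simp add: algebra_simps)
qed (use assms in simp)

lemma powr_le_1D:
  fixes x :: real
  assumes "0 < q" "x powr q \<le> 1"
  shows "x \<le> 1"
proof (rule ccontr)
  assume "\<not> x \<le> 1"
  then have "1 powr q < x powr q" using assms(1) by (intro powr_less_mono2) auto
  with assms(2) show False by simp
qed

text \<open>For \<open>q \<le> 1\<close> every \<open>b k\<close> is at most 1, so
  \<open>b k \<le> b k powr q\<close>. For \<open>q > 1\<close> the tangent inequality is normalised
  at the extremal configuration, in which every \<open>b k\<close> equals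
  \<open>Z powr (- 1 / q)\<close>.\<close>

lemma l1_le_lq:
  fixes b :: "'a \<Rightarrow> real"
  assumes "finite Q" "\<And>k. k \<in> Q \<Longrightarrow> 0 \<le> b k" "0 < q" "(\<Sum>k\<in>Q. b k powr q) \<le> 1"
    and "real (card Q) \<le> Z" "1 \<le> Z"
  shows "(\<Sum>k\<in>Q. b k) \<le> Z powr max 0 (1 - 1 / q)"
proof (cases "q \<le> 1")
  case True
  have b1: "b k powr q \<le> 1" if "k \<in> Q" for k
    using member_le_sum[of k Q "\<lambda>k. b k powr q"] assms(1,4) that by simp
  have "b k \<le> b k powr q" if "k \<in> Q" for k
  proof (cases "b k = 0")
    case False
    then have pos: "0 < b k" using assms(2)[OF that] by simp
    have "b k \<le> 1" by (rule powr_le_1D[OF assms(3) b1[OF that]])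
    then have "b k powr 1 \<le> b k powr q"
      using pos True by (intro powr_mono') auto
    then show ?thesis using pos by simp
  qed (use assms(3) in simp)
  then have "(\<Sum>k\<in>Q. b k) \<le> 1" using sum_mono[of Q b "\<lambda>k. b k powr q"] assms(4) by simp
  then show ?thesis using True assms(3,6) by (simp add: max_def)
next
  case False
  define y where "y k = b k * Z powr (1 / q)" for k
  have Zq: "(Z powr (1 / q)) powr q = Z" using assms by (simp add: powr_powr)
  have "(\<Sum>k\<in>Q. 1 + q * (y k - 1)) \<le> (\<Sum>k\<in>Q. y k powr q)"
    using assms(2) False by (intro sum_mono bernoulli_powr) (auto simp: y_def)
  also have "\<dots> = (\<Sum>k\<in>Q. b k powr q) * Z"
    using assms(2,6) Zq by (simp add: y_def powr_mult sum_distrib_right)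
  also have "\<dots> \<le> 1 * Z" using assms(4,6) by (intro mult_right_mono) auto
  finally have "real (card Q) + q * (\<Sum>k\<in>Q. y k) - q * real (card Q) \<le> Z"
    by (simp add: sum.distrib sum_subtractf algebra_simps flip: sum_distrib_left)
  moreover have "(q - 1) * real (card Q) \<le> (q - 1) * Z"
    using False assms(5) by (intro mult_left_mono) auto
  ultimately have "q * (\<Sum>k\<in>Q. y k) \<le> q * Z" by (simp add: algebra_simps)
  then have "(\<Sum>k\<in>Q. b k) * Z powr (1 / q) \<le> Z" using False by (simp add: y_def flip: sum_distrib_right)
  also have "Z = Z powr (1 - 1 / q) * Z powr (1 / q)" using assms(6) by (simp flip: powr_add)
  finally have "(\<Sum>k\<in>Q. b k) \<le> Z powr (1 - 1 / q)" using assms(6) by simp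
  then show ?thesis using False assms(3) by (simp add: max_def)
qed

text \<open>Puts both ranges of \<open>q\<close> into one formula. For \<open>q \<le> 1\<close> at
  most \<open>\<mu>\<close> entries exceed \<open>\<mu> powr (- 1 / q)\<close>, and below this level
  the factor \<open>b k powr (1 - q)\<close> of \<open>b k\<close> gives the power of
  \<open>\<mu>\<close>. For \<open>q > 1\<close> nothing is removed, and the size of
  \<open>Q\<close> enters through \<open>Y\<close>.\<close>

lemma threshold_l1_le_lq:
  fixes b :: "'a \<Rightarrow> real"
  assumes "finite Q" "\<And>k. k \<in> Q \<Longrightarrow> 0 \<le> b k" "0 < q" "(\<Sum>k\<in>Q. b k powr q) \<le> 1"
    and "1 \<le> \<mu>" "real (card Q) \<le> Y * \<mu>" "1 \<le> Y"
  shows "\<exists>G\<subseteq>Q. real (card G) \<le> \<mu> \<and> (\<Sum>k\<in>Q - G. b k) \<le> \<mu> powr (1 - 1 / q) * Y powr max 0 (1 - 1 / q)"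
proof (cases "q \<le> 1")
  case True
  define G where "G = {k \<in> Q. \<mu> powr (- 1 / q) < b k}"
  have pw: "(\<mu> powr (- 1 / q)) powr q = 1 / \<mu>"
  proof -
    have "(\<mu> powr (- 1 / q)) powr q = \<mu> powr (- 1)" using assms(3) by (simp add: powr_powr)
    then show ?thesis using assms(5) by (simp add: powr_minus inverse_eq_divide)
  qed
  have fG: "finite G" "G \<subseteq> Q" using assms(1) by (auto simp: G_def)
  have "(\<Sum>k\<in>G. 1 / \<mu>) \<le> (\<Sum>k\<in>G. b k powr q)"
    using pw assms(3) by (intro sum_mono) (metis (mono_tags, lifting) G_def less_imp_le mem_Collect_eq powr_ge_zero powr_mono2)
  also have "\<dots> \<le> (\<Sum>k\<in>Q. b k powr q)" using fG assms(1) by (intro sum_mono2) auto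
  finally have "real (card G) / \<mu> \<le> 1" using assms(4) by simp
  then have cG: "real (card G) \<le> \<mu>" using assms(5) by (simp add: pos_divide_le_eq)
  have "b k \<le> b k powr q * \<mu> powr (1 - 1 / q)" if k: "k \<in> Q - G" for k
  proof (cases "b k = 0")
    case False
    then have pos: "0 < b k" using assms(2) k by force
    have "b k \<le> \<mu> powr (- 1 / q)" using k by (auto simp: G_def)
    then have "b k powr (1 - q) \<le> (\<mu> powr (- 1 / q)) powr (1 - q)" using pos True by (intro powr_mono2) auto
    also have "\<dots> = \<mu> powr (- 1 / q * (1 - q))" by (rule powr_powr)
    also have "- 1 / q * (1 - q) = 1 - 1 / q" using assms(3) by (simp add: field_simps)
    finally have "b k powr q * b k powr (1 - q) \<le> b k powr q * \<mu> powr (1 - 1 / q)" by (intro mult_left_mono) auto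
    then show ?thesis using pos by (simp flip: powr_add)
  qed (use assms(3) in simp)
  then have "(\<Sum>k\<in>Q - G. b k) \<le> (\<Sum>k\<in>Q - G. b k powr q) * \<mu> powr (1 - 1 / q)"
    unfolding sum_distrib_right by (rule sum_mono)
  also have "\<dots> \<le> 1 * \<mu> powr (1 - 1 / q)"
    using sum_mono2[of Q "Q - G" "\<lambda>k. b k powr q"] assms(1,4) by (intro mult_right_mono) auto
  finally have "(\<Sum>k\<in>Q - G. b k) \<le> \<mu> powr (1 - 1 / q)" by simp
  moreover have "max 0 (1 - 1 / q) = 0" using True assms(3) by (simp add: max_absorb1)
  then have "Y powr max 0 (1 - 1 / q) = 1" using assms(7) by simp
  ultimately have "(\<Sum>k\<in>Q - G. b k) \<le> \<mu> powr (1 - 1 / q) * Y powr max 0 (1 - 1 / q)"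
    by simp
  with cG fG show ?thesis by blast
next
  case False
  have "1 * 1 \<le> Y * \<mu>" using assms(5,7) by (intro mult_mono) auto
  then have "(\<Sum>k\<in>Q. b k) \<le> (Y * \<mu>) powr max 0 (1 - 1 / q)"
    using assms by (intro l1_le_lq) auto
  also have "\<dots> = \<mu> powr (1 - 1 / q) * Y powr max 0 (1 - 1 / q)"
    using False assms(3,5,7) by (simp add: max_def powr_mult mult.commute)
  finally show ?thesis using assms(5) by (intro exI[of _ "{}"]) auto
qed

section \<open>Weights on cubes and dyadic shells\<close>

lemma index_norm_ge:
  fixes k :: "int ^ 'd::finite"
  assumes "1 \<le> r"
  shows "\<bar>real_of_int (k $ i)\<bar> \<le> index_norm r k"
proof (cases "r = \<infinity>")
  case False
  define s where "s = enn2real r"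
  have s: "1 \<le> s"
    using assms False unfolding s_def by (cases r) (auto simp: top_ennreal.rep_eq)
  have "\<bar>real_of_int (k $ i)\<bar> powr s \<le> (\<Sum>j\<in>UNIV. \<bar>real_of_int (k $ j)\<bar> powr s)"
    by (rule member_le_sum) auto
  then have "(\<bar>real_of_int (k $ i)\<bar> powr s) powr (1 / s) \<le> (\<Sum>j\<in>UNIV. \<bar>real_of_int (k $ j)\<bar> powr s) powr (1 / s)"
    using s by (intro powr_mono2) auto
  then show ?thesis using False s by (simp add: index_norm_def s_def powr_powr)
qed (simp add: index_norm_def)

lemma cube_abs_le: "k \<in> cube N \<Longrightarrow> \<bar>real_of_int (k $ i)\<bar> \<le> real N"
  by (simp add: cube_def) (metis of_int_abs of_int_le_iff of_int_of_nat_eq)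

text \<open>The factor is the worst case, that of \<open>r = 1\<close>; for a finite exponent
  \<open>s\<close> the computation gives \<open>CARD('d) powr (1 / s)\<close>.\<close>

lemma index_norm_le:
  fixes k :: "int ^ 'd::finite"
  assumes "1 \<le> r" "k \<in> cube N"
  shows "index_norm r k \<le> real CARD('d) * real N"
proof (cases "r = \<infinity>")
  case True
  have "index_norm r k \<le> real N"
    unfolding index_norm_def if_P[OF True] using assms(2)
    by (intro Max.boundedI) (auto simp: cube_abs_le simp del: of_int_abs)
  also have "\<dots> \<le> real CARD('d) * real N" by (cases N) auto
  finally show ?thesis .
next
  case False
  define s where "s = enn2real r"
  have s: "1 \<le> s"
    using assms False unfolding s_def by (cases r) (auto simp: top_ennreal.rep_eq)
  have "(\<Sum>j\<in>UNIV. \<bar>real_of_int (k $ j)\<bar> powr s) \<le> (\<Sum>j\<in>(UNIV :: 'd set). real N powr s)"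
  proof (intro sum_mono powr_mono2)
    fix j show "\<bar>real_of_int (k $ j)\<bar> \<le> real N"
      using assms(2) by (rule cube_abs_le)
  qed (use s in auto)
  then have "(\<Sum>j\<in>UNIV. \<bar>real_of_int (k $ j)\<bar> powr s) powr (1 / s) \<le> (real CARD('d) * real N powr s) powr (1 / s)"
    using s by (intro powr_mono2) (auto intro: sum_nonneg)
  also have "\<dots> = real CARD('d) powr (1 / s) * real N"
    using s by (simp add: powr_mult powr_powr)
  also have "\<dots> \<le> real CARD('d) powr 1 * real N"
    using s by (intro mult_right_mono powr_mono) (auto simp: Suc_le_eq)
  finally show ?thesis using False by (simp add: index_norm_def s_def)
qed

lemma index_norm_ge_1:
  assumes "1 \<le> r" "k \<noteq> 0"
  shows "1 \<le> index_norm r k"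
proof -
  obtain i where "k $ i \<noteq> 0" using assms(2) by (auto simp: vec_eq_iff)
  then have "1 \<le> \<bar>real_of_int (k $ i)\<bar>" by linarith
  with index_norm_ge[OF assms(1), of k i] show ?thesis by linarith
qed

lemma Psi_pos:
  fixes k :: "int ^ 'd::finite"
  assumes "\<psi> \<in> class_B" "1 \<le> r"
  shows "0 < Psi \<psi> r k"
  using class_B_pos[OF assms(1)] index_norm_ge_1[OF assms(2), of k] by (simp add: Psi_def)

lemma Psi_outside_cube:
  assumes "\<psi> \<in> class_B" "1 \<le> r" "1 \<le> M" "k \<notin> cube M"
  shows "Psi \<psi> r k \<le> \<psi> (real M)"
proof -
  obtain i where i: "int M < \<bar>k $ i\<bar>" using assms(4) by (auto simp: cube_def not_le)
  then have "k \<noteq> 0" by auto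
  have "real M \<le> \<bar>real_of_int (k $ i)\<bar>" using i by linarith
  also have "\<dots> \<le> index_norm r k" by (rule index_norm_ge[OF assms(2)])
  finally show ?thesis
    using \<open>k \<noteq> 0\<close> assms(1,3) by (simp add: Psi_def class_B_antimono)
qed

definition shell :: "nat \<Rightarrow> nat \<Rightarrow> (int ^ 'd::finite) set" where
  "shell \<nu> s = cube (2 ^ (\<nu> + s + 1)) - cube (2 ^ (\<nu> + s))"

lemma finite_shell [simp]: "finite (shell \<nu> s)"
  by (simp add: shell_def)

text \<open>The 5 comes from \<open>2 * 2 ^ (\<nu> + s + 1) + 1 \<le> 5 * 2 ^ (\<nu> + s)\<close>.
  The power is written with \<open>powr\<close> so that it merges with the real exponents of the
  weights.\<close>

lemma card_shell_le:
  "real (card (shell \<nu> s :: (int ^ 'd::finite) set)) \<le> 5 ^ CARD('d) * 2 powr (real CARD('d) * real (\<nu> + s))"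
proof -
  have "card (shell \<nu> s :: (int ^ 'd) set) \<le> card (cube (2 ^ (\<nu> + s + 1)) :: (int ^ 'd) set)"
    by (intro card_mono) (auto simp: shell_def)
  also have "\<dots> \<le> (5 * 2 ^ (\<nu> + s)) ^ CARD('d)"
    unfolding card_cube by (intro power_mono) auto
  finally have "real (card (shell \<nu> s :: (int ^ 'd) set)) \<le> real ((5 * 2 ^ (\<nu> + s)) ^ CARD('d))"
    by (simp only: of_nat_le_iff)
  also have "\<dots> = 5 ^ CARD('d) * (2 powr real (\<nu> + s)) powr real CARD('d)"
    by (simp add: power_mult_distrib powr_realpow del: of_nat_add)
  finally show ?thesis by (simp add: powr_powr mult.commute)
qed

lemma cube_shell_decomp:
  "(\<Sum>k\<in>cube (2 ^ (\<nu> + T)). f k) = (\<Sum>k\<in>cube (2 ^ \<nu>). f k) + (\<Sum>s<T. \<Sum>k\<in>shell \<nu> s. f k)"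
proof (induction T)
  case (Suc T)
  have sub: "cube (2 ^ (\<nu> + T)) \<subseteq> (cube (2 ^ (\<nu> + Suc T)) :: (int ^ 'b) set)"
    by (intro cube_mono) simp
  have "(\<Sum>k\<in>cube (2 ^ (\<nu> + Suc T)). f k)
      = (\<Sum>k\<in>cube (2 ^ (\<nu> + Suc T)) - cube (2 ^ (\<nu> + T)). f k) + (\<Sum>k\<in>cube (2 ^ (\<nu> + T)). f k)"
    by (rule sum.subset_diff[OF sub]) simp
  then show ?case using Suc by (simp add: shell_def add_ac)
qed simp

text \<open>The budget of shell \<open>s\<close> will depend on \<open>s div w\<close> only, so the
  total budget is \<open>w\<close> times a geometric sum.\<close>

lemma sum_div_blocks: "0 < w \<Longrightarrow> (\<Sum>s<w * n. f (s div w)) = of_nat w * (\<Sum>j<n. f j :: 'a::comm_semiring_1)"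
proof (induction n)
  case (Suc n)
  have "(\<Sum>s<w * Suc n. f (s div w)) = (\<Sum>s<w * n. f (s div w)) + (\<Sum>s\<in>{w * n..<w * n + w}. f (s div w))"
    by (simp add: lessThan_atLeast0 sum.atLeastLessThan_concat add.commute)
  also have "(\<Sum>s\<in>{w * n..<w * n + w}. f (s div w)) = (\<Sum>s\<in>{w * n..<w * n + w}. f n)"
  proof (intro sum.cong refl)
    fix s assume "s \<in> {w * n..<w * n + w}"
    then have "s div w = n" using Suc.prems by (intro div_nat_eqI) (auto simp: algebra_simps)
    then show "f (s div w) = f n" by simp
  qed
  finally show ?case using Suc by (simp add: algebra_simps)
qed simp

text \<open>Exponents of 2 in the shell estimates, with \<open>D\<close> the dimension and
  \<open>m\<close> the level \<open>\<nu>\<close>. The decay \<open>s * b\<close> pays for the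
  growth \<open>D * s * \<rho>\<close> of the shell and leaves \<open>2 * \<delta> * s\<close>.
  Halving the budget once in \<open>w\<close> shells costs at most \<open>\<delta> * s\<close>. In
  the second claim the budget is exhausted; then \<open>D * m\<close> is at most
  \<open>s div w\<close>, so the loss \<open>D * m * (\<bar>e\<bar> + \<rho>)\<close> from taking no
  terms obeys the same bound.\<close>

lemma block_exponent_bounds:
  fixes b \<rho> e \<delta> :: real and w s D m :: nat
  assumes "0 < w" "0 \<le> \<rho>" "(\<bar>e\<bar> + \<rho>) / real w \<le> \<delta>" "real D * \<rho> + 2 * \<delta> = b"
  shows "s div w \<le> D * m \<Longrightarrow>
      - (real s * b) + real (D * m - s div w) * e + (real D * real s + real (s div w)) * \<rho>
        \<le> real D * real m * e - \<delta> * real s"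
    and "D * m < s div w \<Longrightarrow>
      - (real s * b) + real D * real (m + s) * \<rho> \<le> real D * real m * e - \<delta> * real s"
proof -
  define j where "j = real (s div w)"
  have "real (s div w) \<le> real s / real w" by (rule of_nat_div_le_of_nat)
  then have "j * (\<bar>e\<bar> + \<rho>) \<le> real s / real w * (\<bar>e\<bar> + \<rho>)"
    unfolding j_def using assms(2) by (intro mult_right_mono) auto
  also have "\<dots> = real s * ((\<bar>e\<bar> + \<rho>) / real w)" by simp
  also have "\<dots> \<le> real s * \<delta>" using assms(3) by (intro mult_left_mono) auto
  finally have js: "j * \<bar>e\<bar> + j * \<rho> \<le> real s * \<delta>" by (simp add: algebra_simps)
  have sb: "real s * b = real s * (real D * \<rho>) + 2 * (real s * \<delta>)"
    using assms(4) by (simp add: algebra_simps flip: assms(4))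
  have j0: "0 \<le> j" by (simp add: j_def)
  show "- (real s * b) + real (D * m - s div w) * e + (real D * real s + real (s div w)) * \<rho>
        \<le> real D * real m * e - \<delta> * real s" if "s div w \<le> D * m"
  proof -
    have tj: "real (D * m - s div w) = real D * real m - j" using that by (simp add: of_nat_diff j_def)
    have "- (j * e) \<le> j * \<bar>e\<bar>" using j0 by (simp add: abs_if mult_left_mono)
    then show ?thesis unfolding tj j_def[symmetric] using js sb by (simp add: algebra_simps)
  qed
  show "- (real s * b) + real D * real (m + s) * \<rho> \<le> real D * real m * e - \<delta> * real s" if "D * m < s div w"
  proof -
    have "real D * real m \<le> j" using that unfolding j_def by (metis less_imp_le of_nat_le_iff of_nat_mult)
    then have "real D * real m * (\<bar>e\<bar> + \<rho>) \<le> j * (\<bar>e\<bar> + \<rho>)" using assms(2) by (intro mult_right_mono) auto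
    moreover have "- (real D * real m * \<bar>e\<bar>) \<le> real D * real m * e"
    proof -
      have "real D * real m * (- \<bar>e\<bar>) \<le> real D * real m * e" by (intro mult_left_mono) auto
      then show ?thesis by simp
    qed
    ultimately show ?thesis using js sb by (simp add: algebra_simps)
  qed
qed

text \<open>Of the \<open>3 * 2 ^ t\<close> terms, \<open>2 ^ t\<close> remove the set
  \<open>G\<close> of large coefficients and twice as many approximate the rest. \<open>Y\<close> is
  the bound on the shell size divided by \<open>2 ^ t\<close>; it serves both as the ratio in
  \<open>threshold_l1_le_lq\<close> and as the argument of the logarithm. The exponent
  \<open>1 / 2 - 1 / q\<close> is \<open>1 - 1 / q\<close> from the l1 sum less 1/2 from the root of
  the budget.\<close>

lemma sparse_block:
  fixes a :: "int ^ 'd::finite \<Rightarrow> complex" and Cs :: real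
  assumes Cs: "sparse_constant TYPE('d) Cs"
    and q: "0 < q" and V: "0 \<le> V" and b: "\<And>k. k \<in> shell \<nu> s \<Longrightarrow> 0 \<le> b k"
    and ab: "\<And>k. k \<in> shell \<nu> s \<Longrightarrow> norm (a k) \<le> V * b k" "(\<Sum>k\<in>shell \<nu> s. b k powr q) \<le> 1"
    and j: "j \<le> CARD('d) * \<nu>"
  defines "Y \<equiv> 5 ^ CARD('d) * 2 powr (real CARD('d) * real s + real j)" and "t \<equiv> CARD('d) * \<nu> - j"
  shows "\<exists>h. trig_sparse (3 * 2 ^ t) h \<and>
    (\<forall>x. norm (trig_sum (shell \<nu> s) a x - h x)
       \<le> Cs * V * 2 powr (real t * (1 / 2 - 1 / q)) * Y powr max 0 (1 - 1 / q) * (1 + ln Y))"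
proof -
  have Y1: "1 \<le> Y"
  proof -
    have "1 * 1 \<le> Y" unfolding Y_def by (intro mult_mono ge_one_powr_ge_zero one_le_power) auto
    then show ?thesis by simp
  qed
  have t: "(2::real) ^ t = 2 powr (real CARD('d) * real \<nu> - real j)"
    using j by (simp add: t_def powr_realpow[symmetric] of_nat_diff)
  have Yt: "5 ^ CARD('d) * 2 powr (real CARD('d) * real (\<nu> + s)) = Y * 2 ^ t"
    unfolding Y_def t by (simp add: algebra_simps flip: powr_add)
  have "\<exists>G\<subseteq>shell \<nu> s. real (card G) \<le> 2 ^ t \<and>
    (\<Sum>k\<in>shell \<nu> s - G. b k) \<le> (2 ^ t) powr (1 - 1 / q) * Y powr max 0 (1 - 1 / q)"
    using q b ab(2) Y1 card_shell_le[of \<nu> s, where 'd = 'd] unfolding Yt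
    by (intro threshold_l1_le_lq) auto
  then obtain G where G: "G \<subseteq> shell \<nu> s" "real (card G) \<le> 2 ^ t"
    "(\<Sum>k\<in>shell \<nu> s - G. b k) \<le> (2 ^ t) powr (1 - 1 / q) * Y powr max 0 (1 - 1 / q)" by blast
  have cG: "card G \<le> 2 ^ t" using G(2) by (metis of_nat_le_iff of_nat_numeral of_nat_power)
  have fG: "finite G" using G(1) finite_shell finite_subset by blast
  define N :: nat where "N = 2 ^ (\<nu> + s + 1)"
  define a' where "a' k = (if k \<in> shell \<nu> s - G then a k else 0)" for k
  have shN: "shell \<nu> s - G \<subseteq> cube N" by (auto simp: shell_def N_def)
  have "real N ^ CARD('d) = 2 ^ CARD('d) * (2 powr real (\<nu> + s)) powr real CARD('d)"
    by (simp add: N_def power_mult_distrib powr_realpow del: of_nat_add)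
  also have "\<dots> \<le> 5 ^ CARD('d) * (2 powr real (\<nu> + s)) powr real CARD('d)"
    by (intro mult_right_mono power_mono) auto
  also have "\<dots> = Y * 2 ^ t" unfolding Yt[symmetric] by (simp add: powr_powr mult.commute)
  finally have NX: "real N ^ CARD('d) \<le> Y * 2 ^ t" .
  have "1 \<le> N" by (simp add: N_def)
  then obtain g where g: "trig_sparse (2 ^ Suc t) g"
    "\<And>x. norm (trig_sum (cube N) a' x - g x)
          \<le> Cs * (\<Sum>k\<in>cube N. norm (a' k)) * (1 + ln Y) / sqrt (2 ^ t)"
    using Cs Y1 NX unfolding sparse_constant_def by blast
  have a'sum: "trig_sum (cube N) a' x = trig_sum (shell \<nu> s - G) a x" for x
    using shN by (intro sum.mono_neutral_cong_right) (auto simp: a'_def)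
  have "(\<Sum>k\<in>cube N. norm (a' k)) = (\<Sum>k\<in>shell \<nu> s - G. norm (a k))"
    using shN by (intro sum.mono_neutral_cong_right) (auto simp: a'_def)
  also have "\<dots> \<le> (\<Sum>k\<in>shell \<nu> s - G. V * b k)" using ab(1) by (intro sum_mono) auto
  also have "\<dots> \<le> V * ((2 ^ t) powr (1 - 1 / q) * Y powr max 0 (1 - 1 / q))"
    unfolding sum_distrib_left[symmetric] using V G(3) by (intro mult_left_mono) auto
  finally have a'1: "(\<Sum>k\<in>cube N. norm (a' k)) \<le> V * ((2 ^ t) powr (1 - 1 / q) * Y powr max 0 (1 - 1 / q))" .
  define h where "h x = trig_sum G a x + g x" for x
  have "trig_sparse (2 ^ t + 2 ^ Suc t) h"
    unfolding h_def by (intro trig_sparse_add trig_sparse_sum fG cG g(1))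
  then have h1: "trig_sparse (3 * 2 ^ t) h" by simp
  have pw: "(2 ^ t) powr (1 - 1 / q) / sqrt (2 ^ t) = 2 powr (real t * (1 / 2 - 1 / q))"
  proof -
    have "sqrt (2 ^ t) = 2 powr (real t * (1 / 2))"
      by (simp add: powr_half_sqrt[symmetric] powr_realpow[symmetric] powr_powr)
    moreover have "((2::real) ^ t) powr (1 - 1 / q) = 2 powr (real t * (1 - 1 / q))"
      by (simp only: powr_realpow[symmetric] powr_powr zero_less_numeral)
    ultimately show ?thesis by (simp add: algebra_simps flip: powr_diff)
  qed
  have "norm (trig_sum (shell \<nu> s) a x - h x)
       \<le> Cs * V * 2 powr (real t * (1 / 2 - 1 / q)) * Y powr max 0 (1 - 1 / q) * (1 + ln Y)" for x
  proof -
    have "trig_sum (shell \<nu> s) a x = trig_sum (shell \<nu> s - G) a x + trig_sum G a x"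
      by (rule sum.subset_diff[OF G(1)]) simp
    then have "trig_sum (shell \<nu> s) a x - h x = trig_sum (cube N) a' x - g x"
      unfolding a'sum h_def by simp
    then have "norm (trig_sum (shell \<nu> s) a x - h x)
        \<le> Cs * (\<Sum>k\<in>cube N. norm (a' k)) * (1 + ln Y) / sqrt (2 ^ t)" using g(2)[of x] by simp
    also have "\<dots> \<le> Cs * (V * ((2 ^ t) powr (1 - 1 / q) * Y powr max 0 (1 - 1 / q))) * (1 + ln Y) / sqrt (2 ^ t)"
      using a'1 Cs[unfolded sparse_constant_def] Y1 by (intro divide_right_mono mult_right_mono mult_left_mono) auto
    also have "\<dots> = Cs * V * ((2 ^ t) powr (1 - 1 / q) / sqrt (2 ^ t)) * Y powr max 0 (1 - 1 / q) * (1 + ln Y)"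
      by (simp only: times_divide_eq_right times_divide_eq_left mult_ac)
    finally show ?thesis unfolding pw .
  qed
  with h1 show ?thesis by blast
qed

lemma trig_sparse_sum_family:
  fixes S :: nat
  shows "(\<And>s. s < S \<Longrightarrow> trig_sparse (m s) (h s)) \<Longrightarrow> trig_sparse (\<Sum>s<S. m s) (\<lambda>x. \<Sum>s<S. h s x)"
  by (induction S) (simp_all add: trig_sparse_zero trig_sparse_add)

lemma sum_power_two_rev: "(\<Sum>j<Suc n. 2 ^ (n - j)) \<le> (2 * 2 ^ n :: nat)"
proof (induction n)
  case (Suc n)
  have "(\<Sum>j<Suc (Suc n). 2 ^ (Suc n - j)) = 2 ^ Suc n + (\<Sum>j<Suc n. (2::nat) ^ (n - j))"
    by (subst sum.lessThan_Suc_shift) simp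
  with Suc show ?case by simp
qed simp

lemma finite_subset_cube:
  fixes F :: "(int ^ 'd::finite) set"
  assumes F: "finite F"
  shows "\<exists>T0. \<forall>T\<ge>T0. F \<subseteq> cube (2 ^ T)"
proof -
  define M where "M = (\<Sum>k\<in>F. \<Sum>i\<in>UNIV. nat \<bar>k $ i\<bar>)"
  have "\<bar>k $ i\<bar> \<le> int (2 ^ T)" if "k \<in> F" "M \<le> T" for k i T
  proof -
    have "nat \<bar>k $ i\<bar> \<le> (\<Sum>i\<in>UNIV. nat \<bar>k $ i\<bar>)" by (rule member_le_sum) auto
    also have "\<dots> \<le> M" unfolding M_def using F that(1) by (intro member_le_sum) auto
    also have "M \<le> 2 ^ T" using that(2) less_exp[of T] by linarith
    finally show ?thesis by linarith
  qed
  then show ?thesis by (auto simp: cube_def)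
qed

section \<open>Approximation of all sequences in the weighted lq ball\<close>

text \<open>\<open>\<rho>\<close> is the growth exponent of l1 sums relative to the number of
  frequencies and \<open>e\<close> the exponent of the number of terms in the result. Both are
  parameters tied to \<open>q\<close> by equations, which keeps long exponents opaque;
  \<open>dim\<close> ties the locale to one dimension.\<close>

locale weight_decay =
  fixes \<psi> :: "real \<Rightarrow> real" and r :: ennreal and q b C \<rho> e :: real and dim :: "'d::finite itself"
  assumes B: "\<psi> \<in> class_B" and r: "1 \<le> r" and q: "0 < q" and C: "1 \<le> C"
    and decay: "\<And>v u. 1 \<le> v \<Longrightarrow> v \<le> u \<Longrightarrow> \<psi> u \<le> C * (v / u) powr b * \<psi> v"
    and rho_def: "\<rho> = max 0 (1 - 1 / q)" and e_def: "e = 1 / 2 - 1 / q"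
    and b: "real CARD('d) * \<rho> < b"
begin

text \<open>Finite sums are the form in which the estimates use the unit ball;
  \<open>ell_norm_le_1_iff\<close> makes the connection with \<open>ell_norm\<close>.\<close>

definition unit_coeffs :: "(int ^ 'd \<Rightarrow> complex) \<Rightarrow> bool" where
  "unit_coeffs a \<longleftrightarrow> (\<forall>F. finite F \<longrightarrow> (\<Sum>k\<in>F. (norm (a k) / Psi \<psi> r k) powr q) \<le> 1)"

text \<open>Half of the slack in the exponents: one half pays for the shrinking budgets, the other
  remains as geometric decay with ratio \<open>z\<close>.\<close>

definition \<delta> :: real where "\<delta> = (b - real CARD('d) * \<rho>) / 2"

definition z :: real where "z = 2 powr (- \<delta>)"

lemma rho_nonneg: "0 \<le> \<rho>" by (simp add: rho_def)

lemma delta_pos: "0 < \<delta>" using b by (simp add: \<delta>_def)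

lemma z_bounds: "0 < z" "z < 1"
  unfolding z_def using delta_pos by (simp_all add: powr_less_one)

lemma z_power: "2 powr (- (\<delta> * real s)) = z ^ s"
  using z_bounds by (simp add: z_def powr_realpow[symmetric] powr_powr mult.commute)

text \<open>The weight \<open>Suc s\<close> stands for the logarithm \<open>1 + ln Y\<close> of
  shell \<open>s\<close>, which is linear in \<open>s\<close>.\<close>

definition H :: real where "H = (\<Sum>s. real (Suc s) * z ^ s)"

lemma sum_le_H: "(\<Sum>s<T. real (Suc s) * z ^ s) \<le> H"
proof -
  have "summable (\<lambda>s. real (Suc s) * z ^ s)"
    using geometric_deriv_sums[of z] z_bounds by (auto simp: sums_iff)
  then show ?thesis
    unfolding H_def using z_bounds by (intro sum_le_suminf) auto
qed

lemma H_nonneg: "0 \<le> H" using sum_le_H[of 0] by simp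

lemma psi_pos: "0 < \<psi> (2 ^ \<nu>)"
  by (rule class_B_pos[OF B]) simp

lemma shell_weight:
  assumes "k \<in> shell \<nu> s"
  shows "Psi \<psi> r k \<le> C * 2 powr (- (real s * b)) * \<psi> (2 ^ \<nu>)"
proof -
  have "Psi \<psi> r k \<le> \<psi> (real (2 ^ (\<nu> + s)))"
    using assms by (intro Psi_outside_cube[OF B r]) (auto simp: shell_def)
  also have "\<dots> \<le> C * (2 ^ \<nu> / 2 ^ (\<nu> + s)) powr b * \<psi> (2 ^ \<nu>)"
    unfolding of_nat_power of_nat_numeral by (intro decay power_increasing) auto
  also have "(2 ^ \<nu> / 2 ^ (\<nu> + s)) powr b = (2 powr (- real s)) powr b"
    by (simp add: power_add powr_minus powr_realpow inverse_eq_divide)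
  also have "\<dots> = 2 powr (- (real s * b))" by (simp add: powr_powr)
  finally show ?thesis .
qed

lemma shell_coeff:
  fixes a :: "int ^ 'd \<Rightarrow> complex"
  assumes "k \<in> shell \<nu> s"
  shows "norm (a k) \<le> C * 2 powr (- (real s * b)) * \<psi> (2 ^ \<nu>) * (norm (a k) / Psi \<psi> r k)"
proof -
  have "norm (a k) = Psi \<psi> r k * (norm (a k) / Psi \<psi> r k)" using Psi_pos[OF B r, of k] by simp
  also have "\<dots> \<le> C * 2 powr (- (real s * b)) * \<psi> (2 ^ \<nu>) * (norm (a k) / Psi \<psi> r k)"
    using Psi_pos[OF B r, of k] by (intro mult_right_mono shell_weight assms) auto
  finally show ?thesis .
qed

lemma shell_l1:
  assumes "unit_coeffs a"
  shows "(\<Sum>k\<in>shell \<nu> s. norm (a k)) \<le> C * 5 powr (real CARD('d) * \<rho>) * \<psi> (2 ^ \<nu>) *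
    2 powr (- (real s * b) + real CARD('d) * real (\<nu> + s) * \<rho>)"
proof -
  define V where "V = C * 2 powr (- (real s * b)) * \<psi> (2 ^ \<nu>)"
  define Z where "Z = 5 ^ CARD('d) * 2 powr (real CARD('d) * real (\<nu> + s))"
  have V: "0 \<le> V" using C psi_pos[of \<nu>] by (simp add: V_def)
  have Z1: "1 \<le> Z"
  proof -
    have "1 * 1 \<le> Z" unfolding Z_def by (intro mult_mono ge_one_powr_ge_zero one_le_power) auto
    then show ?thesis by simp
  qed
  have "(\<Sum>k\<in>shell \<nu> s. norm (a k) / Psi \<psi> r k) \<le> Z powr \<rho>"
    unfolding rho_def using q assms Z1 card_shell_le[of \<nu> s, where 'd = 'd] Psi_pos[OF B r, where 'd = 'd]
    by (intro l1_le_lq) (auto simp: unit_coeffs_def Z_def less_imp_le)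
  then have "V * (\<Sum>k\<in>shell \<nu> s. norm (a k) / Psi \<psi> r k) \<le> V * Z powr \<rho>"
    using V by (rule mult_left_mono)
  moreover have "(\<Sum>k\<in>shell \<nu> s. norm (a k)) \<le> V * (\<Sum>k\<in>shell \<nu> s. norm (a k) / Psi \<psi> r k)"
    unfolding V_def sum_distrib_left by (intro sum_mono shell_coeff)
  ultimately have "(\<Sum>k\<in>shell \<nu> s. norm (a k)) \<le> V * Z powr \<rho>" by linarith
  also have "Z powr \<rho> = 5 powr (real CARD('d) * \<rho>) * 2 powr (real CARD('d) * real (\<nu> + s) * \<rho>)"
    unfolding Z_def by (simp add: powr_mult powr_powr powr_realpow[symmetric])
  finally show ?thesis unfolding V_def powr_add by (simp only: mult_ac)
qed

text \<open>By the slack \<open>2 * \<delta>\<close> the l1 sums of the shells decay like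
  \<open>z ^ s * z ^ s\<close>; one factor is given away so that \<open>H\<close> can be reused. The
  bound makes the Fourier series of class members absolutely convergent and settles the finitely
  many small \<open>m\<close>.\<close>

lemma l1_bounded: "\<exists>K. \<forall>a F. unit_coeffs a \<longrightarrow> finite F \<longrightarrow> (\<Sum>k\<in>F. norm (a k)) \<le> K"
proof -
  define K1 where "K1 = C * 5 powr (real CARD('d) * \<rho>) * \<psi> 1"
  have K1: "0 \<le> K1" using C psi_pos[of 0] by (simp add: K1_def)
  have "(\<Sum>k\<in>F. norm (a k)) \<le> 3 ^ CARD('d) * \<psi> 1 + K1 * H" if a: "unit_coeffs a" and F: "finite F" for a F
  proof -
    obtain M where "F \<subseteq> cube (2 ^ (0 + M))" using finite_subset_cube[OF F] by auto
    then have "(\<Sum>k\<in>F. norm (a k)) \<le> (\<Sum>k\<in>cube (2 ^ (0 + M)). norm (a k))"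
      by (intro sum_mono2) auto
    also have "\<dots> = (\<Sum>k\<in>cube (2 ^ 0). norm (a k)) + (\<Sum>s<M. \<Sum>k\<in>shell 0 s. norm (a k))"
      by (rule cube_shell_decomp)
    also have "\<dots> \<le> (\<Sum>k\<in>(cube (2 ^ 0) :: (int ^ 'd) set). \<psi> 1) + (\<Sum>s<M. K1 * (real (Suc s) * z ^ s))"
    proof (intro add_mono sum_mono)
      fix k :: "int ^ 'd"
      have P: "0 < Psi \<psi> r k" by (rule Psi_pos[OF B r])
      have "(norm (a k) / Psi \<psi> r k) powr q \<le> 1"
        using a[unfolded unit_coeffs_def, rule_format, of "{k}"] by simp
      then have "norm (a k) / Psi \<psi> r k \<le> 1"
        by (rule powr_le_1D[OF q])
      then have "norm (a k) \<le> Psi \<psi> r k" using P by simp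
      also have "\<dots> \<le> \<psi> 1"
        using index_norm_ge_1[OF r, of k] class_B_antimono[OF B] by (simp add: Psi_def)
      finally show "norm (a k) \<le> \<psi> 1" .
    next
      fix s
      have "(\<Sum>k\<in>shell 0 s. norm (a k)) \<le> K1 * 2 powr (- (real s * b) + real CARD('d) * real s * \<rho>)"
        using shell_l1[OF a, of 0 s] by (simp add: K1_def)
      also have "2 powr (- (real s * b) + real CARD('d) * real s * \<rho>) = z ^ s * z ^ s"
      proof -
        have "- (real s * b) + real CARD('d) * real s * \<rho> = - (\<delta> * real s) + - (\<delta> * real s)"
          by (simp add: \<delta>_def field_simps)
        then show ?thesis unfolding z_power[symmetric] powr_add[symmetric] by simp
      qed
      also have "\<dots> \<le> real (Suc s) * z ^ s"
        using z_bounds by (intro mult_right_mono order_trans[OF power_le_one]) auto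
      finally show "(\<Sum>k\<in>shell 0 s. norm (a k)) \<le> K1 * (real (Suc s) * z ^ s)"
        using K1 by (simp add: mult_left_mono)
    qed
    also have "\<dots> \<le> 3 ^ CARD('d) * \<psi> 1 + K1 * H"
      using K1 sum_le_H[of M] by (simp add: card_cube mult_left_mono flip: sum_distrib_left)
    finally show ?thesis .
  qed
  then show ?thesis by blast
qed

text \<open>\<open>g\<close> is chosen before \<open>T\<close>, and the error bound holds for all
  large partial sums, so it survives the limit in \<open>T\<close>. It consists of the whole cube of
  radius \<open>2 ^ \<nu>\<close> and of sparse approximants on the shells below \<open>S\<close>;
  on later shells the l1 sums are already small enough.\<close>

theorem sparse_upper_bound:
  "\<exists>C0 C1. 0 < C0 \<and> 0 < C1 \<and> (\<forall>\<nu> a. unit_coeffs a \<longrightarrow>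
    (\<exists>g S. trig_sparse (C0 * 2 ^ (CARD('d) * \<nu>)) g \<and>
      (\<forall>T\<ge>S. \<forall>x. norm (trig_sum (cube (2 ^ (\<nu> + T))) a x - g x)
         \<le> C1 * (\<psi> (2 ^ \<nu>) * 2 powr (real CARD('d) * real \<nu> * e)))))"
proof -
  let ?D = "CARD('d)"
  obtain Cs where Cs: "sparse_constant TYPE('d) Cs" using sparse_approximation by blast
  then have Cs0: "0 < Cs" by (simp add: sparse_constant_def)
  \<comment> \<open>Budgets shrink more slowly for larger \<open>w\<close>; the loss per shell,
    \<open>(\<bar>e\<bar> + \<rho>) / w\<close>, must not exceed \<open>\<delta>\<close>.\<close>
  obtain w :: nat where w0: "(\<bar>e\<bar> + \<rho>) / \<delta> < real w" using reals_Archimedean2 by blast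
  have "0 \<le> (\<bar>e\<bar> + \<rho>) / \<delta>" using rho_nonneg delta_pos by simp
  then have w: "0 < w" using w0 by (metis le_less_trans of_nat_0_less_iff)
  have wd: "(\<bar>e\<bar> + \<rho>) / real w \<le> \<delta>"
    using w0 w delta_pos by (simp add: field_simps)
  have bd: "real ?D * \<rho> + 2 * \<delta> = b" by (simp add: \<delta>_def field_simps)
  note expo = block_exponent_bounds[OF w rho_nonneg wd bd]
  \<comment> \<open>\<open>Cs + 1\<close> dominates both \<open>Cs\<close>, for the approximated
    shells, and 1, for the discarded ones. The last factor bounds the growth of the logarithm per
    shell.\<close>
  define K where "K = (Cs + 1) * C * 5 powr (real ?D * \<rho>) * (2 * real ?D + 1)"
  have K: "0 < K" using Cs0 C by (simp add: K_def)
  \<comment> \<open>The first summand counts the inner cube; the second is \<open>w\<close> blocks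
    times 3 times the factor 2 of the geometric sum.\<close>
  define C0 where "C0 = 3 ^ ?D + 6 * w"
  have "\<exists>g S. trig_sparse (C0 * 2 ^ (?D * \<nu>)) g \<and>
      (\<forall>T\<ge>S. \<forall>x. norm (trig_sum (cube (2 ^ (\<nu> + T))) a x - g x)
         \<le> K * (H + 1) * (\<psi> (2 ^ \<nu>) * 2 powr (real ?D * real \<nu> * e)))" if a: "unit_coeffs a" for \<nu> a
  proof -
    define M where "M = \<psi> (2 ^ \<nu>) * 2 powr (real ?D * real \<nu> * e)"
    have M: "0 < M" using psi_pos by (simp add: M_def)
    \<comment> \<open>The first shell with \<open>s div w > ?D * \<nu>\<close>, where the budget
      \<open>2 ^ (?D * \<nu> - s div w)\<close> would have to fall below 1.\<close>
    define S where "S = w * Suc (?D * \<nu>)"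
    have shift: "2 powr (real ?D * real \<nu> * e - \<delta> * real s) = 2 powr (real ?D * real \<nu> * e) * z ^ s" for s
      unfolding z_power[symmetric] by (simp flip: powr_add)
    have near: "\<exists>h. trig_sparse (3 * 2 ^ (?D * \<nu> - s div w)) h \<and>
        (\<forall>x. norm (trig_sum (shell \<nu> s) a x - h x) \<le> K * M * (real (Suc s) * z ^ s))"
      if s: "s < S" for s
    proof -
      define j where "j = s div w"
      have "s div w < Suc (?D * \<nu>)"
        using s unfolding S_def by (simp add: less_mult_imp_div_less mult.commute)
      then have j: "j \<le> ?D * \<nu>" by (simp add: j_def)
      define V where "V = C * 2 powr (- (real s * b)) * \<psi> (2 ^ \<nu>)"
      have V: "0 \<le> V" using C psi_pos[of \<nu>] by (simp add: V_def)
      define Y where "Y = 5 ^ ?D * 2 powr (real ?D * real s + real j)"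
      define t where "t = ?D * \<nu> - j"
      have Pn: "0 \<le> norm (a k) / Psi \<psi> r k" for k
        using Psi_pos[OF B r, of k] by (simp add: less_imp_le)
      have u1: "(\<Sum>k\<in>shell \<nu> s. (norm (a k) / Psi \<psi> r k) powr q) \<le> 1"
        using a by (simp add: unit_coeffs_def)
      obtain h where h: "trig_sparse (3 * 2 ^ t) h"
        "\<And>x. norm (trig_sum (shell \<nu> s) a x - h x)
          \<le> Cs * V * 2 powr (real t * e) * Y powr \<rho> * (1 + ln Y)"
        using sparse_block[where b = "\<lambda>k. norm (a k) / Psi \<psi> r k", OF Cs q V Pn shell_coeff[of _ \<nu> s a, folded V_def] u1 j]
        unfolding t_def Y_def e_def rho_def by blast
      have js: "j \<le> s" by (simp add: j_def)
      have "ln Y = real ?D * ln 5 + (real ?D * real s + real j) * ln 2"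
        unfolding Y_def by (simp add: ln_mult ln_realpow ln_powr)
      also have "\<dots> \<le> real ?D * 2 + (real ?D * real s + real s) * 1"
      proof (intro add_mono mult_mono)
        have "(5::real) \<le> exp 2" using exp_lower_Taylor_quadratic[of 2] by simp
        then show "ln 5 \<le> (2::real)" by (metis exp_gt_zero exp_total ln_exp ln_mono zero_less_numeral)
        show "ln 2 \<le> (1::real)" using ln_2_less_1 by simp
      qed (use js in auto)
      also have "\<dots> \<le> (2 * real ?D + 1) * real (Suc s) - 1"
        by (simp add: algebra_simps)
      finally have lnY: "1 + ln Y \<le> (2 * real ?D + 1) * real (Suc s)" by simp
      have Yr: "Y powr \<rho> = 5 powr (real ?D * \<rho>) * 2 powr ((real ?D * real s + real j) * \<rho>)"
        unfolding Y_def by (simp add: powr_mult powr_powr powr_realpow[symmetric])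
      have "Cs * V * 2 powr (real t * e) * Y powr \<rho>
          = Cs * C * 5 powr (real ?D * \<rho>) * \<psi> (2 ^ \<nu>) *
            2 powr (- (real s * b) + real t * e + (real ?D * real s + real j) * \<rho>)"
        unfolding V_def Yr powr_add by (simp only: mult_ac)
      also have "\<dots> \<le> Cs * C * 5 powr (real ?D * \<rho>) * \<psi> (2 ^ \<nu>) * 2 powr (real ?D * real \<nu> * e - \<delta> * real s)"
        using expo(1)[of s \<nu>] j Cs0 C psi_pos[of \<nu>] unfolding t_def j_def
        by (intro mult_left_mono) auto
      also have "\<dots> = Cs * C * 5 powr (real ?D * \<rho>) * M * z ^ s"
        unfolding shift M_def by (simp only: mult_ac)
      also have "\<dots> \<le> (Cs + 1) * C * 5 powr (real ?D * \<rho>) * M * z ^ s"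
        using Cs0 C M z_bounds by (intro mult_right_mono) auto
      finally have "Cs * V * 2 powr (real t * e) * Y powr \<rho> * (1 + ln Y)
          \<le> ((Cs + 1) * C * 5 powr (real ?D * \<rho>) * M * z ^ s) * ((2 * real ?D + 1) * real (Suc s))"
      proof (rule mult_mono[OF _ lnY])
        have "1 * 1 \<le> Y" unfolding Y_def by (intro mult_mono ge_one_powr_ge_zero one_le_power) auto
        then show "0 \<le> 1 + ln Y" by simp
      qed (use Cs0 C M z_bounds in auto)
      also have "\<dots> = K * M * (real (Suc s) * z ^ s)" by (simp only: K_def mult_ac)
      finally show ?thesis using h unfolding t_def j_def by (meson order_trans)
    qed
    have far: "(\<Sum>k\<in>shell \<nu> s. norm (a k)) \<le> K * M * (real (Suc s) * z ^ s)" if s: "S \<le> s" for s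
    proof -
      have "Suc (?D * \<nu>) = S div w" using w by (simp add: S_def)
      also have "\<dots> \<le> s div w" using s by (rule div_le_mono)
      finally have sw: "?D * \<nu> < s div w" by simp
      have "(\<Sum>k\<in>shell \<nu> s. norm (a k)) \<le> C * 5 powr (real ?D * \<rho>) * \<psi> (2 ^ \<nu>) *
          2 powr (- (real s * b) + real ?D * real (\<nu> + s) * \<rho>)" by (rule shell_l1[OF a])
      also have "\<dots> \<le> C * 5 powr (real ?D * \<rho>) * \<psi> (2 ^ \<nu>) * 2 powr (real ?D * real \<nu> * e - \<delta> * real s)"
        using expo(2)[OF sw] C psi_pos[of \<nu>] by (intro mult_left_mono) auto
      also have "\<dots> = 1 * (C * 5 powr (real ?D * \<rho>)) * 1 * (M * (1 * z ^ s))"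
        unfolding shift M_def by (simp only: mult_ac mult_1)
      also have "\<dots> \<le> (Cs + 1) * (C * 5 powr (real ?D * \<rho>)) * (2 * real ?D + 1) * (M * (real (Suc s) * z ^ s))"
        using Cs0 C M z_bounds by (intro mult_mono) auto
      finally show ?thesis by (simp only: K_def mult_ac)
    qed
    have "\<forall>s. \<exists>h. s < S \<longrightarrow> trig_sparse (3 * 2 ^ (?D * \<nu> - s div w)) h \<and>
        (\<forall>x. norm (trig_sum (shell \<nu> s) a x - h x) \<le> K * M * (real (Suc s) * z ^ s))"
      using near by blast
    from choice[OF this] obtain h where h: "\<And>s. s < S \<Longrightarrow> trig_sparse (3 * 2 ^ (?D * \<nu> - s div w)) (h s)"
      "\<And>s x. s < S \<Longrightarrow> norm (trig_sum (shell \<nu> s) a x - h s x) \<le> K * M * (real (Suc s) * z ^ s)"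
      by blast
    define g where "g x = trig_sum (cube (2 ^ \<nu>)) a x + (\<Sum>s<S. h s x)" for x
    have "card (cube (2 ^ \<nu>) :: (int ^ 'd) set) \<le> (3 * 2 ^ \<nu>) ^ ?D"
      unfolding card_cube by (intro power_mono) auto
    then have "trig_sparse ((3 * 2 ^ \<nu>) ^ ?D + (\<Sum>s<S. 3 * 2 ^ (?D * \<nu> - s div w))) g"
      unfolding g_def using h(1)
      by (intro trig_sparse_add trig_sparse_sum trig_sparse_sum_family) auto
    moreover have "(3 * 2 ^ \<nu>) ^ ?D + (\<Sum>s<S. 3 * 2 ^ (?D * \<nu> - s div w)) \<le> C0 * 2 ^ (?D * \<nu>)"
    proof -
      have "(\<Sum>s<S. 3 * 2 ^ (?D * \<nu> - s div w)) = w * (\<Sum>j<Suc (?D * \<nu>). 3 * 2 ^ (?D * \<nu> - j))"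
        unfolding S_def using sum_div_blocks[OF w, of "\<lambda>j. 3 * 2 ^ (?D * \<nu> - j) :: nat" "Suc (?D * \<nu>)"]
        by (simp only: of_nat_id)
      also have "\<dots> \<le> w * (3 * (2 * 2 ^ (?D * \<nu>)))"
        unfolding sum_distrib_left[symmetric] by (intro mult_left_mono sum_power_two_rev) auto
      finally show ?thesis
        by (simp add: C0_def power_mult_distrib algebra_simps flip: power_mult)
    qed
    ultimately have sp: "trig_sparse (C0 * 2 ^ (?D * \<nu>)) g" by (rule trig_sparse_mono)
    have "norm (trig_sum (cube (2 ^ (\<nu> + T))) a x - g x) \<le> K * (H + 1) * M" if T: "S \<le> T" for T x
    proof -
      define f where "f s = trig_sum (shell \<nu> s) a x" for s
      define h' where "h' s = (if s < S then h s x else 0)" for s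
      have "(\<Sum>s<S. h s x) = (\<Sum>s<T. h' s)"
        unfolding h'_def using T by (intro sum.mono_neutral_cong_left) auto
      then have "(trig_sum (cube (2 ^ (\<nu> + T))) a x) - g x = (\<Sum>s<T. f s - h' s)"
        unfolding g_def cube_shell_decomp f_def by (simp add: sum_subtractf)
      also have "norm \<dots> \<le> (\<Sum>s<T. K * M * (real (Suc s) * z ^ s))"
      proof (rule sum_norm_le)
        fix s
        show "norm (f s - h' s) \<le> K * M * (real (Suc s) * z ^ s)"
        proof (cases "s < S")
          case True
          then show ?thesis using h(2)[of s x] by (simp add: f_def h'_def)
        next
          case False
          have "norm (f s) \<le> (\<Sum>k\<in>shell \<nu> s. norm (a k))"
            unfolding f_def by (rule order_trans[OF norm_sum]) (simp add: norm_mult)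
          also have "\<dots> \<le> K * M * (real (Suc s) * z ^ s)" using False by (intro far) simp
          finally show ?thesis using False by (simp add: h'_def)
        qed
      qed
      also have "\<dots> \<le> K * M * H"
        unfolding sum_distrib_left[symmetric] using K M by (intro mult_left_mono sum_le_H) auto
      also have "\<dots> \<le> K * (H + 1) * M" using K M by (simp add: algebra_simps)
      finally show ?thesis .
    qed
    with sp show ?thesis unfolding M_def by blast
  qed
  moreover have "0 < C0" "0 < K * (H + 1)" using K H_nonneg by (auto simp: C0_def)
  ultimately show ?thesis by (intro exI[of _ C0] exI[of _ "K * (H + 1)"]) blast
qed

end


subsection \<open>Integration over the torus\<close>

lemma box_subset_torus: "box 0 (\<chi> i. 2 * pi) \<subseteq> torus" "torus \<subseteq> cbox 0 (\<chi> i. 2 * pi)"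
  by (auto simp: torus_def mem_box_cart less_imp_le)

lemma sets_borel_coordinate_box: "{x :: real ^ 'd::finite. \<forall>i. a \<le> x $ i \<and> x $ i < b} \<in> sets borel"
proof -
  have "{x :: real ^ 'd. \<forall>i. a \<le> x $ i \<and> x $ i < b} = (\<Inter>i. {x. a \<le> x $ i} \<inter> {x. x $ i < b})"
    by auto
  moreover have "closed {x :: real ^ 'd. a \<le> x $ i}" "open {x :: real ^ 'd. x $ i < b}" for i
    by (intro closed_Collect_le open_Collect_less continuous_intros)+
  ultimately show ?thesis by (auto intro!: sets.finite_INT)
qed

lemma torus_borel [measurable]: "torus \<in> sets borel"
  unfolding torus_def by (rule sets_borel_coordinate_box)

lemma torus_lebesgue [measurable, simp]: "torus \<in> sets lebesgue"
  using torus_borel by simp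

abbreviation torus_leb :: "(real ^ 'd::finite) measure" where
  "torus_leb \<equiv> lebesgue_on torus"

lemma emeasure_torus: "emeasure lborel (torus :: (real ^ 'd::finite) set) = ennreal ((2 * pi) ^ CARD('d))"
proof -
  define u :: "real ^ 'd" where "u = (\<chi> i. 2 * pi)"
  have ub: "u \<bullet> b = 2 * pi" if "b \<in> Basis" for b
    using that by (auto simp: Basis_vec_def u_def inner_axis)
  then have v: "(\<Prod>b\<in>Basis. (u - 0) \<bullet> b) = (2 * pi) ^ CARD('d)"
    by simp
  have "emeasure lborel (torus :: (real ^ 'd) set) \<le> emeasure lborel (cbox 0 u)"
    using box_subset_torus(2) unfolding u_def by (intro emeasure_mono) auto
  also have "\<dots> = ennreal ((2 * pi) ^ CARD('d))"
    unfolding v[symmetric] by (rule emeasure_lborel_cbox) (simp add: ub)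
  finally have le: "emeasure lborel (torus :: (real ^ 'd) set) \<le> ennreal ((2 * pi) ^ CARD('d))" .
  have "ennreal ((2 * pi) ^ CARD('d)) = emeasure lborel (box 0 u)"
    unfolding v[symmetric] by (rule emeasure_lborel_box[symmetric]) (simp add: ub)
  also have "\<dots> \<le> emeasure lborel (torus :: (real ^ 'd) set)"
    using box_subset_torus(1) unfolding u_def by (intro emeasure_mono) auto
  finally show ?thesis using le by (rule antisym[rotated])
qed

text \<open>The coordinatewise floor of \<open>u\<close> is the only grid index whose cell contains
  \<open>x\<close>. Since \<open>torus\<close> is half-open, the half-open cells partition it, which
  reduces integrals to grid sums.\<close>

lemma sum_indicator_grid:
  fixes x :: "real ^ 'd::finite"
  assumes "0 < M"
  shows "indicator torus x = (\<Sum>j\<in>grid M. indicator {y. \<forall>i. 0 \<le> y $ i \<and> y $ i < 2 * pi / real M} (x - grid_pt M j) :: real)"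
    (is "_ = (\<Sum>j\<in>_. indicator ?Q _)")
proof -
  define u where "u i = x $ i * real M / (2 * pi)" for i
  have cell: "0 \<le> (x - grid_pt M j) $ i \<and> (x - grid_pt M j) $ i < 2 * pi / real M \<longleftrightarrow> real (j i) \<le> u i \<and> u i < real (j i) + 1" for i j
  proof -
    define h where "h = 2 * pi / real M"
    have h: "0 < h" using assms by (simp add: h_def)
    have "(x - grid_pt M j) $ i = (u i - real (j i)) * h"
      using assms by (simp add: u_def grid_pt_def h_def field_simps)
    then show ?thesis
      unfolding h_def[symmetric] using h by (auto simp: zero_le_mult_iff)
  qed
  have tor: "0 \<le> x $ i \<and> x $ i < 2 * pi \<longleftrightarrow> 0 \<le> u i \<and> u i < real M" for i
    using assms by (simp add: u_def field_simps zero_le_mult_iff)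
  have floor: "real (j i) \<le> u i \<and> u i < real (j i) + 1 \<longleftrightarrow> int (j i) = \<lfloor>u i\<rfloor>" for i j
    by (metis floor_eq_iff of_int_of_nat_eq)
  show ?thesis
  proof (cases "x \<in> torus")
    case True
    then have u: "0 \<le> u i" "u i < real M" for i using tor by (auto simp: torus_def)
    define j0 where "j0 i = nat \<lfloor>u i\<rfloor>" for i
    have j0: "int (j0 i) = \<lfloor>u i\<rfloor>" for i using u[of i] by (simp add: j0_def)
    have "\<lfloor>u i\<rfloor> < int M" for i using u[of i] by (simp add: floor_less_iff)
    then have "j0 \<in> grid M" using j0 by (auto simp: grid_def) (metis of_nat_less_iff)
    have "(\<Sum>j\<in>grid M. indicator ?Q (x - grid_pt M j) :: real)
        = (\<Sum>j\<in>grid M. if j = j0 then 1 else 0)"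
    proof (intro sum.cong refl)
      fix j
      have "(\<forall>i. int (j i) = \<lfloor>u i\<rfloor>) \<longleftrightarrow> j = j0" unfolding j0[symmetric] by auto
      then show "indicator ?Q (x - grid_pt M j) = (if j = j0 then 1 else 0 :: real)"
        unfolding indicator_def mem_Collect_eq cell floor by simp
    qed
    also have "\<dots> = 1" using \<open>j0 \<in> grid M\<close> by simp
    finally show ?thesis using True by simp
  next
    case False
    have "x - grid_pt M j \<notin> ?Q" if "j \<in> grid M" for j
    proof
      assume "x - grid_pt M j \<in> ?Q"
      then have c: "real (j i) \<le> u i \<and> u i < real (j i) + 1" for i using cell by blast
      have "0 \<le> u i \<and> u i < real M" for i
      proof -
        have "j i < M" using that by (auto simp: grid_def)
        then show ?thesis using c[of i] by linarith
      qed
      then show False using False tor by (simp add: torus_def)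
    qed
    then show ?thesis using False by simp
  qed
qed

lemma lborel_integral_shift:
  fixes f :: "'a::euclidean_space \<Rightarrow> 'b::{banach, second_countable_topology}"
  assumes [measurable]: "f \<in> borel_measurable borel"
  shows "integral\<^sup>L lborel (\<lambda>x. f (x - c)) = integral\<^sup>L lborel f"
  by (subst (2) lborel_distr_plus[symmetric, of "- c"], subst integral_distr) auto

lemma lborel_integrable_shift:
  fixes f :: "'a::euclidean_space \<Rightarrow> 'b::{banach, second_countable_topology}"
  assumes "integrable lborel f"
  shows "integrable lborel (\<lambda>x. f (x - c))"
proof -
  have [measurable]: "f \<in> borel_measurable borel" using assms by auto
  have "integrable (distr lborel borel ((+) (- c))) f" using assms by (simp add: lborel_distr_plus)
  then show ?thesis by (subst (asm) integrable_distr_eq) auto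
qed

lemma trig_exp_borel [measurable]: "trig_exp k \<in> borel_measurable borel"
  by (intro borel_measurable_continuous_onI continuous_on_trig_exp)

text \<open>Translating every cell to the one at the origin turns the integral into the grid sum of
  \<open>trig_exp k\<close> times one cell integral. The grid sum vanishes as soon as
  \<open>M\<close> exceeds all coordinates of \<open>k\<close> in modulus.\<close>

lemma integral_trig_exp:
  fixes k :: "int ^ 'd::finite"
  shows "(LINT x|torus_leb. trig_exp k x) = (if k = 0 then (2 * pi) ^ CARD('d) else 0)"
proof -
  have "(LINT x|torus_leb. trig_exp k x) = integral\<^sup>L lebesgue (\<lambda>x. indicator torus x *\<^sub>R trig_exp k x)"
    by (rule integral_restrict_space) simp
  also have "\<dots> = integral\<^sup>L lborel (\<lambda>x. indicator torus x *\<^sub>R trig_exp k x)"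
    by (rule integral_completion) measurable
  finally have *: "(LINT x|torus_leb. trig_exp k x) = integral\<^sup>L lborel (\<lambda>x. indicator torus x *\<^sub>R trig_exp k x)" .
  show ?thesis
  proof (cases "k = 0")
    case True
    have "(LINT x|torus_leb. trig_exp k x) = integral\<^sup>L lborel (\<lambda>x :: real ^ 'd. of_real (indicator torus x) :: complex)"
      unfolding * by (simp add: True scaleR_conv_of_real)
    also have "\<dots> = of_real (measure lborel (torus :: (real ^ 'd) set))"
      using emeasure_torus[where 'd = 'd] by (subst integral_of_real) (auto simp: less_top[symmetric])
    finally show ?thesis using True emeasure_torus[where 'd = 'd] by (simp add: measure_def)
  next
    case False
    define M where "M = Suc (\<Sum>i\<in>UNIV. nat \<bar>k $ i\<bar>)"
    have kM: "\<bar>k $ i\<bar> < int M" for i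
    proof -
      have "nat \<bar>k $ i\<bar> \<le> (\<Sum>i\<in>UNIV. nat \<bar>k $ i\<bar>)" by (rule member_le_sum) auto
      then show ?thesis unfolding M_def by linarith
    qed
    define A where "A = {y :: real ^ 'd. \<forall>i. 0 \<le> y $ i \<and> y $ i < 2 * pi / real M}"
    define f where "f y = indicator A y *\<^sub>R trig_exp k y" for y
    have [measurable]: "A \<in> sets borel" unfolding A_def by (rule sets_borel_coordinate_box)
    have [measurable]: "f \<in> borel_measurable borel" unfolding f_def by measurable
    have "2 * pi / real M \<le> 2 * pi" by (simp add: M_def divide_le_eq)
    then have "A \<subseteq> torus" unfolding A_def torus_def by (auto intro: less_le_trans)
    then have "emeasure lborel A \<le> emeasure lborel (torus :: (real ^ 'd) set)" by (intro emeasure_mono) auto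
    then have Afin: "emeasure lborel A < \<infinity>" by (auto simp: emeasure_torus less_top[symmetric] top_unique)
    have fint: "integrable lborel f"
      unfolding f_def by (rule integrableI_bounded_set_indicator[where B = 1]) (use Afin in auto)
    have split: "indicator torus x *\<^sub>R trig_exp k x = (\<Sum>j\<in>grid M. trig_exp k (grid_pt M j) * f (x - grid_pt M j))" for x
    proof -
      have "indicator torus x *\<^sub>R trig_exp k x = (\<Sum>j\<in>grid M. indicator A (x - grid_pt M j) *\<^sub>R trig_exp k x)"
        by (subst sum_indicator_grid[of M]) (auto simp: M_def A_def scaleR_sum_left)
      also have "\<dots> = (\<Sum>j\<in>grid M. trig_exp k (grid_pt M j) * f (x - grid_pt M j))"
      proof (intro sum.cong refl)
        fix j :: "'d \<Rightarrow> nat"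
        have "trig_exp k (grid_pt M j) * cnj (trig_exp k (grid_pt M j)) = 1"
          by (simp flip: complex_norm_square)
        then have "trig_exp k (grid_pt M j) * trig_exp k (x - grid_pt M j) = trig_exp k x"
          unfolding trig_exp_diff by (simp add: mult.left_commute)
        then show "indicator A (x - grid_pt M j) *\<^sub>R trig_exp k x = trig_exp k (grid_pt M j) * f (x - grid_pt M j)"
          by (simp add: f_def)
      qed
      finally show ?thesis .
    qed
    have "(LINT x|torus_leb. trig_exp k x) = (\<Sum>j\<in>grid M. trig_exp k (grid_pt M j) * integral\<^sup>L lborel f)"
      unfolding * split using lborel_integrable_shift[OF fint]
      by (subst Bochner_Integration.integral_sum) (auto simp: lborel_integral_shift)
    also have "\<dots> = (\<Sum>j\<in>grid M. trig_exp k (grid_pt M j)) * integral\<^sup>L lborel f"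
      by (simp add: sum_distrib_right)
    also have "\<dots> = 0" using False kM by (subst sum_trig_exp_grid) (auto simp: M_def)
    finally show ?thesis using False by simp
  qed
qed

lemma emeasure_lebesgue_on_torus:
  "emeasure torus_leb (space (torus_leb :: (real ^ 'd::finite) measure)) = ennreal ((2 * pi) ^ CARD('d))"
  by (simp add: emeasure_restrict_space emeasure_torus)

lemma measure_lebesgue_on_torus:
  "measure torus_leb (space (torus_leb :: (real ^ 'd::finite) measure)) = (2 * pi) ^ CARD('d)"
  unfolding measure_def emeasure_lebesgue_on_torus by simp

lemma finite_measure_torus: "finite_measure (torus_leb :: (real ^ 'd::finite) measure)"
  by (rule finite_measureI) (simp only: emeasure_lebesgue_on_torus ennreal_neq_top infinity_ennreal_def not_False_eq_True)

lemma borel_measurable_lebesgue_on: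
  fixes f :: "'a::euclidean_space \<Rightarrow> 'b::topological_space"
  shows "f \<in> borel_measurable borel \<Longrightarrow> f \<in> borel_measurable (lebesgue_on S)"
  by (intro measurable_restrict_space1 measurable_completion) simp

lemma integrable_torus_bounded:
  fixes f :: "real ^ 'd::finite \<Rightarrow> 'b::{banach, second_countable_topology}"
  assumes "f \<in> borel_measurable torus_leb" "\<And>x. norm (f x) \<le> B"
  shows "integrable torus_leb f"
  using finite_measure.integrable_const_bound[OF finite_measure_torus] assms by blast

lemma trig_exp_measurable: "trig_exp k \<in> borel_measurable torus_leb"
  by (rule borel_measurable_lebesgue_on) (rule trig_exp_borel)

lemma trig_exp_integrable: "integrable torus_leb (trig_exp k)"
  by (rule integrable_torus_bounded[where B = 1]) (simp_all add: trig_exp_measurable)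

lemma trig_sum_measurable: "trig_sum F c \<in> borel_measurable torus_leb"
  by (intro borel_measurable_sum borel_measurable_times borel_measurable_const trig_exp_measurable)

lemma trig_sum_norm_le: "norm (trig_sum F c x) \<le> (\<Sum>k\<in>F. norm (c k))"
  by (rule order_trans[OF norm_sum]) (simp add: norm_mult)

lemma fourier_coeff_trig_sum:
  fixes F :: "(int ^ 'd::finite) set"
  assumes "finite F"
  shows "fourier_coeff (trig_sum F c) l = (if l \<in> F then c l else 0)"
proof -
  have "(LINT x|torus_leb. trig_sum F c x * cnj (trig_exp l x))
      = (LINT x|torus_leb. (\<Sum>k\<in>F. c k * trig_exp (k - l) x))"
    by (simp add: sum_distrib_right trig_exp_diff_freq mult.assoc)
  also have "\<dots> = (\<Sum>k\<in>F. c k * (LINT x|torus_leb. trig_exp (k - l) x))"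
    by (subst Bochner_Integration.integral_sum) (auto intro!: integrable_mult_right trig_exp_integrable)
  also have "\<dots> = (\<Sum>k\<in>F. if k = l then c k * (2 * pi) ^ CARD('d) else 0)"
    by (intro sum.cong refl) (simp add: integral_trig_exp)
  finally show ?thesis
    using assms by (simp add: fourier_coeff_def)
qed

lemma torus_parseval:
  fixes F :: "(int ^ 'd::finite) set"
  assumes "finite F"
  shows "(LINT x|torus_leb. (norm (trig_sum F c x))\<^sup>2)
    = (2 * pi) ^ CARD('d) * (\<Sum>k\<in>F. (norm (c k))\<^sup>2)"
proof -
  have "complex_of_real (LINT x|torus_leb. (norm (trig_sum F c x))\<^sup>2)
      = (LINT x|torus_leb. (\<Sum>k\<in>F. \<Sum>l\<in>F. c k * cnj (c l) * trig_exp (k - l) x))"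
    unfolding integral_complex_of_real[symmetric] complex_norm_square cnj_sum sum_product
    by (simp add: trig_exp_diff_freq mult_ac)
  also have "\<dots> = (\<Sum>k\<in>F. \<Sum>l\<in>F. c k * cnj (c l) * (LINT x|torus_leb. trig_exp (k - l) x))"
    by (subst Bochner_Integration.integral_sum, intro Bochner_Integration.integrable_sum integrable_mult_right trig_exp_integrable,
        subst Bochner_Integration.integral_sum, intro integrable_mult_right trig_exp_integrable, simp)
  also have "\<dots> = (\<Sum>k\<in>F. \<Sum>l\<in>F. if k = l then c k * cnj (c l) * (2 * pi) ^ CARD('d) else 0)"
    by (intro sum.cong refl) (simp add: integral_trig_exp)
  also have "\<dots> = complex_of_real ((2 * pi) ^ CARD('d) * (\<Sum>k\<in>F. (norm (c k))\<^sup>2))"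
    using assms by (simp add: complex_norm_square[symmetric] sum_distrib_left mult_ac)
  finally show ?thesis unfolding of_real_eq_iff .
qed

section \<open>\<open>Lp_norm\<close> against uniform and mean-square bounds\<close>

lemma ennreal_powr_mono:
  assumes "x \<le> y" "0 < a"
  shows "ennreal_powr x a \<le> ennreal_powr y a"
proof (cases "y = \<infinity>")
  case False
  then have "x \<noteq> \<infinity>" using assms(1) by (auto simp: top_unique)
  moreover have "enn2real x \<le> enn2real y" using assms(1) False by (intro enn2real_mono) (auto simp: less_top)
  ultimately show ?thesis using False assms(2)
    by (auto simp: ennreal_powr_def intro!: ennreal_leI powr_mono2)
qed (simp add: ennreal_powr_def)

lemma ennreal_powr_ennreal: "0 \<le> x \<Longrightarrow> ennreal_powr (ennreal x) a = ennreal (x powr a)"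
  by (simp add: ennreal_powr_def)

text \<open>The normalised measure of the torus is 1, so no constant arises for any
  \<open>p\<close>. The bound is required almost everywhere because class members equal the sum of
  their Fourier series only almost everywhere.\<close>

lemma Lp_norm_le:
  fixes h :: "real ^ 'd::finite \<Rightarrow> complex"
  assumes [measurable]: "h \<in> borel_measurable torus_leb"
    and "0 < p" "0 \<le> \<epsilon>" and ae: "AE x in torus_leb. norm (h x) \<le> \<epsilon>"
  shows "Lp_norm p h \<le> ennreal \<epsilon>"
proof (cases "p = \<infinity>")
  case True
  have "esssup torus_leb (\<lambda>x. ennreal (norm (h x))) \<le> ennreal \<epsilon>"
    using ae by (intro esssup_I) (auto elim!: eventually_mono intro: ennreal_leI)
  then show ?thesis by (simp add: Lp_norm_def True)
next
  case False
  define s where "s = enn2real p"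
  have s: "0 < s" unfolding s_def using assms(2) False by (simp add: enn2real_positive_iff less_top)
  define m where "m = (2 * pi) ^ CARD('d)"
  have m: "0 < m" by (simp add: m_def)
  have "(\<integral>\<^sup>+x. ennreal (norm (h x) powr s) \<partial>torus_leb) \<le> (\<integral>\<^sup>+x. ennreal (\<epsilon> powr s) \<partial>(torus_leb :: (real ^ 'd) measure))"
    using ae s by (intro nn_integral_mono_AE) (auto elim!: eventually_mono intro!: ennreal_leI powr_mono2)
  also have "\<dots> = ennreal (\<epsilon> powr s) * ennreal m"
    by (subst nn_integral_const) (simp only: emeasure_lebesgue_on_torus m_def)
  finally have "ennreal (1 / m) * (\<integral>\<^sup>+x. ennreal (norm (h x) powr s) \<partial>torus_leb)
      \<le> ennreal (1 / m) * (ennreal (\<epsilon> powr s) * ennreal m)"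
    by (rule mult_left_mono) simp
  also have "\<dots> = ennreal (\<epsilon> powr s)"
    using m by (simp flip: ennreal_mult)
  finally have "Lp_norm p h \<le> ennreal_powr (ennreal (\<epsilon> powr s)) (1 / s)"
    using False s unfolding Lp_norm_def s_def[symmetric] m_def[symmetric] by (simp add: ennreal_powr_mono)
  also have "\<dots> = ennreal \<epsilon>"
    using s assms(3) by (simp add: ennreal_powr_ennreal powr_powr)
  finally show ?thesis .
qed

text \<open>For finite \<open>p\<close> the tangent inequality with exponent \<open>s / 2\<close> is
  applied to \<open>y = (norm (h x) / \<eta>)\<^sup>2\<close> and integrated; by \<open>L2\<close>
  the mean of \<open>y - 1\<close> is nonnegative. For \<open>p = \<infinity>\<close> the mean
  square is at most the square of the essential supremum.\<close>

lemma Lp_norm_ge_L2: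
  fixes h :: "real ^ 'd::finite \<Rightarrow> complex"
  assumes [measurable]: "h \<in> borel_measurable torus_leb" and bdd: "\<And>x. norm (h x) \<le> B"
    and "2 < p" "0 < \<eta>" and L2: "(2 * pi) ^ CARD('d) * \<eta>\<^sup>2 \<le> (LINT x|torus_leb. (norm (h x))\<^sup>2)"
  shows "ennreal \<eta> \<le> Lp_norm p h"
proof -
  define m where "m = (2 * pi) ^ CARD('d)"
  have m: "0 < m" by (simp add: m_def)
  have const: "(LINT x|(torus_leb :: (real ^ 'd) measure). c) = c * m" for c :: real
    using measure_lebesgue_on_torus[where 'd = 'd] by (simp add: m_def)
  have B0: "0 \<le> B" using bdd[of 0] norm_ge_zero order_trans by blast
  have int2: "integrable torus_leb (\<lambda>x. (norm (h x))\<^sup>2)"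
    using bdd by (intro integrable_torus_bounded[where B = "B\<^sup>2"]) (auto intro!: power_mono)
  have int0: "integrable (torus_leb :: (real ^ 'd) measure) (\<lambda>x. c)" for c :: real
    by (intro integrable_torus_bounded[where B = "\<bar>c\<bar>"]) auto
  show ?thesis
  proof (cases "p = \<infinity>")
    case True
    define E where "E = esssup torus_leb (\<lambda>x. ennreal (norm (h x)))"
    have "ennreal \<eta> \<le> E"
    proof (cases "E = \<infinity>")
      case False
      then obtain t where t: "E = ennreal t" "0 \<le> t" by (cases E) auto
      have "AE x in torus_leb. ennreal (norm (h x)) \<le> ennreal t"
        using esssup_AE[of "\<lambda>x. ennreal (norm (h x))" "torus_leb"] unfolding E_def[symmetric] t(1) .
      then have "AE x in torus_leb. (norm (h x))\<^sup>2 \<le> t\<^sup>2"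
        using t(2) by (auto elim!: eventually_mono intro!: power_mono)
      then have "(LINT x|torus_leb. (norm (h x))\<^sup>2) \<le> (LINT x|(torus_leb :: (real ^ 'd) measure). t\<^sup>2)"
        by (intro integral_mono_AE int2 int0)
      with L2 have "m * \<eta>\<^sup>2 \<le> m * t\<^sup>2" unfolding const m_def[symmetric] by (simp add: mult.commute)
      then have "\<eta>\<^sup>2 \<le> t\<^sup>2" using m by simp
      then have "\<eta> \<le> t" using t(2) by (rule power2_le_imp_le)
      then show ?thesis unfolding t(1) by (rule ennreal_leI)
    qed simp
    then show ?thesis by (simp add: Lp_norm_def True E_def)
  next
    case False
    define s where "s = enn2real p"
    have "p = ennreal s" using False by (simp add: s_def less_top)
    then have s: "2 < s" using assms(3) by (simp add: ennreal_less_iff flip: ennreal_numeral)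
    have ints: "integrable torus_leb (\<lambda>x. norm (h x) powr s)"
      using bdd s B0 by (intro integrable_torus_bounded[where B = "B powr s"]) (auto intro!: powr_mono2)
    have pt: "\<eta> powr s * (1 - s / 2 + s / 2 / \<eta>\<^sup>2 * (norm (h x))\<^sup>2) \<le> norm (h x) powr s" for x
    proof -
      define y where "y = (norm (h x) / \<eta>)\<^sup>2"
      have "1 + s / 2 * (y - 1) \<le> y powr (s / 2)" using s by (intro bernoulli_powr) (auto simp: y_def)
      also have "y powr (s / 2) = (norm (h x) / \<eta>) powr s"
      proof -
        have "y = (norm (h x) / \<eta>) powr 2" using assms(4) by (simp add: y_def)
        then show ?thesis by (simp add: powr_powr)
      qed
      also have "\<dots> = norm (h x) powr s / \<eta> powr s" by (simp add: powr_divide)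
      finally have "(1 + s / 2 * (y - 1)) * \<eta> powr s \<le> norm (h x) powr s"
        using assms(4) by (simp add: pos_le_divide_eq)
      moreover have eq: "1 - s / 2 + s / 2 / \<eta>\<^sup>2 * (norm (h x))\<^sup>2 = 1 + s / 2 * (y - 1)"
        by (simp add: y_def power_divide algebra_simps)
      ultimately show ?thesis unfolding eq by (subst mult.commute)
    qed
    have "\<eta> powr s * m = \<eta> powr s * ((1 - s / 2) * m + s / 2 / \<eta>\<^sup>2 * (m * \<eta>\<^sup>2))"
      using assms(4) by (simp add: field_simps)
    also have "\<dots> \<le> \<eta> powr s * ((1 - s / 2) * m + s / 2 / \<eta>\<^sup>2 * (LINT x|torus_leb. (norm (h x))\<^sup>2))"
      using L2 s unfolding m_def[symmetric] by (intro mult_left_mono add_left_mono) auto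
    also have "\<dots> = (LINT x|torus_leb. \<eta> powr s * (1 - s / 2 + s / 2 / \<eta>\<^sup>2 * (norm (h x))\<^sup>2))"
      using int2 int0 by (simp add: const[symmetric] Bochner_Integration.integral_add)
    also have "\<dots> \<le> (LINT x|torus_leb. norm (h x) powr s)"
      using int2 int0 ints pt by (intro integral_mono integrable_mult_right Bochner_Integration.integrable_add) auto
    finally have *: "\<eta> powr s * m \<le> (LINT x|torus_leb. norm (h x) powr s)" .
    have "ennreal \<eta> = ennreal_powr (ennreal (\<eta> powr s)) (1 / s)"
      using s assms(4) by (simp add: ennreal_powr_ennreal powr_powr)
    also have "\<dots> \<le> ennreal_powr (ennreal (1 / m) * (\<integral>\<^sup>+x. ennreal (norm (h x) powr s) \<partial>torus_leb)) (1 / s)"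
    proof (rule ennreal_powr_mono)
      have "ennreal (\<eta> powr s) = ennreal (1 / m * (\<eta> powr s * m))" using m by simp
      also have "\<dots> \<le> ennreal (1 / m * (LINT x|torus_leb. norm (h x) powr s))"
        using * m by (intro ennreal_leI mult_left_mono) auto
      also have "\<dots> = ennreal (1 / m) * ennreal (LINT x|torus_leb. norm (h x) powr s)"
        using m by (intro ennreal_mult) auto
      also have "ennreal (LINT x|torus_leb. norm (h x) powr s) = (\<integral>\<^sup>+x. ennreal (norm (h x) powr s) \<partial>torus_leb)"
        using ints by (intro nn_integral_eq_integral[symmetric]) auto
      finally show "ennreal (\<eta> powr s) \<le> ennreal (1 / m) * (\<integral>\<^sup>+x. ennreal (norm (h x) powr s) \<partial>torus_leb)" .
    qed (use s in simp)
    finally show ?thesis using False by (simp add: Lp_norm_def s_def m_def)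
  qed
qed


subsection \<open>Uniqueness of Fourier coefficients\<close>

definition trig_poly :: "(real ^ 'd::finite \<Rightarrow> complex) \<Rightarrow> bool" where
  "trig_poly p \<longleftrightarrow> (\<exists>m. trig_sparse m p)"

lemma trig_poly_monomial: "trig_poly (\<lambda>x. c * trig_exp k x)"
  using trig_sparse_sum[of "{k}" 1 "\<lambda>_. c"] by (auto simp: trig_poly_def)

lemma trig_poly_const: "trig_poly (\<lambda>x. c)"
  using trig_poly_monomial[of c 0] by simp

lemma trig_poly_add: "trig_poly p \<Longrightarrow> trig_poly q \<Longrightarrow> trig_poly (\<lambda>x. p x + q x)"
  unfolding trig_poly_def using trig_sparse_add by blast

lemma trig_poly_sum: "finite I \<Longrightarrow> (\<And>i. i \<in> I \<Longrightarrow> trig_poly (p i)) \<Longrightarrow> trig_poly (\<lambda>x. \<Sum>i\<in>I. p i x)"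
  by (induction I rule: finite_induct) (simp_all add: trig_poly_const trig_poly_add)

lemma trig_polyE:
  assumes "trig_poly p"
  obtains F c where "finite F" "p = trig_sum F c"
  using assms unfolding trig_poly_def trig_sparse_def by blast

lemma trig_poly_mult:
  assumes "trig_poly p" "trig_poly q"
  shows "trig_poly (\<lambda>x. p x * q x)"
proof -
  obtain F c where p: "finite F" "p = trig_sum F c" using assms(1) by (rule trig_polyE)
  obtain G d where q: "finite G" "q = trig_sum G d" using assms(2) by (rule trig_polyE)
  have "p x * q x = (\<Sum>k\<in>F. \<Sum>l\<in>G. (c k * d l) * trig_exp (k + l) x)" for x
    unfolding p(2) q(2) sum_product by (simp add: trig_exp_add_freq mult_ac)
  moreover have "trig_poly (\<lambda>x. \<Sum>k\<in>F. \<Sum>l\<in>G. (c k * d l) * trig_exp (k + l) x)"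
    by (intro trig_poly_sum p(1) q(1) trig_poly_monomial)
  ultimately show ?thesis by simp
qed

text \<open>Identifies the torus with a compact subset of \<open>complex ^ 'd\<close>, where Stone-Weierstrass applies.\<close>

definition circle_map :: "real ^ 'd::finite \<Rightarrow> complex ^ 'd" where
  "circle_map x = (\<chi> i. cis (x $ i))"

lemma continuous_on_circle_map: "continuous_on S circle_map"
  unfolding circle_map_def cis_conv_exp by (intro continuous_intros)

lemma inj_on_circle_map: "inj_on circle_map torus"
proof (rule inj_onI)
  fix x y :: "real ^ 'a" assume *: "x \<in> torus" "y \<in> torus" "circle_map x = circle_map y"
  show "x = y"
  proof (rule vec_eq_iff[THEN iffD2, rule_format])
    fix i
    have "cis (x $ i) = cis (y $ i)" using *(3) by (simp add: circle_map_def vec_eq_iff)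
    then have "cis (x $ i - y $ i) = 1" by (simp flip: cis_divide)
    then obtain n where n: "x $ i - y $ i = of_int n * (2 * pi)" unfolding cis_eq_1_iff by blast
    have b: "0 \<le> x $ i" "x $ i < 2 * pi" "0 \<le> y $ i" "y $ i < 2 * pi" using * by (auto simp: torus_def)
    have "\<bar>of_int n * (2 * pi)\<bar> < 1 * (2 * pi)" unfolding n[symmetric] using b by linarith
    then have "\<bar>real_of_int n\<bar> < 1" by (simp add: abs_mult)
    then have "n = 0" by linarith
    then show "x $ i = y $ i" using n by simp
  qed
qed

lemma trig_exp_axis: "trig_exp (axis i n) x = cis (real_of_int n * x $ i)"
proof -
  have "(\<Sum>j\<in>UNIV. real_of_int (axis i n $ j) * x $ j) = (\<Sum>j\<in>UNIV. if j = i then real_of_int n * x $ i else 0)"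
    by (intro sum.cong) (auto simp: axis_def)
  then show ?thesis by (simp add: trig_exp_cis)
qed

lemma trig_poly_cos_sin:
  "trig_poly (\<lambda>x. of_real (cos (x $ i)))" "trig_poly (\<lambda>x. of_real (sin (x $ i)))"
proof -
  have c: "complex_of_real (cos (x $ i)) = 1 / 2 * trig_exp (axis i 1) x + 1 / 2 * trig_exp (axis i (- 1)) x" for x
    by (simp add: trig_exp_axis complex_eq_iff)
  show "trig_poly (\<lambda>x. of_real (cos (x $ i)))"
    unfolding c by (intro trig_poly_add trig_poly_monomial)
  have s: "complex_of_real (sin (x $ i)) = - \<i> / 2 * trig_exp (axis i 1) x + \<i> / 2 * trig_exp (axis i (- 1)) x" for x
    by (simp add: trig_exp_axis complex_eq_iff)
  show "trig_poly (\<lambda>x. of_real (sin (x $ i)))"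
    unfolding s by (intro trig_poly_add trig_poly_monomial)
qed

text \<open>Only the linear functionals need an argument: in the real basis \<open>axis i 1\<close>,
  \<open>axis i \<i>\<close> the point \<open>circle_map x\<close> has the coordinates
  \<open>cos (x $ i)\<close> and \<open>sin (x $ i)\<close>, which are trigonometric
  polynomials.\<close>

lemma real_polynomial_trig_poly:
  "real_polynomial_function g \<Longrightarrow> trig_poly (\<lambda>x. of_real (g (circle_map x)))"
proof (induction rule: real_polynomial_function.induct)
  case (linear g)
  interpret bounded_linear g by (rule linear)
  have "circle_map x = (\<Sum>i\<in>UNIV. cos (x $ i) *\<^sub>R axis i 1 + sin (x $ i) *\<^sub>R axis i \<i>)" for x :: "real ^ 'a"
  proof (rule vec_eq_iff[THEN iffD2, rule_format])
    fix j
    have "(\<Sum>i\<in>UNIV. cos (x $ i) *\<^sub>R axis i 1 + sin (x $ i) *\<^sub>R axis i \<i>) $ j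
        = (\<Sum>i\<in>UNIV. if i = j then cis (x $ j) else 0)"
      unfolding sum_component
      by (intro sum.cong) (auto simp: axis_def complex_eq_iff)
    then show "circle_map x $ j = (\<Sum>i\<in>UNIV. cos (x $ i) *\<^sub>R axis i 1 + sin (x $ i) *\<^sub>R axis i \<i>) $ j"
      by (simp add: circle_map_def)
  qed
  then have "complex_of_real (g (circle_map x)) = (\<Sum>i\<in>UNIV. of_real (cos (x $ i)) * of_real (g (axis i 1)) + of_real (sin (x $ i)) * of_real (g (axis i \<i>)))" for x
    by (simp add: sum add scaleR)
  then show ?case
    by (simp add: trig_poly_sum trig_poly_add trig_poly_mult trig_poly_cos_sin trig_poly_const)
qed (simp_all add: trig_poly_const trig_poly_add trig_poly_mult)

lemma integrable_mult_bounded: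
  fixes f g :: "'a \<Rightarrow> complex"
  assumes "integrable M f" "g \<in> borel_measurable M" "\<And>x. x \<in> space M \<Longrightarrow> norm (g x) \<le> B"
  shows "integrable M (\<lambda>x. f x * g x)"
proof (rule Bochner_Integration.integrable_bound)
  show "integrable M (\<lambda>x. of_real B * f x)" using assms(1) by (rule integrable_mult_right)
  show "AE x in M. norm (f x * g x) \<le> norm (of_real B * f x)"
  proof (rule AE_I2)
    fix x assume "x \<in> space M"
    then have "norm (g x) \<le> \<bar>B\<bar>" using assms(3)[of x] by linarith
    then show "norm (f x * g x) \<le> norm (of_real B * f x)"
      using mult_left_mono[of "norm (g x)" "\<bar>B\<bar>" "norm (f x)"] by (simp add: norm_mult mult.commute)
  qed
qed (use assms in auto)

lemma integral_mult_trig_poly_eq_0: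
  fixes f :: "real ^ 'd::finite \<Rightarrow> complex"
  assumes f: "integrable torus_leb f" and "\<And>k. fourier_coeff f k = 0" and "trig_poly p"
  shows "(LINT x|torus_leb. f x * p x) = 0"
proof -
  obtain F c where p: "finite F" "p = trig_sum F c" using assms(3) by (rule trig_polyE)
  have int: "integrable torus_leb (\<lambda>x. f x * trig_exp k x)" for k
    using f trig_exp_measurable by (rule integrable_mult_bounded[where B = 1]) simp
  have "(LINT x|torus_leb. f x * trig_exp k x) = 0" for k
    using assms(2)[of "- k"] by (simp add: fourier_coeff_def cnj_trig_exp)
  moreover have "f x * p x = (\<Sum>k\<in>F. c k * (f x * trig_exp k x))" for x
    unfolding p(2) sum_distrib_left by (simp add: mult_ac)
  ultimately show ?thesis
    using int by (simp add: Bochner_Integration.integral_sum)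
qed

lemma circle_map_measurable [measurable]: "circle_map \<in> borel_measurable borel"
  by (intro borel_measurable_continuous_onI continuous_on_circle_map)

text \<open>Stone-Weierstrass approximates \<open>\<phi>\<close> uniformly on the compact set
  \<open>S\<close> by polynomials, against which \<open>f\<close> integrates to zero; the error is
  at most \<open>e\<close> times the integral of \<open>norm (f x)\<close>. \<open>S\<close> is the
  image of the closed box because \<open>torus\<close> is not compact.\<close>

lemma integral_mult_continuous_eq_0:
  fixes f :: "real ^ 'd::finite \<Rightarrow> complex" and \<phi> :: "complex ^ 'd \<Rightarrow> real"
  assumes f: "integrable torus_leb f" and "\<And>k. fourier_coeff f k = 0" and \<phi>: "continuous_on UNIV \<phi>"
  shows "(LINT x|torus_leb. f x * of_real (\<phi> (circle_map x))) = 0"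
proof -
  define S :: "(complex ^ 'd) set" where "S = circle_map ` cbox 0 (\<chi> i. 2 * pi)"
  have S: "compact S" unfolding S_def by (intro compact_continuous_image continuous_on_circle_map compact_cbox)
  have inS: "circle_map x \<in> S" if "x \<in> torus" for x
    using that box_subset_torus(2) unfolding S_def by blast
  have meas: "(\<lambda>x. complex_of_real (\<theta> (circle_map x))) \<in> borel_measurable torus_leb"
    if "continuous_on UNIV \<theta>" for \<theta> :: "complex ^ 'd \<Rightarrow> real"
  proof (rule borel_measurable_lebesgue_on)
    have [measurable]: "\<theta> \<in> borel_measurable borel" using that by (rule borel_measurable_continuous_onI)
    show "(\<lambda>x. complex_of_real (\<theta> (circle_map x))) \<in> borel_measurable borel" by measurable
  qed
  have int: "integrable torus_leb (\<lambda>x. f x * of_real (\<theta> (circle_map x)))"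
    if \<theta>: "continuous_on UNIV \<theta>" for \<theta> :: "complex ^ 'd \<Rightarrow> real"
  proof -
    have "compact (\<theta> ` S)" using \<theta> S by (intro compact_continuous_image) (auto intro: continuous_on_subset)
    then obtain B where B: "\<And>z. z \<in> S \<Longrightarrow> norm (\<theta> z) \<le> B" using compact_imp_bounded bounded_iff by (metis imageI)
    show ?thesis
      using f meas[OF \<theta>] by (rule integrable_mult_bounded[where B = B]) (use B inS in auto)
  qed
  define I where "I = (LINT x|torus_leb. norm (f x))"
  have small: "norm (LINT x|torus_leb. f x * of_real (\<phi> (circle_map x))) \<le> e * I" if e: "0 < e" for e
  proof -
    obtain g where g: "real_polynomial_function g" "\<And>z. z \<in> S \<Longrightarrow> \<bar>\<phi> z - g z\<bar> < e"
      using Stone_Weierstrass_real_polynomial_function[OF S continuous_on_subset[OF \<phi> subset_UNIV] e] by blast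
    have gc: "continuous_on UNIV g"
      using g(1) by (simp add: continuous_on_eq_continuous_within continuous_real_polymonial_function)
    have "(LINT x|torus_leb. f x * of_real (g (circle_map x))) = 0"
      using integral_mult_trig_poly_eq_0[OF f assms(2) real_polynomial_trig_poly[OF g(1)]] .
    then have "(LINT x|torus_leb. f x * of_real (\<phi> (circle_map x)))
        = (LINT x|torus_leb. f x * of_real (\<phi> (circle_map x)) - f x * of_real (g (circle_map x)))"
      using int[OF \<phi>] int[OF gc] by simp
    also have "norm \<dots> \<le> (LINT x|torus_leb. e * norm (f x))"
    proof (rule Bochner_Integration.integral_norm_bound_integral)
      show "integrable torus_leb (\<lambda>x. f x * of_real (\<phi> (circle_map x)) - f x * of_real (g (circle_map x)))"
        using int[OF \<phi>] int[OF gc] by (rule Bochner_Integration.integrable_diff)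
      show "integrable torus_leb (\<lambda>x. e * norm (f x))" using f by simp
      fix x :: "real ^ 'd" assume "x \<in> space torus_leb"
      then have "\<bar>\<phi> (circle_map x) - g (circle_map x)\<bar> \<le> e" using g(2)[OF inS] by (simp add: less_imp_le)
      then have "norm (f x) * \<bar>\<phi> (circle_map x) - g (circle_map x)\<bar> \<le> norm (f x) * e" by (rule mult_left_mono) simp
      moreover have "norm (f x * of_real (\<phi> (circle_map x)) - f x * of_real (g (circle_map x)))
          = norm (f x) * \<bar>\<phi> (circle_map x) - g (circle_map x)\<bar>"
        by (simp only: right_diff_distrib[symmetric] norm_mult of_real_diff[symmetric] norm_of_real real_norm_def)
      ultimately show "norm (f x * of_real (\<phi> (circle_map x)) - f x * of_real (g (circle_map x))) \<le> e * norm (f x)"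
        by (simp add: mult.commute)
    qed
    finally show ?thesis by (simp add: I_def)
  qed
  have I: "0 \<le> I" by (simp add: I_def)
  have "norm (LINT x|torus_leb. f x * of_real (\<phi> (circle_map x))) \<le> 0 + e" if "0 < e" for e
  proof -
    have "norm (LINT x|torus_leb. f x * of_real (\<phi> (circle_map x))) \<le> e / (I + 1) * I"
      using I that by (intro small) simp
    also have "\<dots> \<le> e" using I that by (simp add: field_simps)
    finally show ?thesis by simp
  qed
  then have "norm (LINT x|torus_leb. f x * of_real (\<phi> (circle_map x))) \<le> 0" by (rule field_le_epsilon)
  then show ?thesis by simp
qed

text \<open>The cut-offs \<open>\<phi> n\<close> decrease to the indicator of the closed set
  \<open>C\<close>. Injectivity of \<open>circle_map\<close> on the half-open torus identifies
  \<open>circle_map x \<in> C\<close> with \<open>x \<in> K\<close>, and dominated convergence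
  concludes.\<close>

lemma integral_compact_eq_0:
  fixes f :: "real ^ 'd::finite \<Rightarrow> complex"
  assumes f: "integrable torus_leb f" and "\<And>k. fourier_coeff f k = 0" and K: "compact K" "K \<subseteq> torus"
  shows "(LINT x|torus_leb. f x * of_real (indicator K x)) = 0"
proof (cases "K = {}")
  case False
  define C where "C = circle_map ` K"
  have C: "closed C" "C \<noteq> {}"
    using False K(1) unfolding C_def
    by (auto intro!: compact_imp_closed compact_continuous_image continuous_on_circle_map)
  define \<phi> where "\<phi> n z = max 0 (1 - real n * infdist z C)" for n and z :: "complex ^ 'd"
  have \<phi>: "continuous_on UNIV (\<phi> n)" for n unfolding \<phi>_def by (intro continuous_intros)
  have [measurable]: "\<phi> n \<in> borel_measurable borel" for n using \<phi> by (rule borel_measurable_continuous_onI)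
  have [measurable]: "K \<in> sets borel" using K(1) by (simp add: borel_compact)
  have Km: "(\<lambda>x. complex_of_real (indicator K x)) \<in> borel_measurable torus_leb"
    by (rule borel_measurable_lebesgue_on) measurable
  have pm: "(\<lambda>x. complex_of_real (\<phi> n (circle_map x))) \<in> borel_measurable torus_leb" for n
    by (rule borel_measurable_lebesgue_on) measurable
  have bound: "\<bar>\<phi> n z\<bar> \<le> 1" for n z by (simp add: \<phi>_def infdist_nonneg)
  have lim: "(\<lambda>n. \<phi> n (circle_map x)) \<longlonglongrightarrow> indicator K x" if x: "x \<in> torus" for x
  proof (cases "x \<in> K")
    case True
    then have "infdist (circle_map x) C = 0" by (simp add: C_def)
    then show ?thesis using True by (simp add: \<phi>_def)
  next
    case F: False
    have "circle_map x \<notin> C"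
      unfolding C_def using F x K(2) inj_on_circle_map by (auto dest: inj_onD)
    then have pos: "0 < infdist (circle_map x) C"
      using in_closed_iff_infdist_zero[OF C] by (metis infdist_nonneg less_eq_real_def)
    obtain n0 where n0: "1 < real n0 * infdist (circle_map x) C" using reals_Archimedean3[OF pos] by blast
    have "\<phi> n (circle_map x) = 0" if "n0 \<le> n" for n
    proof -
      have "real n0 * infdist (circle_map x) C \<le> real n * infdist (circle_map x) C"
        using that pos by (intro mult_right_mono) auto
      then show ?thesis using n0 by (simp add: \<phi>_def)
    qed
    then have "eventually (\<lambda>n. \<phi> n (circle_map x) = indicator K x) sequentially"
      using F by (auto simp: eventually_sequentially)
    then show ?thesis by (rule tendsto_eventually)
  qed
  have "(\<lambda>n. LINT x|torus_leb. f x * of_real (\<phi> n (circle_map x))) \<longlonglongrightarrow> (LINT x|torus_leb. f x * of_real (indicator K x))"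
  proof (rule integral_dominated_convergence[where w = "\<lambda>x. norm (f x)"])
    show "integrable torus_leb (\<lambda>x. norm (f x))" using f by simp
    show "(\<lambda>x. f x * of_real (indicator K x)) \<in> borel_measurable torus_leb"
      using f Km by (intro borel_measurable_times) auto
    show "(\<lambda>x. f x * of_real (\<phi> n (circle_map x))) \<in> borel_measurable torus_leb" for n
      using f pm by (intro borel_measurable_times) auto
    show "AE x in torus_leb. (\<lambda>n. f x * of_real (\<phi> n (circle_map x))) \<longlonglongrightarrow> f x * of_real (indicator K x)"
      using lim by (intro AE_I2 tendsto_intros) auto
    show "AE x in torus_leb. norm (f x * of_real (\<phi> n (circle_map x))) \<le> norm (f x)" for n
      using bound by (intro AE_I2) (simp add: norm_mult mult_left_le)
  qed
  then show ?thesis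
    unfolding integral_mult_continuous_eq_0[OF f assms(2) \<phi>] by (simp add: LIMSEQ_const_iff)
qed simp

text \<open>A compact subset of the set \<open>N\<close> where \<open>g\<close> is positive must be
  null, since \<open>g\<close> has integral zero over it. Inner regularity exhausts \<open>N\<close>
  by closed sets, which are compact because the torus is bounded.\<close>

lemma AE_nonpos_of_compact_integrals:
  fixes g :: "real ^ 'd::finite \<Rightarrow> real"
  assumes g: "integrable torus_leb g"
    and zero: "\<And>K. compact K \<Longrightarrow> K \<subseteq> torus \<Longrightarrow> (LINT x|torus_leb. g x * indicator K x) = 0"
  shows "AE x in torus_leb. g x \<le> 0"
proof -
  define N where "N = {x \<in> torus. 0 < g x}"
  have "{x \<in> space torus_leb. 0 < g x} \<in> sets torus_leb"
    using g by measurable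
  then have Nl: "N \<in> sets lebesgue" by (simp add: N_def sets_restrict_space_iff)
  have null: "emeasure lebesgue K = 0" if K: "compact K" "K \<subseteq> N" for K
  proof -
    have Kt: "K \<subseteq> torus" using K(2) by (auto simp: N_def)
    have [measurable]: "K \<in> sets borel" using K(1) by (simp add: borel_compact)
    have Km: "indicator K \<in> borel_measurable (torus_leb :: (real ^ 'd) measure)"
      by (rule borel_measurable_lebesgue_on) measurable
    have int: "integrable torus_leb (\<lambda>x. g x * indicator K x)"
    proof (rule Bochner_Integration.integrable_bound[OF g])
      show "(\<lambda>x. g x * indicator K x) \<in> borel_measurable torus_leb"
        using g Km by (intro borel_measurable_times) auto
    qed (auto simp: indicator_def)
    have "AE x in torus_leb. g x * indicator K x = 0"
    proof -
      have "AE x in torus_leb. 0 \<le> g x * indicator K x"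
        using K(2) by (intro AE_I2) (auto simp: indicator_def N_def)
      then show ?thesis using integral_nonneg_eq_0_iff_AE[OF int] zero[OF K(1) Kt] by simp
    qed
    then have "AE x in torus_leb. x \<notin> K"
      using K(2) by (auto elim!: eventually_mono simp: indicator_def N_def split: if_splits)
    then have "AE x in lebesgue. x \<in> torus \<longrightarrow> x \<notin> K" by (simp add: AE_restrict_space_iff)
    then have "AE x in lebesgue. x \<notin> K" using Kt by (auto elim!: eventually_mono)
    moreover have "K \<in> sets lebesgue" by simp
    ultimately have "K \<in> null_sets lebesgue" by (simp add: AE_iff_null_sets)
    then show ?thesis by auto
  qed
  have "emeasure lebesgue N \<le> 0 + ennreal e" if "0 < e" for e :: real
  proof -
    obtain K where K: "closed K" "K \<subseteq> N" "N - K \<in> lmeasurable" "emeasure lebesgue (N - K) < ennreal e"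
      using sets_lebesgue_inner_closed[OF Nl \<open>0 < e\<close>] by blast
    have "K \<subseteq> cbox 0 (\<chi> i. 2 * pi)" using K(2) box_subset_torus(2) by (auto simp: N_def)
    then have "bounded K" by (rule bounded_subset[OF bounded_cbox])
    then have "compact K" using K(1) by (simp add: compact_eq_bounded_closed)
    then have "emeasure lebesgue K = 0" using null K(2) by blast
    moreover have "emeasure lebesgue N \<le> emeasure lebesgue K + emeasure lebesgue (N - K)"
    proof -
      have "N = K \<union> (N - K)" using K(2) by blast
      moreover have "K \<in> sets lebesgue" using K(1) by simp
      ultimately show ?thesis using emeasure_subadditive[of K lebesgue "N - K"] K(3) by (metis fmeasurableD)
    qed
    ultimately show ?thesis using K(4) by simp
  qed
  then have "emeasure lebesgue N \<le> 0" by (rule ennreal_le_epsilon)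
  then have "N \<in> null_sets lebesgue" using Nl by auto
  then have "AE x in lebesgue. x \<notin> N" by (rule AE_not_in)
  then have "AE x in lebesgue. x \<in> torus \<longrightarrow> g x \<le> 0" by (auto elim!: eventually_mono simp: N_def not_less)
  then show ?thesis by (simp add: AE_restrict_space_iff)
qed

text \<open>One-sided bounds for \<open>Re\<close>, \<open>- Re\<close>, \<open>Im\<close> and
  \<open>- Im\<close> together give the claim; hence the auxiliary fact for a general real
  functional \<open>T\<close>.\<close>

theorem fourier_uniqueness:
  fixes f :: "real ^ 'd::finite \<Rightarrow> complex"
  assumes f: "integrable torus_leb f" and coeff: "\<And>k. fourier_coeff f k = 0"
  shows "AE x in torus_leb. f x = 0"
proof -
  have main: "AE x in torus_leb. T (f x) \<le> 0" if T: "bounded_linear T" for T :: "complex \<Rightarrow> real"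
  proof (rule AE_nonpos_of_compact_integrals)
    interpret bounded_linear T by (rule T)
    show "integrable torus_leb (\<lambda>x. T (f x))" using T f by (rule integrable_bounded_linear)
    fix K :: "(real ^ 'd) set" assume K: "compact K" "K \<subseteq> torus"
    have [measurable]: "K \<in> sets borel" using K(1) by (simp add: borel_compact)
    have "(\<lambda>x. complex_of_real (indicator K x)) \<in> borel_measurable torus_leb"
      by (rule borel_measurable_lebesgue_on) measurable
    with f have "integrable torus_leb (\<lambda>x. f x * of_real (indicator K x))"
      by (rule integrable_mult_bounded[where B = 1]) (simp add: indicator_def)
    then have "(LINT x|torus_leb. T (f x * of_real (indicator K x))) = T (LINT x|torus_leb. f x * of_real (indicator K x))"
      by (rule integral_bounded_linear[OF T])
    also have "\<dots> = 0" using integral_compact_eq_0[OF f coeff K] by (simp add: zero)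
    also have "(\<lambda>x. T (f x * of_real (indicator K x))) = (\<lambda>x. T (f x) * indicator K x)"
      by (auto simp: indicator_def zero)
    finally show "(LINT x|torus_leb. T (f x) * indicator K x) = 0" .
  qed
  have "AE x in torus_leb. Re (f x) \<le> 0" "AE x in torus_leb. - Re (f x) \<le> 0"
    "AE x in torus_leb. Im (f x) \<le> 0" "AE x in torus_leb. - Im (f x) \<le> 0"
    by (intro main bounded_linear_Re bounded_linear_Im bounded_linear_minus)+
  then show ?thesis by eventually_elim (simp add: complex_eq_iff)
qed

section \<open>Recovery of a function from summable Fourier coefficients\<close>

lemma fourier_coeff_tendsto:
  fixes P :: "nat \<Rightarrow> real ^ 'd::finite \<Rightarrow> complex"
  assumes meas: "\<And>n. P n \<in> borel_measurable torus_leb" and bound: "\<And>n x. norm (P n x) \<le> B"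
    and lim: "\<And>x. (\<lambda>n. P n x) \<longlonglongrightarrow> g x"
  shows "(\<lambda>n. fourier_coeff (P n) k) \<longlonglongrightarrow> fourier_coeff g k"
proof -
  have cm: "(\<lambda>x. cnj (trig_exp k x)) \<in> borel_measurable torus_leb"
    unfolding cnj_trig_exp by (rule trig_exp_measurable)
  have gm: "g \<in> borel_measurable torus_leb"
    using meas lim by (rule borel_measurable_LIMSEQ_metric)
  have "(\<lambda>n. LINT x|torus_leb. P n x * cnj (trig_exp k x)) \<longlonglongrightarrow> (LINT x|torus_leb. g x * cnj (trig_exp k x))"
  proof (rule integral_dominated_convergence[where w = "\<lambda>x. B"])
    show "integrable (torus_leb :: (real ^ 'd) measure) (\<lambda>x. B)"
      by (rule integrable_torus_bounded[where B = "\<bar>B\<bar>"]) auto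
    show "AE x in torus_leb. (\<lambda>n. P n x * cnj (trig_exp k x)) \<longlonglongrightarrow> g x * cnj (trig_exp k x)"
      by (intro AE_I2 tendsto_intros lim)
    show "AE x in torus_leb. norm (P n x * cnj (trig_exp k x)) \<le> B" for n
      using bound by (simp add: norm_mult)
  qed (use meas gm cm in \<open>auto intro!: borel_measurable_times\<close>)
  then show ?thesis unfolding fourier_coeff_def by (rule tendsto_mult_left)
qed

text \<open>The dyadic partial sums converge everywhere to a bounded \<open>g\<close>. Dominated
  convergence shows that \<open>g\<close> has the coefficients of \<open>f\<close>, and uniqueness
  identifies the two almost everywhere.\<close>

theorem fourier_series_AE:
  fixes f :: "real ^ 'd::finite \<Rightarrow> complex"
  assumes f: "integrable torus_leb f"
    and K: "\<And>F. finite F \<Longrightarrow> (\<Sum>k\<in>F. norm (fourier_coeff f k)) \<le> K"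
  shows "AE x in torus_leb. (\<lambda>T. trig_sum (cube (2 ^ T)) (fourier_coeff f) x) \<longlonglongrightarrow> f x"
proof -
  define P where "P T x = trig_sum (cube (2 ^ T)) (fourier_coeff f) x" for T x
  define R where "R s x = trig_sum (shell 0 s) (fourier_coeff f) x" for s x
  define \<rho> where "\<rho> s = (\<Sum>k\<in>(shell 0 s :: (int ^ 'd) set). norm (fourier_coeff f k))" for s
  have P_R: "P T x = P 0 x + (\<Sum>s<T. R s x)" for T x
    using cube_shell_decomp[of "\<lambda>k. fourier_coeff f k * trig_exp k x" 0 T] by (simp add: P_def R_def)
  have "(\<Sum>s<T. \<rho> s) \<le> K" for T
  proof -
    have "(\<Sum>k\<in>cube (2 ^ (0 + T)). norm (fourier_coeff f k)) = (\<Sum>k\<in>cube (2 ^ 0). norm (fourier_coeff f k)) + (\<Sum>s<T. \<rho> s)"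
      unfolding \<rho>_def by (rule cube_shell_decomp)
    moreover have "0 \<le> (\<Sum>k\<in>(cube (2 ^ 0) :: (int ^ 'd) set). norm (fourier_coeff f k))" by (rule sum_nonneg) simp
    ultimately show ?thesis using K[of "cube (2 ^ (0 + T))"] by simp
  qed
  then have "summable \<rho>" by (intro summableI_nonneg_bounded) (auto simp: \<rho>_def sum_nonneg)
  then have "summable (\<lambda>s. R s x)" for x
    by (rule summable_comparison_test'[where N = 0]) (simp add: R_def \<rho>_def trig_sum_norm_le)
  then have "(\<lambda>T. P 0 x + (\<Sum>s<T. R s x)) \<longlonglongrightarrow> P 0 x + (\<Sum>s. R s x)" for x
    by (intro tendsto_add tendsto_const summable_LIMSEQ)
  then have lim: "(\<lambda>T. P T x) \<longlonglongrightarrow> P 0 x + (\<Sum>s. R s x)" for x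
    unfolding P_R[symmetric] .
  define g where "g x = P 0 x + (\<Sum>s. R s x)" for x
  have Pg: "(\<lambda>T. P T x) \<longlonglongrightarrow> g x" for x using lim by (simp add: g_def)
  have Pb: "norm (P T x) \<le> K" for T x
    unfolding P_def using trig_sum_norm_le K[OF finite_cube] by (rule order_trans)
  have Pm: "P T \<in> borel_measurable torus_leb" for T
    unfolding P_def[abs_def] by (rule trig_sum_measurable)
  have gm: "g \<in> borel_measurable torus_leb" using Pm Pg by (rule borel_measurable_LIMSEQ_metric)
  have gb: "norm (g x) \<le> K" for x
    using Pb by (intro tendsto_upperbound[OF tendsto_norm[OF Pg]]) auto
  have gi: "integrable torus_leb g" using gm gb by (rule integrable_torus_bounded)
  have gc: "fourier_coeff g k = fourier_coeff f k" for k
  proof -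
    obtain T0 where "\<forall>T\<ge>T0. k \<in> cube (2 ^ T)" using finite_subset_cube[of "{k}"] by auto
    then have "eventually (\<lambda>T. fourier_coeff (P T) k = fourier_coeff f k) sequentially"
      unfolding P_def eventually_sequentially by (intro exI[of _ T0]) (simp add: fourier_coeff_trig_sum)
    then have "(\<lambda>T. fourier_coeff (P T) k) \<longlonglongrightarrow> fourier_coeff f k" by (rule tendsto_eventually)
    with fourier_coeff_tendsto[OF Pm Pb Pg, of k] show ?thesis by (rule LIMSEQ_unique)
  qed
  have int: "integrable torus_leb (\<lambda>x. h x * cnj (trig_exp k x))"
    if "integrable torus_leb h" for h :: "real ^ 'd \<Rightarrow> complex" and k
    unfolding cnj_trig_exp using that trig_exp_measurable by (rule integrable_mult_bounded[where B = 1]) simp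
  have "fourier_coeff (\<lambda>x. f x - g x) k = 0" for k
    using gc[of k] int[OF f] int[OF gi]
    by (simp add: fourier_coeff_def left_diff_distrib right_diff_distrib)
  then have "AE x in torus_leb. f x - g x = 0"
    using f gi by (intro fourier_uniqueness) auto
  then show ?thesis
    unfolding P_def[symmetric] using Pg by (auto elim!: eventually_mono)
qed

section \<open>The class and \<open>sigma_m\<close> in terms of finite sums\<close>

lemma ell_norm_le_1_iff:
  assumes "0 < q"
  shows "ell_norm (ennreal q) a \<le> 1 \<longleftrightarrow> (\<forall>F. finite F \<longrightarrow> (\<Sum>k\<in>F. norm (a k) powr q) \<le> 1)"
proof -
  define S where "S = (\<Sum>\<^sub>\<infinity>k. ennreal (norm (a k) powr q))"
  have "S = (SUP F\<in>{F. finite F \<and> F \<subseteq> UNIV}. \<Sum>k\<in>F. ennreal (norm (a k) powr q))"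
    unfolding S_def by (rule nonneg_infsum_complete) simp
  then have "S \<le> 1 \<longleftrightarrow> (\<forall>F. finite F \<longrightarrow> (\<Sum>k\<in>F. norm (a k) powr q) \<le> 1)"
    by (simp add: SUP_le_iff sum_ennreal ennreal_le_1)
  moreover have "ell_norm (ennreal q) a = ennreal_powr S (1 / q)"
    using assms by (simp add: ell_norm_def S_def)
  moreover have "ennreal_powr S (1 / q) \<le> 1 \<longleftrightarrow> S \<le> 1"
  proof
    assume *: "ennreal_powr S (1 / q) \<le> 1"
    show "S \<le> 1"
    proof (cases S)
      case (real s)
      then have "s powr (1 / q) \<le> 1" using * by (simp add: ennreal_powr_ennreal ennreal_le_1)
      then have "s \<le> 1" by (rule powr_le_1D[rotated]) (use assms in simp)
      then show ?thesis by (simp add: real ennreal_le_1)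
    qed (use * in \<open>simp add: ennreal_powr_def top_unique\<close>)
  next
    assume "S \<le> 1"
    then have "ennreal_powr S (1 / q) \<le> ennreal_powr (ennreal 1) (1 / q)"
      using assms by (intro ennreal_powr_mono) auto
    then show "ennreal_powr S (1 / q) \<le> 1" by (subst (asm) ennreal_powr_ennreal) auto
  qed
  ultimately show ?thesis by simp
qed

lemma Lp_space_1_integrable:
  fixes f :: "real ^ 'd::finite \<Rightarrow> complex"
  assumes "f \<in> Lp_space 1"
  shows "integrable torus_leb f"
proof -
  have fm: "f \<in> borel_measurable torus_leb" and fin: "Lp_norm 1 f < \<infinity>"
    using assms by (auto simp: Lp_space_def)
  have "(\<integral>\<^sup>+x. ennreal (norm (f x)) \<partial>torus_leb) < \<infinity>"
  proof (rule ccontr)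
    assume "\<not> ?thesis"
    then have "(\<integral>\<^sup>+x. ennreal (norm (f x)) \<partial>torus_leb) = \<infinity>" by (simp add: less_top[symmetric])
    then have "Lp_norm 1 f = \<infinity>"
      by (simp add: Lp_norm_def ennreal_powr_def ennreal_mult_top)
    with fin show False by simp
  qed
  with fm show ?thesis by (intro integrableI_bounded) auto
qed

lemma infinite_frequencies: "infinite (UNIV :: (int ^ 'd::finite) set)"
proof
  assume fin: "finite (UNIV :: (int ^ 'd) set)"
  define n where "n = card (UNIV :: (int ^ 'd) set)"
  have "(2 * n + 1) ^ 1 \<le> (2 * n + 1) ^ CARD('d)" by (intro power_increasing) (auto simp: Suc_le_eq)
  also have "\<dots> \<le> n" unfolding card_cube[symmetric] n_def by (intro card_mono fin) auto
  finally show False by simp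
qed

text \<open>\<open>Gam m\<close> demands exactly \<open>m\<close> frequencies, so
  \<open>\<gamma>\<close> is padded by further frequencies with zero coefficients; infinitely many
  are available.\<close>

lemma sigma_m_le:
  fixes N :: "(real ^ 'd::finite \<Rightarrow> complex) set"
  assumes "\<And>f. f \<in> N \<Longrightarrow> \<exists>g. trig_sparse m g \<and> Lp_norm p (\<lambda>x. f x - g x) \<le> E"
  shows "sigma_m m N p \<le> E"
  unfolding sigma_m_def
proof (rule SUP_least)
  fix f assume "f \<in> N"
  then obtain g where g: "trig_sparse m g" "Lp_norm p (\<lambda>x. f x - g x) \<le> E" using assms by blast
  then obtain \<gamma> b where \<gamma>: "finite \<gamma>" "card \<gamma> \<le> m" "g = trig_sum \<gamma> b"
    unfolding trig_sparse_def by blast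
  have "infinite (UNIV - \<gamma>)" using infinite_frequencies \<gamma>(1) by (simp add: Diff_infinite_finite)
  then obtain \<delta> where \<delta>: "finite \<delta>" "card \<delta> = m - card \<gamma>" "\<delta> \<subseteq> UNIV - \<gamma>"
    using infinite_arbitrarily_large by blast
  have "card (\<gamma> \<union> \<delta>) = m" using \<gamma>(1,2) \<delta> by (subst card_Un_disjoint) auto
  then have in_Gam: "\<gamma> \<union> \<delta> \<in> Gam m" using \<gamma>(1) \<delta>(1) by (simp add: Gam_def)
  define c where "c k = (if k \<in> \<gamma> then b k else 0)" for k
  have "g = trig_sum (\<gamma> \<union> \<delta>) c"
    unfolding \<gamma>(3) c_def using \<gamma>(1) \<delta>(1) by (intro ext sum.mono_neutral_cong_left) auto
  with g(2) have "Lp_norm p (\<lambda>x. f x - trig_sum (\<gamma> \<union> \<delta>) c x) \<le> E" by simp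
  then have "(INF c. Lp_norm p (\<lambda>x. f x - trig_sum (\<gamma> \<union> \<delta>) c x)) \<le> E"
    by (intro INF_lower2[of c]) auto
  then show "(INF \<gamma>\<in>Gam m. INF c. Lp_norm p (\<lambda>x. f x - trig_sum \<gamma> c x)) \<le> E"
    by (rule INF_lower2[OF in_Gam])
qed


subsection \<open>Both bounds\<close>

lemma F_class_coeffs:
  fixes f :: "real ^ 'd::finite \<Rightarrow> complex"
  assumes "f \<in> F_class \<psi> (ennreal q) r" "0 < q" "\<psi> \<in> class_B" "1 \<le> r" "finite F"
  shows "(\<Sum>k\<in>F. (norm (fourier_coeff f k) / Psi \<psi> r k) powr q) \<le> 1"
proof -
  have "norm (fourier_coeff f k / complex_of_real (Psi \<psi> r k)) = norm (fourier_coeff f k) / Psi \<psi> r k" for k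
    using Psi_pos[OF assms(3,4), of k] by (simp add: norm_divide)
  moreover have "(\<Sum>k\<in>F. norm (fourier_coeff f k / complex_of_real (Psi \<psi> r k)) powr q) \<le> 1"
    using assms(1,2,5) by (auto simp: F_class_def ell_norm_le_1_iff)
  ultimately show ?thesis by simp
qed

text \<open>The exponent of interest, a multiple of \<open>1 / 2 - 1 / q\<close>, can have either
  sign; \<open>\<bar>a\<bar>\<close> in the constant covers both. For negative \<open>a\<close> the
  case of \<open>\<bar>a\<bar>\<close> is multiplied by \<open>x powr a * y powr a\<close>.\<close>

lemma powr_comparable:
  fixes x y R a :: real
  assumes "0 < x" "x \<le> y" "y \<le> R * x"
  shows "x powr a \<le> R powr \<bar>a\<bar> * y powr a" "y powr a \<le> R powr \<bar>a\<bar> * x powr a"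
proof -
  have R: "1 \<le> R"
  proof -
    have "1 * x \<le> R * x" using assms by linarith
    then show ?thesis using assms(1) by (rule mult_right_le_imp_le)
  qed
  then have R1: "1 \<le> R powr \<bar>a\<bar>" by (simp add: ge_one_powr_ge_zero)
  have pos: "0 < y" using assms by linarith
  have t1: "1 * z powr a \<le> R powr \<bar>a\<bar> * z powr a" for z using R1 by (intro mult_right_mono) auto
  have t2: "R powr \<bar>a\<bar> * x powr \<bar>a\<bar> \<ge> y powr \<bar>a\<bar>"
    using assms pos powr_mono2[of "\<bar>a\<bar>" y "R * x"] by (simp add: powr_mult)
  have "x powr a \<le> R powr \<bar>a\<bar> * y powr a \<and> y powr a \<le> R powr \<bar>a\<bar> * x powr a"
  proof (cases "0 \<le> a")
    case True
    then have "x powr a \<le> y powr a" using assms by (intro powr_mono2) auto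
    with t1[of y] t2 True show ?thesis by auto
  next
    case False
    then have le: "y powr a \<le> x powr a" using assms by (intro powr_mono2') auto
    have "y powr \<bar>a\<bar> * (x powr a * y powr a) \<le> R powr \<bar>a\<bar> * x powr \<bar>a\<bar> * (x powr a * y powr a)"
      using t2 by (intro mult_right_mono) auto
    moreover have "y powr \<bar>a\<bar> * y powr a = 1" "x powr \<bar>a\<bar> * x powr a = 1"
      using False pos assms(1) by (simp_all flip: powr_add)
    moreover have "u * (x powr a * y powr a) = x powr a * (u * y powr a)"
      "v * u * (x powr a * y powr a) = v * ((u * x powr a) * y powr a)" for u v by (simp_all only: mult_ac)
    ultimately have "x powr a \<le> R powr \<bar>a\<bar> * y powr a" by (simp only: mult_1 mult_1_right)
    with t1[of x] le show ?thesis by auto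
  qed
  then show "x powr a \<le> R powr \<bar>a\<bar> * y powr a" "y powr a \<le> R powr \<bar>a\<bar> * x powr a" by auto
qed

text \<open>The test function is a multiple of the Dirichlet kernel of \<open>cube n\<close>, with
  \<open>n\<close> about \<open>m^(1/d)\<close>. The size \<open>c\<close> of the cube lies between
  \<open>2 * m\<close> and \<open>5 ^ ?D * m\<close>, so at least \<open>m\<close> coefficients of
  size \<open>\<epsilon>\<close> survive any choice of \<open>m\<close> frequencies, which leaves an
  L2 norm of at least \<open>\<epsilon> * sqrt m\<close>.\<close>

lemma sigma_m_lower_bound:
  fixes \<psi> :: "real \<Rightarrow> real" and p r :: ennreal
  assumes B: "\<psi> \<in> class_B" and r: "1 \<le> r" and q: "0 < q" and p: "2 < p"
  shows "\<exists>K>0. \<forall>m\<ge>1. ennreal (K * (\<psi> (real m powr (1 / real CARD('d))) * real m powr (1 / 2 - 1 / q)))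
    \<le> sigma_m m (F_class \<psi> (ennreal q) r :: (real ^ 'd::finite \<Rightarrow> complex) set) p"
proof -
  let ?D = "CARD('d)"
  obtain Kd where Kd: "1 \<le> Kd" "\<And>v u. 1 \<le> v \<Longrightarrow> v \<le> u \<Longrightarrow> u \<le> 2 * real ?D * v \<Longrightarrow> \<psi> v \<le> Kd * \<psi> u"
    using class_B_dilation[OF B, of "2 * real ?D"] by blast
  define K where "K = (5 ^ ?D) powr (- 1 / q) / Kd"
  have "ennreal (K * (\<psi> (real m powr (1 / real ?D)) * real m powr (1 / 2 - 1 / q)))
    \<le> sigma_m m (F_class \<psi> (ennreal q) r :: (real ^ 'd \<Rightarrow> complex) set) p" if m: "1 \<le> m" for m
  proof -
    define X where "X = real m powr (1 / real ?D)"
    have X1: "1 \<le> X" unfolding X_def using m by (intro ge_one_powr_ge_zero) auto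
    have XD: "X ^ ?D = real m"
      using X1 m by (simp add: X_def powr_realpow[symmetric] powr_powr)
    define n where "n = nat \<lceil>X\<rceil>"
    have n: "X \<le> real n" "real n \<le> 2 * X" using X1 unfolding n_def by linarith+
    define c where "c = real (card (cube n :: (int ^ 'd) set))"
    have c_eq: "c = (2 * real n + 1) ^ ?D" by (simp add: c_def card_cube add.commute)
    have "2 ^ 1 * real m \<le> 2 ^ ?D * X ^ ?D"
      unfolding XD by (intro mult_right_mono power_increasing) (auto simp: Suc_le_eq)
    also have "\<dots> \<le> c" unfolding c_eq power_mult_distrib[symmetric] using n X1 by (intro power_mono) auto
    finally have c2: "2 * real m \<le> c" by simp
    have "c \<le> (5 * X) ^ ?D" unfolding c_eq using n X1 by (intro power_mono) auto
    then have c5: "c \<le> 5 ^ ?D * real m" by (simp add: power_mult_distrib XD)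
    have c0: "0 < c" using c2 m by simp
    define Dn where "Dn = real ?D * real n"
    have D1: "1 \<le> real ?D" by (simp add: Suc_le_eq)
    have Dn: "1 \<le> Dn" "X \<le> Dn" "Dn \<le> 2 * real ?D * X"
    proof -
      have "1 * X \<le> Dn" unfolding Dn_def using D1 n X1 by (intro mult_mono) auto
      then show "1 \<le> Dn" "X \<le> Dn" using X1 by auto
      have "Dn \<le> real ?D * (2 * X)" unfolding Dn_def using n by (intro mult_left_mono) auto
      then show "Dn \<le> 2 * real ?D * X" by (simp add: mult_ac)
    qed
    \<comment> \<open>\<open>Dn\<close> bounds \<open>index_norm r\<close> on the cube, so the
      weights there are at least \<open>\<psi> Dn\<close>; the power of \<open>c\<close> makes the
      lq norm of the weighted coefficients at most 1.\<close>
    define \<epsilon> where "\<epsilon> = \<psi> Dn * c powr (- 1 / q)"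
    have psiD: "0 < \<psi> Dn" using class_B_pos[OF B Dn(1)] .
    have \<epsilon>: "0 < \<epsilon>" using psiD c0 by (simp add: \<epsilon>_def)
    define f where "f x = (\<Sum>k\<in>cube n. of_real \<epsilon> * trig_exp k x)" for x :: "real ^ 'd"
    have fc: "fourier_coeff f k = (if k \<in> cube n then of_real \<epsilon> else 0)" for k
      unfolding f_def by (rule fourier_coeff_trig_sum) simp
    have Psi_lower: "\<psi> Dn \<le> Psi \<psi> r k" if "k \<in> cube n" for k :: "int ^ 'd"
    proof (cases "k = 0")
      case True
      then show ?thesis using class_B_antimono[OF B, of 1 Dn] Dn(1) by (simp add: Psi_def)
    next
      case False
      then show ?thesis
        using class_B_antimono[OF B index_norm_ge_1[OF r False] index_norm_le[OF r that, folded Dn_def]]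
        by (simp add: Psi_def)
    qed
    have "f \<in> F_class \<psi> (ennreal q) r"
    proof -
      have "periodic f"
        unfolding periodic_def f_def by (simp add: periodic_trig_exp[unfolded periodic_def, rule_format])
      moreover have fm: "f \<in> borel_measurable torus_leb"
        unfolding f_def[abs_def] by (rule trig_sum_measurable)
      moreover have "Lp_norm 1 f \<le> ennreal (\<Sum>k\<in>(cube n :: (int ^ 'd) set). norm (complex_of_real \<epsilon>))"
        unfolding f_def[abs_def]
        by (intro Lp_norm_le AE_I2 trig_sum_norm_le trig_sum_measurable sum_nonneg) auto
      then have "Lp_norm 1 f < \<infinity>" by (rule le_less_trans) simp
      moreover have "ell_norm (ennreal q) (\<lambda>k. fourier_coeff f k / complex_of_real (Psi \<psi> r k)) \<le> 1"
        unfolding ell_norm_le_1_iff[OF q]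
      proof (intro allI impI)
        fix F :: "(int ^ 'd) set" assume F: "finite F"
        define u where "u k = fourier_coeff f k / complex_of_real (Psi \<psi> r k)" for k
        have summand: "norm (u k) powr q \<le> (if k \<in> cube n then 1 / c else 0)" for k
        proof (cases "k \<in> cube n")
          case True
          have "norm (u k) = \<epsilon> / Psi \<psi> r k"
            using True \<epsilon> Psi_pos[OF B r, of k] by (simp add: u_def fc norm_divide)
          also have "\<dots> \<le> \<epsilon> / \<psi> Dn"
            using \<epsilon> psiD Psi_lower[OF True] by (intro divide_left_mono) auto
          also have "\<dots> = c powr (- 1 / q)" using psiD by (simp add: \<epsilon>_def)
          finally have "norm (u k) powr q \<le> (c powr (- 1 / q)) powr q"
            using q by (intro powr_mono2) auto
          also have "\<dots> = c powr (- 1)" using q by (simp add: powr_powr)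
          also have "\<dots> = 1 / c" using c0 by (simp add: powr_minus inverse_eq_divide)
          finally show ?thesis using True by simp
        qed (simp add: u_def fc)
        have "(\<Sum>k\<in>F. norm (u k) powr q)
            \<le> (\<Sum>k\<in>F. if k \<in> cube n then 1 / c else 0)" by (intro sum_mono summand)
        also have "\<dots> = (\<Sum>k\<in>F \<inter> cube n. 1 / c)" by (rule sum.inter_restrict[symmetric, OF F])
        also have "\<dots> \<le> (\<Sum>k\<in>(cube n :: (int ^ 'd) set). 1 / c)" using c0 by (intro sum_mono2) auto
        also have "\<dots> = 1" using c0 by (simp add: c_def)
        finally show "(\<Sum>k\<in>F. norm (fourier_coeff f k / complex_of_real (Psi \<psi> r k)) powr q) \<le> 1"
          by (simp add: u_def)
      qed
      ultimately show ?thesis by (simp add: F_class_def Lp_space_def)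
    qed
    have err: "ennreal (\<epsilon> * sqrt (real m)) \<le> Lp_norm p (\<lambda>x. f x - trig_sum \<gamma> a x)"
      if \<gamma>: "\<gamma> \<in> Gam m" for \<gamma> and a :: "int ^ 'd \<Rightarrow> complex"
    proof -
      have g: "finite \<gamma>" "card \<gamma> = m" using \<gamma> by (auto simp: Gam_def)
      define b where "b k = (if k \<in> cube n then of_real \<epsilon> else 0) - (if k \<in> \<gamma> then a k else 0)" for k
      define U where "U = cube n \<union> \<gamma>"
      have U: "finite U" using g(1) by (simp add: U_def)
      have h: "f x - trig_sum \<gamma> a x = trig_sum U b x" for x
      proof -
        have "f x = (\<Sum>k\<in>U. (if k \<in> cube n then of_real \<epsilon> else 0) * trig_exp k x)"
          unfolding f_def U_def using g(1) by (intro sum.mono_neutral_cong_left) auto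
        moreover have "trig_sum \<gamma> a x = (\<Sum>k\<in>U. (if k \<in> \<gamma> then a k else 0) * trig_exp k x)"
          unfolding U_def using g(1) by (intro sum.mono_neutral_cong_left) auto
        ultimately show ?thesis by (simp add: b_def left_diff_distrib sum_subtractf)
      qed
      have "real (card (cube n :: (int ^ 'd) set)) \<le> real (card (cube n - \<gamma>) + card \<gamma>)"
        using diff_card_le_card_Diff[OF g(1), of "cube n"] by simp
      then have cc: "real m \<le> real (card (cube n - \<gamma>))" using c2 g(2) by (simp add: c_def)
      have "\<epsilon>\<^sup>2 * real m \<le> (\<Sum>k\<in>cube n - \<gamma>. \<epsilon>\<^sup>2)" using mult_left_mono[OF cc, of "\<epsilon>\<^sup>2"] by (simp add: mult.commute)
      also have "\<dots> = (\<Sum>k\<in>cube n - \<gamma>. (norm (b k))\<^sup>2)" by (intro sum.cong) (auto simp: b_def)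
      also have "\<dots> \<le> (\<Sum>k\<in>U. (norm (b k))\<^sup>2)" using U by (intro sum_mono2) (auto simp: U_def)
      finally have "(2 * pi) ^ ?D * (\<epsilon> * sqrt (real m))\<^sup>2 \<le> (2 * pi) ^ ?D * (\<Sum>k\<in>U. (norm (b k))\<^sup>2)"
        by (intro mult_left_mono) (simp_all add: power_mult_distrib)
      then have "(2 * pi) ^ ?D * (\<epsilon> * sqrt (real m))\<^sup>2 \<le> (LINT x|torus_leb. (norm (trig_sum U b x))\<^sup>2)"
        unfolding torus_parseval[OF U] .
      then show ?thesis
        unfolding h using \<epsilon> m by (intro Lp_norm_ge_L2[OF trig_sum_measurable trig_sum_norm_le p]) auto
    qed
    have "K * (\<psi> X * real m powr (1 / 2 - 1 / q)) \<le> \<epsilon> * sqrt (real m)"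
    proof -
      have "\<psi> X / Kd \<le> \<psi> Dn" using Kd(2)[OF X1 Dn(2,3)] Kd(1) by (simp add: divide_le_eq mult.commute)
      moreover have "(5 ^ ?D * real m) powr (- 1 / q) \<le> c powr (- 1 / q)" using c0 c5 q by (intro powr_mono2') auto
      ultimately have "\<psi> X / Kd * (5 ^ ?D * real m) powr (- 1 / q) \<le> \<epsilon>"
        unfolding \<epsilon>_def using psiD by (intro mult_mono) auto
      then have "\<psi> X / Kd * (5 ^ ?D * real m) powr (- 1 / q) * sqrt (real m) \<le> \<epsilon> * sqrt (real m)"
        by (intro mult_right_mono) auto
      moreover have "real m powr (1 / 2 - 1 / q) = real m powr (- 1 / q) * sqrt (real m)"
        by (simp add: powr_half_sqrt[symmetric] flip: powr_add)
      ultimately show ?thesis by (simp add: K_def powr_mult mult_ac)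
    qed
    then have "ennreal (K * (\<psi> X * real m powr (1 / 2 - 1 / q))) \<le> ennreal (\<epsilon> * sqrt (real m))" by (rule ennreal_leI)
    also have "\<dots> \<le> (INF \<gamma>\<in>Gam m. INF a. Lp_norm p (\<lambda>x. f x - trig_sum \<gamma> a x))"
      by (intro INF_greatest err)
    also have "\<dots> \<le> sigma_m m (F_class \<psi> (ennreal q) r :: (real ^ 'd \<Rightarrow> complex) set) p"
      unfolding sigma_m_def using \<open>f \<in> F_class \<psi> (ennreal q) r\<close> by (rule SUP_upper)
    finally show ?thesis unfolding X_def .
  qed
  moreover have "0 < K" using Kd(1) by (simp add: K_def)
  ultimately show ?thesis by blast
qed

text \<open>For \<open>m \<ge> C0\<close> the largest level \<open>\<nu>\<close> whose budget
  \<open>C0 * 2 ^ (?D * \<nu>)\<close> fits into \<open>m\<close> is used; then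
  \<open>2 ^ \<nu>\<close> and \<open>m^(1/d)\<close> are comparable. For the finitely many smaller
  \<open>m\<close> the zero function and the bound \<open>K0\<close> suffice, since the target
  quantity stays above \<open>L\<close>.\<close>

lemma sigma_m_upper_bound:
  fixes \<psi> :: "real \<Rightarrow> real" and p r :: ennreal
  assumes B: "\<psi> \<in> class_B" and r: "1 \<le> r" and q: "0 < q" and p: "0 < p" and C: "1 \<le> C"
    and decay: "\<And>v u. 1 \<le> v \<Longrightarrow> v \<le> u \<Longrightarrow> \<psi> u \<le> C * (v / u) powr b * \<psi> v"
    and b: "real CARD('d) * max 0 (1 - 1 / q) < b"
  shows "\<exists>K>0. \<forall>m\<ge>1. sigma_m m (F_class \<psi> (ennreal q) r :: (real ^ 'd::finite \<Rightarrow> complex) set) p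
    \<le> ennreal (K * (\<psi> (real m powr (1 / real CARD('d))) * real m powr (1 / 2 - 1 / q)))"
proof -
  let ?D = "CARD('d)"
  let ?P = "\<lambda>f T. trig_sum (cube (2 ^ T)) (fourier_coeff f)"
  interpret weight_decay \<psi> r q b C "max 0 (1 - 1 / q)" "1 / 2 - 1 / q" "TYPE('d)"
    by unfold_locales (use assms in auto)
  define e where "e = 1 / 2 - 1 / q"
  let ?N = "F_class \<psi> (ennreal q) r :: (real ^ 'd \<Rightarrow> complex) set"
  obtain C0 C1 where C01: "0 < C0" "0 < C1" and approx: "\<And>\<nu> a. unit_coeffs a \<Longrightarrow>
    \<exists>g S. trig_sparse (C0 * 2 ^ (?D * \<nu>)) g \<and>
      (\<forall>T\<ge>S. \<forall>x. norm (trig_sum (cube (2 ^ (\<nu> + T))) a x - g x)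
         \<le> C1 * (\<psi> (2 ^ \<nu>) * 2 powr (real ?D * real \<nu> * e)))"
    using sparse_upper_bound unfolding e_def by blast
  obtain K0 where K0: "\<And>a F. unit_coeffs a \<Longrightarrow> finite F \<Longrightarrow> (\<Sum>k\<in>F. norm (a k)) \<le> K0"
    using l1_bounded by blast
  have K0_nonneg: "0 \<le> K0" using K0[of "\<lambda>_. 0" "{}"] q by (simp add: unit_coeffs_def)
  have unit: "unit_coeffs (fourier_coeff f)" if "f \<in> ?N" for f
    unfolding unit_coeffs_def using F_class_coeffs[OF that q B r] by blast
  have int: "integrable torus_leb f" if "f \<in> ?N" for f
    using that by (intro Lp_space_1_integrable) (simp add: F_class_def)
  have series: "AE x in torus_leb. (\<lambda>T. ?P f T x) \<longlonglongrightarrow> f x" if "f \<in> ?N" for f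
    using int[OF that] K0[OF unit[OF that]] by (rule fourier_series_AE)
  have sparse_meas: "g \<in> borel_measurable torus_leb" if "trig_sparse m g" for m and g :: "real ^ 'd \<Rightarrow> complex"
    using that unfolding trig_sparse_def by (auto simp: trig_sum_measurable)
  have sig: "sigma_m m ?N p \<le> ennreal \<eta>"
    if "0 \<le> \<eta>" and ex: "\<And>f. f \<in> ?N \<Longrightarrow> \<exists>g S. trig_sparse m g \<and>
      (\<forall>T\<ge>S. \<forall>x. norm (?P f T x - g x) \<le> \<eta>)" for m \<eta>
  proof (rule sigma_m_le)
    fix f assume f: "f \<in> ?N"
    obtain g S where g: "trig_sparse m g"
      "\<And>T x. S \<le> T \<Longrightarrow> norm (?P f T x - g x) \<le> \<eta>"
      using ex[OF f] by blast
    \<comment> \<open>A bound valid for all large partial sums is inherited by their limit, which is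
      \<open>f x\<close> for almost every \<open>x\<close>.\<close>
    have "AE x in torus_leb. norm (f x - g x) \<le> \<eta>"
    proof (rule eventually_mono[OF series[OF f]])
      fix x assume "(\<lambda>T. ?P f T x) \<longlonglongrightarrow> f x"
      then have "(\<lambda>T. norm (?P f T x - g x)) \<longlonglongrightarrow> norm (f x - g x)"
        by (intro tendsto_norm tendsto_diff tendsto_const)
      then show "norm (f x - g x) \<le> \<eta>"
        by (rule LIMSEQ_le_const2) (use g(2) in blast)
    qed
    then have "Lp_norm p (\<lambda>x. f x - g x) \<le> ennreal \<eta>"
      using int[OF f] sparse_meas[OF g(1)] p \<open>0 \<le> \<eta>\<close> by (intro Lp_norm_le) auto
    with g(1) show "\<exists>g. trig_sparse m g \<and> Lp_norm p (\<lambda>x. f x - g x) \<le> ennreal \<eta>" by blast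
  qed
  \<comment> \<open>The 2 comes from rounding the logarithm down to \<open>\<nu>\<close>, the other
    factor from the constant \<open>C0\<close> in the budget.\<close>
  define R where "R = 2 * real C0 powr (1 / real ?D)"
  have C0R: "1 \<le> real C0 powr (1 / real ?D)" using C01(1) by (intro ge_one_powr_ge_zero) auto
  then have R: "1 \<le> R" by (simp add: R_def)
  obtain Kd where Kd: "1 \<le> Kd" "\<And>v u. 1 \<le> v \<Longrightarrow> v \<le> u \<Longrightarrow> u \<le> R * v \<Longrightarrow> \<psi> v \<le> Kd * \<psi> u"
    using class_B_dilation[OF B, of R] by blast
  define K1 where "K1 = C1 * Kd * R powr \<bar>real ?D * e\<bar>"
  define L where "L = \<psi> (real C0 powr (1 / real ?D)) / real C0 powr \<bar>e\<bar>"
  have L: "0 < L" unfolding L_def using class_B_pos[OF B C0R] C01(1) by simp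
  have K1: "0 < K1" using C01(2) Kd(1) R by (simp add: K1_def)
  have "sigma_m m ?N p \<le> ennreal ((K1 + K0 / L) * (\<psi> (real m powr (1 / real ?D)) * real m powr e))" if m: "1 \<le> m" for m
  proof -
    define X where "X = real m powr (1 / real ?D)"
    have X1: "1 \<le> X" unfolding X_def using m by (intro ge_one_powr_ge_zero) auto
    have Xe: "X powr (real ?D * e) = real m powr e"
      using m by (simp add: X_def powr_powr)
    have psiX: "0 < \<psi> X" using class_B_pos[OF B X1] .
    define M where "M = \<psi> X * real m powr e"
    have M: "0 < M" using psiX m by (simp add: M_def)
    show ?thesis
    proof (cases "m < C0")
      case True
      have "sigma_m m ?N p \<le> ennreal K0"
      proof (rule sig[OF K0_nonneg])
        fix f assume f: "f \<in> ?N"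
        have "norm (?P f T x - 0) \<le> K0" for T x
          using order_trans[OF trig_sum_norm_le K0[OF unit[OF f] finite_cube]] by simp
        then show "\<exists>g S. trig_sparse m g \<and>
          (\<forall>T\<ge>S. \<forall>x. norm (?P f T x - g x) \<le> K0)"
          by (intro exI[of _ "\<lambda>x. 0"] exI[of _ 0] conjI trig_sparse_zero) blast
      qed
      also have "ennreal K0 \<le> ennreal ((K1 + K0 / L) * M)"
      proof (rule ennreal_leI)
        have "X \<le> real C0 powr (1 / real ?D)" unfolding X_def using True by (intro powr_mono2) auto
        then have "\<psi> (real C0 powr (1 / real ?D)) \<le> \<psi> X" by (rule class_B_antimono[OF B X1])
        moreover have "1 / real C0 powr \<bar>e\<bar> \<le> real m powr e"
        proof -
          have "real m powr \<bar>e\<bar> \<le> real C0 powr \<bar>e\<bar>" using True by (intro powr_mono2) auto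
          then have "1 / real C0 powr \<bar>e\<bar> \<le> 1 / real m powr \<bar>e\<bar>" using m C01(1) by (intro divide_left_mono mult_pos_pos) auto
          also have "\<dots> = real m powr (- \<bar>e\<bar>)" by (simp add: powr_minus inverse_eq_divide)
          also have "\<dots> \<le> real m powr e" using m by (intro powr_mono) auto
          finally show ?thesis .
        qed
        ultimately have "\<psi> (real C0 powr (1 / real ?D)) * (1 / real C0 powr \<bar>e\<bar>) \<le> \<psi> X * real m powr e"
          using psiX by (intro mult_mono) auto
        then have "L \<le> M" by (simp add: L_def M_def)
        then have "K0 / L * L \<le> (K1 + K0 / L) * M" using K0_nonneg K1 L by (intro mult_mono) auto
        then show "K0 \<le> (K1 + K0 / L) * M" using L by simp
      qed
      finally show ?thesis by (simp add: M_def X_def)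
    next
      case False
      define y where "y = (real m / real C0) powr (1 / real ?D)"
      have y1: "1 \<le> y" unfolding y_def using False C01(1) by (intro ge_one_powr_ge_zero) auto
      define \<nu> where "\<nu> = nat \<lfloor>log 2 y\<rfloor>"
      have l0: "0 \<le> log 2 y" using y1 by simp
      have "real \<nu> \<le> log 2 y" "log 2 y \<le> real (Suc \<nu>)" using l0 unfolding \<nu>_def by linarith+
      then have "2 powr real \<nu> \<le> y" "y \<le> 2 powr real (Suc \<nu>)" using y1 by (simp_all add: le_log_iff log_le_iff)
      then have \<nu>: "2 ^ \<nu> \<le> y" "y \<le> 2 * 2 ^ \<nu>" by (simp_all only: powr_realpow power_Suc zero_less_numeral)
      have "y ^ ?D = real m / real C0"
        using m C01(1) by (simp add: y_def powr_realpow[symmetric] powr_powr)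
      moreover have "(2 ^ \<nu>) ^ ?D \<le> y ^ ?D" using \<nu>(1) by (intro power_mono) auto
      ultimately have "real C0 * 2 ^ (?D * \<nu>) \<le> real m"
        using C01(1) by (simp add: pos_le_divide_eq mult.commute flip: power_mult)
      then have Cm: "C0 * 2 ^ (?D * \<nu>) \<le> m"
        by (metis of_nat_le_iff of_nat_mult of_nat_numeral of_nat_power)
      have Xy: "X = y * real C0 powr (1 / real ?D)"
        using C01(1) by (simp add: X_def y_def powr_divide)
      have nX: "2 ^ \<nu> \<le> X" "X \<le> R * 2 ^ \<nu>"
      proof -
        have "2 ^ \<nu> * 1 \<le> X" unfolding Xy using \<nu>(1) C0R y1 by (intro mult_mono) auto
        then show "2 ^ \<nu> \<le> X" by simp
        have "X \<le> 2 * 2 ^ \<nu> * real C0 powr (1 / real ?D)" unfolding Xy using \<nu>(2) by (intro mult_right_mono) auto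
        then show "X \<le> R * 2 ^ \<nu>" by (simp add: R_def mult_ac)
      qed
      define \<eta> where "\<eta> = C1 * (\<psi> (2 ^ \<nu>) * 2 powr (real ?D * real \<nu> * e))"
      have \<eta>0: "0 \<le> \<eta>" using C01(2) psi_pos[of \<nu>] by (simp add: \<eta>_def)
      have "sigma_m m ?N p \<le> ennreal \<eta>"
      proof (rule sig[OF \<eta>0])
        fix f assume f: "f \<in> ?N"
        obtain g S where g: "trig_sparse (C0 * 2 ^ (?D * \<nu>)) g"
          "\<And>T x. S \<le> T \<Longrightarrow> norm (trig_sum (cube (2 ^ (\<nu> + T))) (fourier_coeff f) x - g x) \<le> \<eta>"
          using approx[OF unit[OF f], of \<nu>] unfolding \<eta>_def by blast
        have "norm (?P f T x - g x) \<le> \<eta>" if "\<nu> + S \<le> T" for T x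
          using g(2)[of "T - \<nu>" x] that by simp
        with trig_sparse_mono[OF g(1) Cm] show "\<exists>g S. trig_sparse m g \<and>
          (\<forall>T\<ge>S. \<forall>x. norm (?P f T x - g x) \<le> \<eta>)" by blast
      qed
      also have "ennreal \<eta> \<le> ennreal ((K1 + K0 / L) * M)"
      proof (rule ennreal_leI)
        have "\<psi> (2 ^ \<nu>) \<le> Kd * \<psi> X" using nX by (intro Kd(2)) auto
        moreover have "2 powr (real ?D * real \<nu> * e) \<le> R powr \<bar>real ?D * e\<bar> * real m powr e"
        proof -
          have "2 powr (real ?D * real \<nu> * e) = (2 ^ \<nu>) powr (real ?D * e)"
            by (simp add: powr_realpow[symmetric] powr_powr mult_ac)
          also have "\<dots> \<le> R powr \<bar>real ?D * e\<bar> * X powr (real ?D * e)"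
            using nX by (intro powr_comparable(1)) auto
          finally show ?thesis unfolding Xe .
        qed
        ultimately have "\<psi> (2 ^ \<nu>) * 2 powr (real ?D * real \<nu> * e) \<le> Kd * \<psi> X * (R powr \<bar>real ?D * e\<bar> * real m powr e)"
          using Kd(1) psiX by (intro mult_mono) auto
        then have "\<eta> \<le> C1 * (Kd * \<psi> X * (R powr \<bar>real ?D * e\<bar> * real m powr e))"
          unfolding \<eta>_def using C01(2) by (intro mult_left_mono) auto
        also have "\<dots> = K1 * M" by (simp only: K1_def M_def mult_ac)
        also have "\<dots> \<le> (K1 + K0 / L) * M" using M K0_nonneg L by (intro mult_right_mono) auto
        finally show "\<eta> \<le> (K1 + K0 / L) * M" .
      qed
      finally show ?thesis by (simp add: M_def X_def)
    qed
  qed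
  moreover have "0 < K1 + K0 / L" using K1 K0_nonneg L by (simp add: add_pos_nonneg)
  ultimately show ?thesis unfolding e_def by blast
qed

theorem theorem6:
  fixes p r :: ennreal and q \<beta> t0 :: real and \<psi> :: "real \<Rightarrow> real"
  assumes "1 \<le> r" and "2 < p" and "0 < q"
    and "\<psi> \<in> class_B"
    and "1 \<le> t0"
    and "convex_on {t0<..} \<psi>"
    and "\<And>t. t > t0 \<Longrightarrow> t * \<bar>right_deriv \<psi> t\<bar> / \<psi> t \<ge> \<beta>"
    and "\<beta> > real CARD('d) * max 0 (1 - 1 / q)"
  shows "(\<lambda>m. sigma_m m (F_class \<psi> (ennreal q) r :: (real ^ 'd::finite \<Rightarrow> complex) set) p)
           \<asymp> (\<lambda>m. \<psi> (real m powr (1 / real CARD('d))) * real m powr (1 / 2 - 1 / q))"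
proof -
  \<comment> \<open>The midpoint is positive even if the lower limit is 0, as
    \<open>class_B_decay\<close> requires.\<close>
  have "\<exists>b>0. b < \<beta> \<and> x < b" if "0 \<le> x" "x < \<beta>" for x
    using that by (intro exI[of _ "(x + \<beta>) / 2"]) auto
  from this[OF _ assms(8)] obtain b where b: "0 < b" "b < \<beta>" "real CARD('d) * max 0 (1 - 1 / q) < b"
    by auto
  obtain C where C: "1 \<le> C" "\<And>v u. 1 \<le> v \<Longrightarrow> v \<le> u \<Longrightarrow> \<psi> u \<le> C * (v / u) powr b * \<psi> v"
    using class_B_decay[OF assms(4-7) b(1,2)] by blast
  let ?\<sigma> = "\<lambda>m. sigma_m m (F_class \<psi> (ennreal q) r :: (real ^ 'd \<Rightarrow> complex) set) p"
  let ?b = "\<lambda>m. \<psi> (real m powr (1 / real CARD('d))) * real m powr (1 / 2 - 1 / q)"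
  obtain K1 where K1: "0 < K1" "\<And>m. 1 \<le> m \<Longrightarrow> ennreal (K1 * ?b m) \<le> ?\<sigma> m"
    using sigma_m_lower_bound[OF assms(4,1,3,2), where 'd = 'd] by blast
  have "0 < p" using assms(2) by (rule le_less_trans[rotated]) simp
  then obtain K2 where K2: "0 < K2" "\<And>m. 1 \<le> m \<Longrightarrow> ?\<sigma> m \<le> ennreal (K2 * ?b m)"
    using sigma_m_upper_bound[OF assms(4,1,3) _ C b(3)] by blast
  \<comment> \<open>The larger constant \<open>K1 + K2\<close> provides the strict inequality
    between the two constants in \<open>same_order\<close>.\<close>
  have "?\<sigma> m \<le> ennreal ((K1 + K2) * ?b m)" if m: "1 \<le> m" for m
  proof -
    have "1 \<le> real m powr (1 / real CARD('d))" using m by (intro ge_one_powr_ge_zero) auto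
    then have "0 \<le> ?b m" using class_B_pos[OF assms(4)] by (intro mult_nonneg_nonneg) (auto intro: less_imp_le)
    then have "K2 * ?b m \<le> (K1 + K2) * ?b m" using K1(1) by (intro mult_right_mono) auto
    then show ?thesis using K2(2)[OF m] by (meson ennreal_leI order_trans)
  qed
  then show ?thesis
    unfolding same_order_def using K1 K2(1) by (intro exI[of _ K1] exI[of _ "K1 + K2"]) auto
qed

end
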